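(* Let $T>0$, let $B$, $Y$ be Banach spaces and let $M_+$ be a seminormed nonnegative cone in $B$ (with function $[\cdot]$) such that $M_+\cap Y\neq\emptyset$. Let $1\le p\le\infty$. Assume that: (i) $M_+\hookrightarrow B$ compactly. (ii) For all sequences $(w_n)\subset B$: if $w_n\to w$ in $B$ and $w_n\to 0$ in $Y$ as $n\to\infty$, then $w=0$. (iii) $U\subset L^p(0,T;M_+\cap Y)$ is bounded in $L^p(0,T;M_+)$. (iv) $\|\sigma_h u-u\|_{L^p(0,T-h;Y)}\to 0$ as $h\to 0$ (with $h>0$), uniformly in $u\in U$. Then $U$ is relatively compact in $L^p(0,T;B)$, and, if $p=\infty$, also in $C^0([0,T];B)$.
   Context: Seminormed nonnegative cone: $M_+$ is a seminormed nonnegative cone in a Banach space $B$ if $M_+\subset B$; $cu\in M_+$ for all $u\in M_+$ and $c\ge 0$; and there is a function $[\cdot]:M_+\to[0,\infty)$ such that $[u]=0$ if and only if $u=0$, and $[cu]=c[u]$ for all $c\ge 0$, $u\in M_+$. (No convexity of $M_+$ and no triangle inequality for $[\cdot]$ is assumed.) Embeddings: $M_+\hookrightarrow B$ continuously means that there is $C>0$ with $\|u\|_B\le C[u]$ for all $u\in M_+$. $M_+\hookrightarrow B$ compactly means that every sequence $(u_n)\subset M_+$ with $\sup_n[u_n]<\infty$ has a subsequence converging in $B$. Conventions: $B$ and $Y$ are regarded as linear subspaces of a common vector space, so that $B\cap Y$ and $M_+\cap Y$ make sense; "$w_n\to 0$ in $Y$" includes $w_n\in Y$. No embedding of $B$ into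 $Y$ is assumed. $L^p(0,T;M_+)$ is the set of strongly measurable $u:(0,T)\to B$ with $u(t)\in M_+$ for a.e. $t$, $t\mapsto[u(t)]$ measurable, and $\|u\|_{L^p(0,T;M_+)}:=\big\|\,t\mapsto[u(t)]\,\big\|_{L^p(0,T)}<\infty$; bounded means that these quantities are uniformly bounded. $L^p(0,T;M_+\cap Y):=L^p(0,T;M_+)\cap L^p(0,T;Y)$. The time shift is $(\sigma_h u)(t)=u(t+h)$. For $p=\infty$, functions are identified with their continuous representatives when relative compactness in $C^0([0,T];B)$ is asserted. *)

theory Defs
  imports "HOL-Analysis.Analysis" "HOL-Probability.Essential_Supremum"
begin

definition seminormed_nonneg_cone :: "'b::real_normed_vector set \<Rightarrow> ('b \<Rightarrow> real) \<Rightarrow> bool" where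
  "seminormed_nonneg_cone M s \<longleftrightarrow>
     (\<forall>u\<in>M. \<forall>c\<ge>0. c *\<^sub>R u \<in> M) \<and>
     (\<forall>u\<in>M. 0 \<le> s u) \<and>
     (\<forall>u\<in>M. s u = 0 \<longleftrightarrow> u = 0) \<and>
     (\<forall>u\<in>M. \<forall>c\<ge>0. s (c *\<^sub>R u) = c * s u)"

definition cone_compactly_embedded :: "'b::real_normed_vector set \<Rightarrow> ('b \<Rightarrow> real) \<Rightarrow> bool" where
  "cone_compactly_embedded M s \<longleftrightarrow>
     (\<forall>u::nat \<Rightarrow> 'b. range u \<subseteq> M \<and> bdd_above (range (\<lambda>n. s (u n))) \<longrightarrow>
        (\<exists>r. strict_mono r \<and> convergent (u \<circ> r)))"

text \<open>
  Two Banach spaces that are linear subspaces of a common vector space are represented by types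
  \<open>'b\<close>, \<open>'y\<close> with injective linear maps \<open>iB\<close>, \<open>iY\<close> into a common real vector space; these maps
  carry no topology. An element \<open>b\<close> lies in the intersection iff \<open>iB b \<in> range iY\<close>, and then
  \<open>as_Y iB iY b\<close> is the same element regarded as a member of \<open>'y\<close>; for other \<open>b\<close> the value of
  \<open>as_Y\<close> is meaningless.
\<close>

definition lies_in_Y :: "('b \<Rightarrow> 'v) \<Rightarrow> ('y \<Rightarrow> 'v) \<Rightarrow> 'b \<Rightarrow> bool" where
  "lies_in_Y iB iY b \<longleftrightarrow> iB b \<in> range iY"

definition as_Y :: "('b \<Rightarrow> 'v) \<Rightarrow> ('y \<Rightarrow> 'v) \<Rightarrow> 'b \<Rightarrow> 'y" where
  "as_Y iB iY b = inv iY (iB b)"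

text \<open>
  Strong (Bochner) measurability: a.e. limit of simple functions. Borel measurability would be
  too weak, as the Banach spaces need not be separable.
\<close>

definition strongly_measurable :: "'a measure \<Rightarrow> ('a \<Rightarrow> 'b::topological_space) \<Rightarrow> bool" where
  "strongly_measurable M f \<longleftrightarrow>
     (\<exists>\<phi>. (\<forall>n::nat. simple_function M (\<phi> n)) \<and> (AE x in M. (\<lambda>n. \<phi> n x) \<longlonglongrightarrow> f x))"

text \<open>The exponent \<open>p\<close> ranges over the extended reals in \<open>[1, \<infinity>]\<close>; the value may be \<open>\<infinity>\<close>.\<close>

definition Lp_norm :: "ennreal \<Rightarrow> real set \<Rightarrow> (real \<Rightarrow> real) \<Rightarrow> ennreal" where
  "Lp_norm p S g =
     (if p = \<infinity> then esssup (lebesgue_on S) (\<lambda>t. ennreal \<bar>g t\<bar>)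
      else let I = \<integral>\<^sup>+t. ennreal (\<bar>g t\<bar> powr enn2real p) \<partial>lebesgue_on S
           in if I = \<infinity> then \<infinity> else ennreal (enn2real I powr (1 / enn2real p)))"

text \<open>
  The spaces below consist of functions rather than classes modulo a.e. equality; all notions
  depend only on the restriction to \<open>S\<close> up to null sets.
\<close>

definition Lp_space :: "ennreal \<Rightarrow> real set \<Rightarrow> (real \<Rightarrow> 'b::real_normed_vector) set" where
  "Lp_space p S =
     {u. strongly_measurable (lebesgue_on S) u \<and> Lp_norm p S (\<lambda>t. norm (u t)) < \<infinity>}"

definition Lp_cone ::
  "ennreal \<Rightarrow> real set \<Rightarrow> 'b::real_normed_vector set \<Rightarrow> ('b \<Rightarrow> real) \<Rightarrow> (real \<Rightarrow> 'b) set" where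
  "Lp_cone p S M s =
     {u. strongly_measurable (lebesgue_on S) u \<and>
         (AE t in lebesgue_on S. u t \<in> M) \<and>
         (\<lambda>t. s (u t)) \<in> borel_measurable (lebesgue_on S) \<and>
         Lp_norm p S (\<lambda>t. s (u t)) < \<infinity>}"

text \<open>\<open>L\<^sup>p(S; Y)\<close>, for functions given with values in \<open>'b\<close>.\<close>

definition Lp_in_Y ::
  "('b \<Rightarrow> 'v) \<Rightarrow> ('y::real_normed_vector \<Rightarrow> 'v) \<Rightarrow> ennreal \<Rightarrow> real set \<Rightarrow> (real \<Rightarrow> 'b) set" where
  "Lp_in_Y iB iY p S =
     {u. (AE t in lebesgue_on S. lies_in_Y iB iY (u t)) \<and>
         (\<lambda>t. as_Y iB iY (u t)) \<in> Lp_space p S}"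

text \<open>
  The topology of the pseudometric \<open>\<parallel>v - u\<parallel>\<close> on \<open>Lp_space\<close>. It is not Hausdorff: its open sets are
  exactly the preimages of the open sets of the normed quotient space modulo a.e. equality, so
  that closures and compactness correspond to those in the quotient.
\<close>

definition Lp_open :: "ennreal \<Rightarrow> real set \<Rightarrow> (real \<Rightarrow> 'b::real_normed_vector) set \<Rightarrow> bool" where
  "Lp_open p S W \<longleftrightarrow>
     W \<subseteq> Lp_space p S \<and>
     (\<forall>u\<in>W. \<exists>r>0. \<forall>v\<in>Lp_space p S. Lp_norm p S (\<lambda>t. norm (v t - u t)) < ennreal r \<longrightarrow> v \<in> W)"

definition Lp_topology :: "ennreal \<Rightarrow> real set \<Rightarrow> (real \<Rightarrow> 'b::real_normed_vector) topology" where
  "Lp_topology p S = topology (Lp_open p S)"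

lemma istopology_Lp_open: "istopology (Lp_open p S)"
  unfolding istopology_def
proof (intro conjI allI impI)
  fix V W :: "(real \<Rightarrow> 'a) set"
  assume V: "Lp_open p S V" and W: "Lp_open p S W"
  show "Lp_open p S (V \<inter> W)"
    unfolding Lp_open_def
  proof (intro conjI ballI)
    show "V \<inter> W \<subseteq> Lp_space p S" using V by (auto simp: Lp_open_def)
    fix u assume "u \<in> V \<inter> W"
    then have u: "u \<in> V" "u \<in> W" by auto
    obtain r1 where r1: "r1 > 0"
      "\<And>v. v \<in> Lp_space p S \<Longrightarrow> Lp_norm p S (\<lambda>t. norm (v t - u t)) < ennreal r1 \<Longrightarrow> v \<in> V"
      using V u(1) unfolding Lp_open_def by blast
    obtain r2 where r2: "r2 > 0"
      "\<And>v. v \<in> Lp_space p S \<Longrightarrow> Lp_norm p S (\<lambda>t. norm (v t - u t)) < ennreal r2 \<Longrightarrow> v \<in> W"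
      using W u(2) unfolding Lp_open_def by blast
    have le: "ennreal (min r1 r2) \<le> ennreal r1" "ennreal (min r1 r2) \<le> ennreal r2"
      by (simp_all add: ennreal_leI)
    have "v \<in> V \<inter> W"
      if "v \<in> Lp_space p S" "Lp_norm p S (\<lambda>t. norm (v t - u t)) < ennreal (min r1 r2)" for v
      using r1(2)[OF that(1) less_le_trans[OF that(2) le(1)]]
        r2(2)[OF that(1) less_le_trans[OF that(2) le(2)]] by blast
    moreover have "min r1 r2 > 0" using r1(1) r2(1) by simp
    ultimately show "\<exists>r>0. \<forall>v\<in>Lp_space p S.
        Lp_norm p S (\<lambda>t. norm (v t - u t)) < ennreal r \<longrightarrow> v \<in> V \<inter> W"
      by blast
  qed
next
  fix K :: "(real \<Rightarrow> 'a) set set"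
  assume K: "\<forall>W\<in>K. Lp_open p S W"
  show "Lp_open p S (\<Union>K)"
    unfolding Lp_open_def
  proof (intro conjI ballI)
    show "\<Union>K \<subseteq> Lp_space p S" using K unfolding Lp_open_def by blast
    fix u assume "u \<in> \<Union>K"
    then obtain W where W: "W \<in> K" "u \<in> W" by blast
    with K obtain r where "r > 0"
      "\<forall>v\<in>Lp_space p S. Lp_norm p S (\<lambda>t. norm (v t - u t)) < ennreal r \<longrightarrow> v \<in> W"
      unfolding Lp_open_def by blast
    with W(1) show "\<exists>r>0. \<forall>v\<in>Lp_space p S.
        Lp_norm p S (\<lambda>t. norm (v t - u t)) < ennreal r \<longrightarrow> v \<in> \<Union>K"
      by blast
  qed
qed

lemma openin_Lp_topology: "openin (Lp_topology p S) = Lp_open p S"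
  unfolding Lp_topology_def by (rule topology_inverse'[OF istopology_Lp_open])

lemma topspace_Lp_topology: "topspace (Lp_topology p S) = Lp_space p S"
proof -
  have "Lp_open p S (Lp_space p S)"
    unfolding Lp_open_def using zero_less_one by blast
  then show ?thesis
    unfolding topspace_def openin_Lp_topology unfolding Lp_open_def by blast
qed

definition relatively_compact_in :: "'a topology \<Rightarrow> 'a set \<Rightarrow> bool" where
  "relatively_compact_in X A \<longleftrightarrow> A \<subseteq> topspace X \<and> compactin X (X closure_of A)"

definition C0_metric :: "real \<Rightarrow> (real \<Rightarrow> 'b::metric_space) metric" where
  "C0_metric T = cfunspace (top_of_set {0..T}) euclidean_metric"

text \<open>Elements of \<open>C0_metric T\<close> are extensional on \<open>{0..T}\<close>, so each is determined by its a.e. class.\<close>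

definition is_continuous_representative ::
  "real \<Rightarrow> (real \<Rightarrow> 'b::metric_space) \<Rightarrow> (real \<Rightarrow> 'b) \<Rightarrow> bool" where
  "is_continuous_representative T u v \<longleftrightarrow>
     v \<in> mspace (C0_metric T) \<and> (AE t in lebesgue_on {0<..<T}. v t = u t)"

end

theory Submission
  imports Defs
begin

text \<open>
  Compactness of the embedding, homogeneity of \<open>[\<cdot>]\<close> and compatibility of \<open>B\<close> and \<open>Y\<close> give an
  Ehrling inequality \<open>\<parallel>x - y\<parallel>\<^sub>B \<le> \<epsilon> ([x] + [y]) + C \<parallel>x - y\<parallel>\<^sub>Y\<close> on the cone, so the time shifts
  are small in \<open>L\<^sup>p(B)\<close> uniformly on \<open>U\<close>. Since the cone need not be convex, time averages of
  functions in \<open>U\<close> may leave it; instead each function is sampled on a grid of mesh \<open>m\<close> at a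
  suitable offset \<open>\<tau>\<close>. Averaging over \<open>\<tau>\<close> with Tonelli bounds the error of the resulting step
  function by the norms of shifts shorter than \<open>m\<close>, and keeps the sampled values in a sublevel set
  of \<open>[\<cdot>]\<close>, which is totally bounded in \<open>B\<close>. Finitely many step functions therefore approximate
  all of \<open>U\<close>. For \<open>p = \<infinity>\<close> the shift estimate makes the functions equicontinuous off a null set,
  and the Arzela--Ascoli argument applies to their continuous extensions.
\<close>

section \<open>The \<open>L\<^sup>p\<close> norms\<close>

text \<open>Differences of cone elements may leave \<open>M\<close>, and the seminorm obeys no
  triangle inequality, so an Ehrling inequality for single elements would say nothing about shifts.
  It is stated for pairs instead, at the price of the symmetric term \<open>s x + s y\<close>, which
  the bound on \<open>U\<close> controls. For the same reason nothing is known about the seminorm of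
  a limit: functions of \<open>U\<close> are only ever evaluated at single times, and continuous
  representatives are only located in the closure of a sublevel set. Single values, however, make
  sense only off a null set, while the shift estimate holds for each fixed shift at almost every
  time. A double integral over a strip along the diagonal reconciles the two; it requires joint
  measurability, whence the Borel versions of distance functions. The nets always consist of members
  of \<open>U\<close>: functions with the same finite label are close, and one function per label is
  kept.\<close>

lemma ennreal_powr_inverse_le_iff:
  fixes I :: ennreal
  assumes "1 \<le> q" "0 \<le> a"
  shows "(if I = \<infinity> then \<infinity> else ennreal (enn2real I powr (1 / q))) \<le> ennreal a \<longleftrightarrow> I \<le> ennreal (a powr q)"
proof (cases I)
  case (real x)
  have "x powr (1/q) \<le> a \<longleftrightarrow> x \<le> a powr q"
  proof
    assume "x powr (1/q) \<le> a"
    then have "(x powr (1/q)) powr q \<le> a powr q" using assms by (intro powr_mono2) auto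
    then show "x \<le> a powr q" using assms real by (simp add: powr_powr)
  next
    assume "x \<le> a powr q"
    then have "x powr (1/q) \<le> (a powr q) powr (1/q)" using assms real by (intro powr_mono2) auto
    then show "x powr (1/q) \<le> a" using assms real by (simp add: powr_powr)
  qed
  then show ?thesis using real assms by simp
qed (simp add: top_unique)

lemma enn2real_ge_1: "1 \<le> p \<Longrightarrow> p \<noteq> \<infinity> \<Longrightarrow> 1 \<le> enn2real p" for p :: ennreal
  by (cases p) auto

text \<open>Estimates become real bounds on an integral of powers, so that the root and the case of
  an infinite integral in \<open>Lp_norm\<close> are dealt with once and for all.\<close>

lemma Lp_norm_le_iff:
  assumes "1 \<le> p" "p \<noteq> \<infinity>" "0 \<le> a"
  shows "Lp_norm p S g \<le> ennreal a \<longleftrightarrow>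
    (\<integral>\<^sup>+t. ennreal (\<bar>g t\<bar> powr enn2real p) \<partial>lebesgue_on S) \<le> ennreal (a powr enn2real p)"
  using ennreal_powr_inverse_le_iff[OF enn2real_ge_1[OF assms(1,2)] assms(3)] assms(2)
  unfolding Lp_norm_def Let_def by simp

text \<open>Measurability matters from right to left: \<open>esssup\<close> of a nonmeasurable
  function is \<open>top\<close>.\<close>

lemma Lp_norm_infinity_le_iff:
  assumes "p = \<infinity>" "g \<in> borel_measurable (lebesgue_on S)" "0 \<le> a"
  shows "Lp_norm p S g \<le> ennreal a \<longleftrightarrow> (AE t in lebesgue_on S. \<bar>g t\<bar> \<le> a)"
proof
  assume *: "Lp_norm p S g \<le> ennreal a"
  have "AE t in lebesgue_on S. ennreal \<bar>g t\<bar> \<le> esssup (lebesgue_on S) (\<lambda>t. ennreal \<bar>g t\<bar>)"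
    by (rule esssup_AE)
  then show "AE t in lebesgue_on S. \<bar>g t\<bar> \<le> a"
    by eventually_elim
      (metis "*" Lp_norm_def assms(1) assms(3) ennreal_le_iff order_trans)
next
  assume *: "AE t in lebesgue_on S. \<bar>g t\<bar> \<le> a"
  show "Lp_norm p S g \<le> ennreal a"
    unfolding Lp_norm_def using * assms
    by (auto intro!: esssup_I elim!: eventually_mono simp: ennreal_leI)
qed

text \<open>The asymmetric assumption fits both cases: \<open>nn_integral\<close> is monotone on
  arbitrary functions, and for infinite \<open>p\<close> a nonmeasurable \<open>g\<close> has norm
  \<open>top\<close>.\<close>

lemma Lp_norm_mono_AE:
  assumes "1 \<le> p" "f \<in> borel_measurable (lebesgue_on S)"
    "AE t in lebesgue_on S. \<bar>f t\<bar> \<le> \<bar>g t\<bar>"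
  shows "Lp_norm p S f \<le> Lp_norm p S g"
proof (cases "p = \<infinity>")
  case True
  show ?thesis unfolding Lp_norm_def using assms True
    by (auto intro!: esssup_AE_mono elim!: eventually_mono simp: ennreal_leI)
next
  case False
  have le: "(\<integral>\<^sup>+t. ennreal (\<bar>f t\<bar> powr enn2real p) \<partial>lebesgue_on S)
      \<le> (\<integral>\<^sup>+t. ennreal (\<bar>g t\<bar> powr enn2real p) \<partial>lebesgue_on S)"
    using assms(3) by (intro nn_integral_mono_AE, eventually_elim) (intro ennreal_leI powr_mono2, auto)
  show ?thesis
  proof (cases "Lp_norm p S g")
    case (real a)
    then have "(\<integral>\<^sup>+t. ennreal (\<bar>g t\<bar> powr enn2real p) \<partial>lebesgue_on S) \<le> ennreal (a powr enn2real p)"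
      by (subst Lp_norm_le_iff[OF assms(1) False, symmetric]) auto
    with le have "Lp_norm p S f \<le> ennreal a"
      using real by (subst Lp_norm_le_iff[OF assms(1) False]) (auto intro: order_trans)
    then show ?thesis using real by simp
  qed simp
qed

lemma Lp_norm_cmult_le:
  assumes "1 \<le> p" "f \<in> borel_measurable (lebesgue_on S)" "Lp_norm p S f \<le> ennreal a" "0 \<le> a"
  shows "Lp_norm p S (\<lambda>t. c * f t) \<le> ennreal (\<bar>c\<bar> * a)"
proof (cases "p = \<infinity>")
  case True
  then show ?thesis using assms
    by (auto simp: Lp_norm_infinity_le_iff abs_mult elim!: eventually_mono intro!: mult_left_mono)
next
  case False
  let ?q = "enn2real p"
  have "(\<integral>\<^sup>+t. ennreal (\<bar>c * f t\<bar> powr ?q) \<partial>lebesgue_on S)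
      = (\<integral>\<^sup>+t. ennreal (\<bar>c\<bar> powr ?q) * ennreal (\<bar>f t\<bar> powr ?q) \<partial>lebesgue_on S)"
    by (simp add: abs_mult powr_mult ennreal_mult)
  also have "\<dots> = ennreal (\<bar>c\<bar> powr ?q) * (\<integral>\<^sup>+t. ennreal (\<bar>f t\<bar> powr ?q) \<partial>lebesgue_on S)"
    using assms(2) by (intro nn_integral_cmult) measurable
  also have "\<dots> \<le> ennreal (\<bar>c\<bar> powr ?q) * ennreal (a powr ?q)"
    using Lp_norm_le_iff[OF assms(1) False assms(4)] assms(3) by (intro mult_left_mono) auto
  also have "\<dots> = ennreal ((\<bar>c\<bar> * a) powr ?q)"
    using assms(4) by (simp add: powr_mult ennreal_mult)
  finally show ?thesis using Lp_norm_le_iff[OF assms(1) False] assms(4) by simp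
qed

text \<open>For \<open>x\<close> and \<open>y\<close> positive this is convexity of the power. If
  one of them vanishes, it reduces to \<open>c powr q \<le> c\<close> for \<open>c\<close> between 0
  and 1.\<close>

lemma powr_convex_combination_le:
  fixes x y :: real
  assumes "1 \<le> q" "0 \<le> x" "0 \<le> y" "0 < \<theta>" "\<theta> < 1"
  shows "(\<theta> * x + (1 - \<theta>) * y) powr q \<le> \<theta> * x powr q + (1 - \<theta>) * y powr q"
proof -
  have *: "(c * z) powr q \<le> c * z powr q" if "0 < c" "c < 1" "0 \<le> z" for c z :: real
  proof -
    have "c powr q \<le> c powr 1" using that assms by (intro powr_mono') auto
    then show ?thesis using that by (simp add: powr_mult mult_right_mono)
  qed
  consider "x = 0" | "y = 0" | "x > 0" "y > 0" using assms by linarith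
  then show ?thesis
  proof cases
    case 3
    then show ?thesis using convex_onD[OF powr_convex[OF assms(1)], of "1 - \<theta>" x y] assms by auto
  qed (use * assms in auto)
qed

text \<open>Minkowski's inequality from convexity of the power: after division by the bounds both
  functions have norm at most 1, and so does any convex combination of them.\<close>

lemma Lp_norm_add_le_pos:
  assumes "1 \<le> p" "f \<in> borel_measurable (lebesgue_on S)" "g \<in> borel_measurable (lebesgue_on S)"
    and "Lp_norm p S f \<le> ennreal a" "Lp_norm p S g \<le> ennreal b" "0 < a" "0 < b"
  shows "Lp_norm p S (\<lambda>t. f t + g t) \<le> ennreal (a + b)"
proof (cases "p = \<infinity>")
  case True
  have "AE t in lebesgue_on S. \<bar>f t\<bar> \<le> a" "AE t in lebesgue_on S. \<bar>g t\<bar> \<le> b"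
    using assms True by (auto simp: Lp_norm_infinity_le_iff)
  then have "AE t in lebesgue_on S. \<bar>f t + g t\<bar> \<le> a + b"
    by eventually_elim linarith
  then show ?thesis using assms True by (subst Lp_norm_infinity_le_iff) auto
next
  case False
  let ?q = "enn2real p"
  \<comment> \<open>The weight for which \<open>f + g\<close> is \<open>a + b\<close> times the
    convex combination of \<open>f / a\<close> and \<open>g / b\<close>.\<close>
  define \<theta> where "\<theta> = a / (a + b)"
  have \<theta>: "0 < \<theta>" "\<theta> < 1" "1 - \<theta> = b / (a + b)"
    using assms by (auto simp: \<theta>_def field_simps)
  have F: "(\<integral>\<^sup>+t. ennreal (\<bar>f t\<bar> powr ?q) \<partial>lebesgue_on S) \<le> ennreal (a powr ?q)"
    and G: "(\<integral>\<^sup>+t. ennreal (\<bar>g t\<bar> powr ?q) \<partial>lebesgue_on S) \<le> ennreal (b powr ?q)"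
    using assms Lp_norm_le_iff[OF assms(1) False] by auto
  have pt: "\<bar>f t + g t\<bar> powr ?q \<le> (a+b) powr ?q * \<theta> / a powr ?q * \<bar>f t\<bar> powr ?q
      + (a+b) powr ?q * (1 - \<theta>) / b powr ?q * \<bar>g t\<bar> powr ?q" for t
  proof -
    have "\<theta> * (\<bar>f t\<bar> / a) = \<bar>f t\<bar> / (a + b)" "(1 - \<theta>) * (\<bar>g t\<bar> / b) = \<bar>g t\<bar> / (a + b)"
      using assms unfolding \<theta>(3) unfolding \<theta>_def by auto
    then have "(\<bar>f t\<bar> + \<bar>g t\<bar>) = (a+b) * (\<theta> * (\<bar>f t\<bar> / a) + (1 - \<theta>) * (\<bar>g t\<bar> / b))"
      using assms by (simp flip: add_divide_distrib)
    then have "\<bar>f t + g t\<bar> powr ?q \<le> ((a+b) * (\<theta> * (\<bar>f t\<bar> / a) + (1 - \<theta>) * (\<bar>g t\<bar> / b))) powr ?q"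
      using abs_triangle_ineq[of "f t" "g t"] enn2real_ge_1[OF assms(1) False]
      by (intro powr_mono2) (simp_all del: times_divide_eq_right)
    also have "\<dots> = (a+b) powr ?q * (\<theta> * (\<bar>f t\<bar> / a) + (1 - \<theta>) * (\<bar>g t\<bar> / b)) powr ?q"
      by (rule powr_mult)
    also have "\<dots> \<le> (a+b) powr ?q * (\<theta> * (\<bar>f t\<bar> / a) powr ?q + (1 - \<theta>) * (\<bar>g t\<bar> / b) powr ?q)"
      using assms \<theta> enn2real_ge_1[OF assms(1) False]
      by (intro mult_left_mono powr_convex_combination_le) auto
    also have "\<dots> = (a+b) powr ?q * \<theta> / a powr ?q * \<bar>f t\<bar> powr ?q
      + (a+b) powr ?q * (1 - \<theta>) / b powr ?q * \<bar>g t\<bar> powr ?q"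
      using assms by (simp add: powr_divide algebra_simps)
    finally show ?thesis .
  qed
  define A where "A = (a+b) powr ?q * \<theta> / a powr ?q"
  define B where "B = (a+b) powr ?q * (1 - \<theta>) / b powr ?q"
  have AB: "0 \<le> A" "0 \<le> B" "A * a powr ?q + B * b powr ?q = (a + b) powr ?q"
    using assms \<theta>(1,2) by (auto simp: A_def B_def simp flip: distrib_left)
  have "(\<integral>\<^sup>+t. ennreal (\<bar>f t + g t\<bar> powr ?q) \<partial>lebesgue_on S)
     \<le> (\<integral>\<^sup>+t. ennreal A * ennreal (\<bar>f t\<bar> powr ?q) + ennreal B * ennreal (\<bar>g t\<bar> powr ?q) \<partial>lebesgue_on S)"
    using pt AB unfolding A_def[symmetric] B_def[symmetric]
    by (intro nn_integral_mono) (simp add: ennreal_leI flip: ennreal_mult ennreal_plus)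
  also have "\<dots> = ennreal A * (\<integral>\<^sup>+t. ennreal (\<bar>f t\<bar> powr ?q) \<partial>lebesgue_on S)
      + ennreal B * (\<integral>\<^sup>+t. ennreal (\<bar>g t\<bar> powr ?q) \<partial>lebesgue_on S)"
    using assms(2,3) by (simp add: nn_integral_add nn_integral_cmult)
  also have "\<dots> \<le> ennreal A * ennreal (a powr ?q) + ennreal B * ennreal (b powr ?q)"
    using F G by (intro add_mono mult_left_mono) auto
  also have "\<dots> = ennreal ((a+b) powr ?q)"
    using AB by (simp flip: ennreal_mult ennreal_plus)
  finally show ?thesis using assms by (subst Lp_norm_le_iff[OF assms(1) False]) auto
qed

lemma Lp_norm_add_le:
  assumes "1 \<le> p" "f \<in> borel_measurable (lebesgue_on S)" "g \<in> borel_measurable (lebesgue_on S)"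
  shows "Lp_norm p S (\<lambda>t. f t + g t) \<le> Lp_norm p S f + Lp_norm p S g"
proof (cases "Lp_norm p S f"; cases "Lp_norm p S g")
  fix a b assume a: "0 \<le> a" "Lp_norm p S f = ennreal a" and b: "0 \<le> b" "Lp_norm p S g = ennreal b"
  \<comment> \<open>Either norm may vanish; the slack \<open>e / 2\<close> makes both bounds
    positive.\<close>
  have "Lp_norm p S (\<lambda>t. f t + g t) \<le> Lp_norm p S f + Lp_norm p S g + ennreal e" if "e > 0" for e
  proof -
    have "Lp_norm p S (\<lambda>t. f t + g t) \<le> ennreal ((a + e/2) + (b + e/2))"
      using assms a b that by (intro Lp_norm_add_le_pos) (auto simp: ennreal_leI)
    also have "\<dots> = Lp_norm p S f + Lp_norm p S g + ennreal e"
      using a b that by (simp flip: ennreal_plus)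
    finally show ?thesis .
  qed
  then show ?thesis by (rule ennreal_le_epsilon)
qed auto

text \<open>The factor \<open>1 + T\<close> dominates \<open>T powr (1 / q)\<close> for every
  \<open>q \<ge> 1\<close> and also the factor 1 of the supremum norm, so one bound serves all
  exponents.\<close>

lemma Lp_norm_const_le:
  assumes "1 \<le> p" "0 \<le> T" "0 \<le> a"
  shows "Lp_norm p {0<..<T} (\<lambda>t. a) \<le> ennreal (a * (1 + T))"
proof (cases "p = \<infinity>")
  case True
  have "a \<le> a * (1 + T)" using assms by (simp add: algebra_simps)
  then show ?thesis using True assms by (simp add: Lp_norm_infinity_le_iff)
next
  case False
  let ?q = "enn2real p"
  note q = enn2real_ge_1[OF assms(1) False]
  have "(1 + T) powr 1 \<le> (1 + T) powr ?q" using assms q by (intro powr_mono) auto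
  then have "a powr ?q * T \<le> (a * (1 + T)) powr ?q"
    using assms by (auto simp: powr_mult intro!: mult_left_mono)
  moreover have "(\<integral>\<^sup>+t. ennreal (\<bar>a\<bar> powr ?q) \<partial>lebesgue_on {0<..<T}) = ennreal (a powr ?q * T)"
    using assms by (simp add: emeasure_restrict_space ennreal_mult)
  ultimately show ?thesis
    using Lp_norm_le_iff[OF assms(1) False, of "a * (1 + T)"] assms by (simp add: ennreal_leI)
qed

text \<open>Chebyshev gives \<open>(a / b) powr q\<close>; since \<open>a \<le> b\<close>, this is
  at most \<open>a / b\<close>, a bound free of the exponent. For infinite \<open>p\<close> the set
  is null.\<close>

lemma Lp_norm_Chebyshev:
  assumes "1 \<le> p" "f \<in> borel_measurable (lebesgue_on S)" "Lp_norm p S f \<le> ennreal a"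
    "0 \<le> a" "a \<le> b" "0 < b"
  shows "emeasure (lebesgue_on S) {t \<in> space (lebesgue_on S). b < \<bar>f t\<bar>} \<le> ennreal (a / b)"
proof (cases "p = \<infinity>")
  case True
  have "AE t in lebesgue_on S. \<bar>f t\<bar> \<le> a" using assms True by (auto simp: Lp_norm_infinity_le_iff)
  then have "AE t in lebesgue_on S. \<not> b < \<bar>f t\<bar>" using assms by (auto elim!: eventually_mono)
  moreover have "{t \<in> space (lebesgue_on S). b < \<bar>f t\<bar>} \<in> sets (lebesgue_on S)"
    using assms(2) by measurable
  ultimately have "emeasure (lebesgue_on S) {t \<in> space (lebesgue_on S). b < \<bar>f t\<bar>} = 0"
    by (subst (asm) AE_iff_measurable[OF _ refl]) simp_all
  then show ?thesis by simp
next
  case False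
  let ?q = "enn2real p" and ?A = "{t \<in> space (lebesgue_on S). b < \<bar>f t\<bar>}"
  note q = enn2real_ge_1[OF assms(1) False]
  have "?A \<in> sets (lebesgue_on S)" using assms(2) by measurable
  then have "ennreal (b powr ?q) * emeasure (lebesgue_on S) ?A = (\<integral>\<^sup>+t. ennreal (b powr ?q) * indicator ?A t \<partial>lebesgue_on S)"
    by (simp add: nn_integral_cmult_indicator)
  also have "\<dots> \<le> (\<integral>\<^sup>+t. ennreal (\<bar>f t\<bar> powr ?q) \<partial>lebesgue_on S)"
    using q assms by (intro nn_integral_mono) (auto simp: indicator_def intro!: ennreal_leI powr_mono2)
  also have "\<dots> \<le> ennreal (a powr ?q)" using Lp_norm_le_iff[OF assms(1) False] assms by auto
  finally have *: "ennreal (b powr ?q) * emeasure (lebesgue_on S) ?A \<le> ennreal (a powr ?q)" .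
  have "emeasure (lebesgue_on S) ?A = ennreal (1 / b powr ?q) * (ennreal (b powr ?q) * emeasure (lebesgue_on S) ?A)"
    using assms by (simp add: mult.assoc[symmetric] flip: ennreal_mult)
  also have "\<dots> \<le> ennreal (1 / b powr ?q) * ennreal (a powr ?q)" by (intro mult_left_mono *) auto
  also have "\<dots> = ennreal ((a / b) powr ?q)" using assms by (simp add: powr_divide flip: ennreal_mult)
  also have "\<dots> \<le> ennreal ((a / b) powr 1)" using assms q by (intro ennreal_leI powr_mono') auto
  finally show ?thesis using assms by simp
qed

lemma Lp_norm_Fatou:
  assumes "1 \<le> p" "\<And>k. f k \<in> borel_measurable (lebesgue_on S)" "g \<in> borel_measurable (lebesgue_on S)"
    "AE t in lebesgue_on S. (\<lambda>k. f k t) \<longlonglongrightarrow> g t" "\<And>k::nat. Lp_norm p S (f k) \<le> ennreal a" "0 \<le> a"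
  shows "Lp_norm p S g \<le> ennreal a"
proof (cases "p = \<infinity>")
  case True
  have "AE t in lebesgue_on S. \<forall>k. \<bar>f k t\<bar> \<le> a"
    unfolding AE_all_countable using assms True by (simp add: Lp_norm_infinity_le_iff)
  with assms(4) have "AE t in lebesgue_on S. \<bar>g t\<bar> \<le> a"
  proof eventually_elim
    case (elim t)
    then show ?case by (intro tendsto_upperbound[OF tendsto_rabs[OF elim(1)]]) auto
  qed
  then show ?thesis using assms True by (simp add: Lp_norm_infinity_le_iff)
next
  case False
  let ?q = "enn2real p"
  note q = enn2real_ge_1[OF assms(1) False]
  have "(\<integral>\<^sup>+t. ennreal (\<bar>g t\<bar> powr ?q) \<partial>lebesgue_on S)
     = (\<integral>\<^sup>+t. liminf (\<lambda>k. ennreal (\<bar>f k t\<bar> powr ?q)) \<partial>lebesgue_on S)"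
  proof (rule nn_integral_cong_AE)
    show "AE t in lebesgue_on S. ennreal (\<bar>g t\<bar> powr ?q) = liminf (\<lambda>k. ennreal (\<bar>f k t\<bar> powr ?q))"
      using assms(4)
    proof eventually_elim
      case (elim t)
      have "(\<lambda>k. \<bar>f k t\<bar> powr ?q) \<longlonglongrightarrow> \<bar>g t\<bar> powr ?q"
        using q by (intro tendsto_powr2 tendsto_rabs elim) auto
      then have "(\<lambda>k. ennreal (\<bar>f k t\<bar> powr ?q)) \<longlonglongrightarrow> ennreal (\<bar>g t\<bar> powr ?q)" by (rule tendsto_ennrealI)
      then show ?case by (intro lim_imp_Liminf[symmetric]) simp_all
    qed
  qed
  also have "\<dots> \<le> liminf (\<lambda>k. \<integral>\<^sup>+t. ennreal (\<bar>f k t\<bar> powr ?q) \<partial>lebesgue_on S)"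
    using assms(2) by (intro nn_integral_liminf) measurable
  also have "\<dots> \<le> ennreal (a powr ?q)"
    using assms Lp_norm_le_iff[OF assms(1) False]
    by (intro Liminf_le) auto
  finally show ?thesis using Lp_norm_le_iff[OF assms(1) False] assms by simp
qed

section \<open>Strong measurability\<close>

lemma AE_lebesgue_on_iff:
  "S \<in> sets lebesgue \<Longrightarrow> (AE t in lebesgue_on S. P t) \<longleftrightarrow> (AE t in lborel. t \<in> S \<longrightarrow> P t)"
  by (simp add: AE_restrict_space_iff AE_completion_iff)

lemma borel_measurable_lebesgue_on_AE:
  fixes f g :: "real \<Rightarrow> real"
  assumes "S \<in> sets lebesgue" "f \<in> borel_measurable (lebesgue_on S)" "AE t in lebesgue_on S. f t = g t"
  shows "g \<in> borel_measurable (lebesgue_on S)"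
proof -
  let ?e = "\<lambda>h::real \<Rightarrow> real. \<lambda>t. if t \<in> S then h t else 0"
  have f: "?e f \<in> borel_measurable lebesgue"
    using borel_measurable_if_I[OF assms(2,1)] by simp
  have "AE t in lebesgue. t \<in> S \<longrightarrow> f t = g t"
    using assms(1,3) by (simp add: AE_restrict_space_iff)
  then have "AE t in lebesgue. ?e f t = ?e g t"
    by eventually_elim auto
  from borel_measurable_AE[OF f this] show ?thesis
    by (rule borel_measurable_if_D)
qed

lemma strongly_measurable_diff:
  fixes f g :: "_ \<Rightarrow> 'b::real_normed_vector"
  assumes "strongly_measurable M f" "strongly_measurable M g"
  shows "strongly_measurable M (\<lambda>x. f x - g x)"
proof -
  obtain \<phi> where \<phi>: "\<And>n::nat. simple_function M (\<phi> n)" "AE x in M. (\<lambda>n. \<phi> n x) \<longlonglongrightarrow> f x"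
    using assms(1) unfolding strongly_measurable_def by blast
  obtain \<psi> where \<psi>: "\<And>n::nat. simple_function M (\<psi> n)" "AE x in M. (\<lambda>n. \<psi> n x) \<longlonglongrightarrow> g x"
    using assms(2) unfolding strongly_measurable_def by blast
  have "AE x in M. (\<lambda>n. \<phi> n x - \<psi> n x) \<longlonglongrightarrow> f x - g x"
    using \<phi>(2) \<psi>(2) by eventually_elim (rule tendsto_diff)
  with \<phi>(1) \<psi>(1) show ?thesis unfolding strongly_measurable_def
    by (intro exI[of _ "\<lambda>n x. \<phi> n x - \<psi> n x"]) (auto intro: simple_function_compose2)
qed

lemma strongly_measurable_simple_function: "simple_function M f \<Longrightarrow> strongly_measurable M f"
  unfolding strongly_measurable_def by (intro exI[of _ "\<lambda>_. f"]) auto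

lemma borel_measurable_norm_strongly_measurable:
  fixes f :: "real \<Rightarrow> 'b::real_normed_vector"
  assumes S: "S \<in> sets lebesgue" and "strongly_measurable (lebesgue_on S) f"
  shows "(\<lambda>t. norm (f t)) \<in> borel_measurable (lebesgue_on S)"
proof -
  obtain \<phi> where \<phi>: "\<And>n::nat. simple_function (lebesgue_on S) (\<phi> n)"
      "AE x in lebesgue_on S. (\<lambda>n. \<phi> n x) \<longlonglongrightarrow> f x"
    using assms(2) unfolding strongly_measurable_def by blast
  have [measurable]: "(\<lambda>t. norm (\<phi> n t)) \<in> borel_measurable (lebesgue_on S)" for n
    using simple_function_compose1[OF \<phi>(1)] by (rule borel_measurable_simple_function)
  \<comment> \<open>\<open>lim\<close> has some value even where the sequence diverges; this
    concerns a null set only, which the completeness of Lebesgue measure absorbs.\<close>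
  have "(\<lambda>t. lim (\<lambda>n. norm (\<phi> n t))) \<in> borel_measurable (lebesgue_on S)"
    by measurable
  moreover have "AE t in lebesgue_on S. lim (\<lambda>n. norm (\<phi> n t)) = norm (f t)"
    using \<phi>(2) by eventually_elim (intro limI tendsto_norm)
  ultimately show ?thesis by (rule borel_measurable_lebesgue_on_AE[OF S])
qed

text \<open>On a set of finite measure, convergence almost everywhere implies convergence in
  measure. This supplies the approximants of the diagonal argument in
  \<open>strongly_measurable_lim\<close>.\<close>

lemma strongly_measurable_ex_simple_close:
  fixes f :: "real \<Rightarrow> 'b::real_normed_vector"
  assumes S: "S \<in> lmeasurable" and f: "strongly_measurable (lebesgue_on S) f" and "0 < \<epsilon>"
  obtains \<phi> where "simple_function (lebesgue_on S) \<phi>"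
    "emeasure (lebesgue_on S) {t \<in> S. \<epsilon> < norm (f t - \<phi> t)} < ennreal \<epsilon>"
proof -
  have S': "S \<in> sets lebesgue" using S by auto
  obtain \<phi> where \<phi>: "\<And>n::nat. simple_function (lebesgue_on S) (\<phi> n)"
      "AE x in lebesgue_on S. (\<lambda>n. \<phi> n x) \<longlonglongrightarrow> f x"
    using f unfolding strongly_measurable_def by blast
  interpret finite_measure "lebesgue_on S" using S by (rule finite_measure_lebesgue_on)
  have [measurable]: "(\<lambda>t. norm (f t - \<phi> n t)) \<in> borel_measurable (lebesgue_on S)" for n
    by (intro borel_measurable_norm_strongly_measurable[OF S'] strongly_measurable_diff f
      strongly_measurable_simple_function \<phi>(1))
  \<comment> \<open>Taking all \<open>m \<ge> n\<close> makes the sets decreasing, so that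
    continuity from above applies; a point of convergence lies outside some
    \<open>A n\<close>.\<close>
  define A where "A n = {t \<in> space (lebesgue_on S). \<exists>m\<ge>n. \<epsilon> < norm (f t - \<phi> m t)}" for n
  have [measurable]: "A n \<in> sets (lebesgue_on S)" for n unfolding A_def by measurable
  have "decseq A" unfolding decseq_def A_def using le_trans by blast
  then have "(\<lambda>n. emeasure (lebesgue_on S) (A n)) \<longlonglongrightarrow> emeasure (lebesgue_on S) (\<Inter>n. A n)"
    by (intro Lim_emeasure_decseq \<open>decseq A\<close>) auto
  moreover have "emeasure (lebesgue_on S) (\<Inter>n. A n) = 0"
  proof -
    have "AE t in lebesgue_on S. t \<notin> (\<Inter>n. A n)"
      using \<phi>(2)
    proof eventually_elim
      case (elim t)
      have "(\<lambda>n. norm (f t - \<phi> n t)) \<longlonglongrightarrow> norm (f t - f t)"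
        by (intro tendsto_intros elim)
      then have "\<forall>\<^sub>F n in sequentially. norm (f t - \<phi> n t) < \<epsilon>"
        using \<open>0 < \<epsilon>\<close> order_tendstoD(2) by fastforce
      then obtain N where "\<And>n. n \<ge> N \<Longrightarrow> norm (f t - \<phi> n t) < \<epsilon>"
        unfolding eventually_sequentially by blast
      then have "t \<notin> A N" unfolding A_def by force
      then show ?case by blast
    qed
    then show ?thesis
      by (subst (asm) AE_iff_measurable[of "\<Inter>n. A n"]) (simp_all, auto simp: A_def)
  qed
  ultimately have "\<forall>\<^sub>F n in sequentially. emeasure (lebesgue_on S) (A n) < ennreal \<epsilon>"
    using \<open>0 < \<epsilon>\<close> by (intro order_tendstoD(2)[where y=0]) auto
  then obtain n where n: "emeasure (lebesgue_on S) (A n) < ennreal \<epsilon>"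
    using eventually_happens'[OF sequentially_bot] by blast
  have "{t \<in> S. \<epsilon> < norm (f t - \<phi> n t)} \<subseteq> A n" by (auto simp: A_def)
  then have "emeasure (lebesgue_on S) {t \<in> S. \<epsilon> < norm (f t - \<phi> n t)} \<le> emeasure (lebesgue_on S) (A n)"
    by (rule emeasure_mono) simp
  with n have "emeasure (lebesgue_on S) {t \<in> S. \<epsilon> < norm (f t - \<phi> n t)} < ennreal \<epsilon>" by simp
  with \<phi>(1) show ?thesis by (rule that)
qed

text \<open>The Borel-Cantelli lemma in the form used twice below: for simple approximants of a
  sequence and for a rapidly converging subsequence.\<close>

lemma AE_eventually_le_if_summable_measure:
  assumes "\<And>n. {x \<in> space M. b n < g n x} \<in> sets M"
    "\<And>n::nat. emeasure M {x \<in> space M. b n < (g n x::real)} \<le> ennreal (c n)" "summable c" "\<And>n. 0 \<le> c n"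
  shows "AE x in M. \<forall>\<^sub>F n in sequentially. g n x \<le> b n"
proof -
  have "measure M {x \<in> space M. b n < g n x} \<le> c n" for n
    using assms(2)[of n] assms(4)[of n] by (simp add: measure_def enn2real_leI)
  then have "summable (\<lambda>n. measure M {x \<in> space M. b n < g n x})"
    by (intro summable_comparison_test'[OF assms(3)]) auto
  moreover have "emeasure M {x \<in> space M. b n < g n x} < \<infinity>" for n
    using assms(2)[of n] by (auto simp: le_less_trans)
  ultimately have "AE x in M. \<forall>\<^sub>F n in sequentially. x \<in> space M - {x \<in> space M. b n < g n x}"
    using assms(1) by (intro borel_cantelli_AE1) auto
  then show ?thesis
    by eventually_elim (auto elim!: eventually_mono)
qed

text \<open>A diagonal argument: \<open>f n\<close> is replaced by a simple function that differs
  from it by at most \<open>(1/2)^n\<close> outside a set of measure \<open>(1/2)^n\<close>. By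
  Borel-Cantelli these simple functions have the same limit almost everywhere.\<close>

lemma strongly_measurable_lim:
  fixes f :: "nat \<Rightarrow> real \<Rightarrow> 'b::real_normed_vector"
  assumes S: "S \<in> lmeasurable" and f: "\<And>n. strongly_measurable (lebesgue_on S) (f n)"
    and lim: "AE t in lebesgue_on S. (\<lambda>n. f n t) \<longlonglongrightarrow> g t"
  shows "strongly_measurable (lebesgue_on S) g"
proof -
  have S': "S \<in> sets lebesgue" using S by auto
  have "\<exists>\<phi>. simple_function (lebesgue_on S) \<phi> \<and>
      emeasure (lebesgue_on S) {t \<in> S. (1/2)^n < norm (f n t - \<phi> t)} < ennreal ((1/2)^n)" for n :: nat
    by (rule strongly_measurable_ex_simple_close[OF S f, of "(1/2)^n" n]) auto
  then obtain \<phi> where \<phi>: "\<And>n::nat. simple_function (lebesgue_on S) (\<phi> n)"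
      "\<And>n. emeasure (lebesgue_on S) {t \<in> S. (1/2)^n < norm (f n t - \<phi> n t)} < ennreal ((1/2)^n)"
    by metis
  have [measurable]: "(\<lambda>t. norm (f n t - \<phi> n t)) \<in> borel_measurable (lebesgue_on S)" for n
    by (intro borel_measurable_norm_strongly_measurable[OF S'] strongly_measurable_diff f
      strongly_measurable_simple_function \<phi>(1))
  have "{t \<in> space (lebesgue_on S). (1/2)^n < norm (f n t - \<phi> n t)} \<in> sets (lebesgue_on S)" for n
    by measurable
  then have "AE t in lebesgue_on S. \<forall>\<^sub>F n in sequentially. norm (f n t - \<phi> n t) \<le> (1/2)^n"
    using less_imp_le[OF \<phi>(2)]
    by (intro AE_eventually_le_if_summable_measure[where c = "\<lambda>n. (1/2)^n"]) simp_all
  with lim have "AE t in lebesgue_on S. (\<lambda>n. \<phi> n t) \<longlonglongrightarrow> g t"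
  proof eventually_elim
    case (elim t)
    have "(\<lambda>n. (1/2)^n :: real) \<longlonglongrightarrow> 0" by (intro LIMSEQ_realpow_zero) auto
    then have "(\<lambda>n. f n t - \<phi> n t) \<longlonglongrightarrow> 0"
      by (rule Lim_null_comparison[OF elim(2)])
    from tendsto_diff[OF elim(1) this] show ?case by simp
  qed
  with \<phi>(1) show ?thesis unfolding strongly_measurable_def by blast
qed

section \<open>Total boundedness and completeness\<close>

text \<open>The net is a choice of one member of \<open>U\<close> for each label. Both net
  constructions encode a function by finitely many centres and end here.\<close>

lemma finite_net_of_finite_labels:
  assumes "finite (lab ` U)" "\<And>x y. x \<in> U \<Longrightarrow> y \<in> U \<Longrightarrow> lab x = lab y \<Longrightarrow> P x y"
  shows "\<exists>K. finite K \<and> K \<subseteq> U \<and> (\<forall>x\<in>U. \<exists>k\<in>K. P x k)"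
proof -
  obtain K where K: "K \<subseteq> U" "finite K" "lab ` U = lab ` K"
    using finite_subset_image[OF assms(1) order_refl] by blast
  have "\<exists>k\<in>K. P x k" if "x \<in> U" for x
  proof -
    have "lab x \<in> lab ` K" using that K(3) by blast
    then obtain k where "k \<in> K" "lab x = lab k" by auto
    then show ?thesis using assms(2)[OF that, of k] K(1) by blast
  qed
  then show ?thesis using K by blast
qed

text \<open>
  The library knows compactness of closures only for metrics, so a pseudometric is restricted to
  a set \<open>R\<close> of representatives of the classes of points at distance zero.
\<close>

lemma relatively_compact_in_pseudometric:
  fixes d :: "'a \<Rightarrow> 'a \<Rightarrow> real"
  assumes nonneg: "\<And>x y. 0 \<le> d x y" and sym: "\<And>x y. d x y = d y x"
    and refl: "\<And>x. x \<in> X \<Longrightarrow> d x x = 0"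
    and tri: "\<And>x y z. x \<in> X \<Longrightarrow> y \<in> X \<Longrightarrow> z \<in> X \<Longrightarrow> d x z \<le> d x y + d y z"
    and complete: "\<And>f. range f \<subseteq> X \<Longrightarrow> (\<And>\<epsilon>. \<epsilon> > 0 \<Longrightarrow> \<exists>N::nat. \<forall>m\<ge>N. \<forall>n\<ge>N. d (f m) (f n) < \<epsilon>)
        \<Longrightarrow> \<exists>g\<in>X. (\<lambda>n. d (f n) g) \<longlonglongrightarrow> 0"
    and opn: "\<And>W. openin T W \<longleftrightarrow> W \<subseteq> X \<and> (\<forall>u\<in>W. \<exists>r>0. \<forall>v\<in>X. d v u < r \<longrightarrow> v \<in> W)"
    and U: "U \<subseteq> X"
    and net: "\<And>\<epsilon>. \<epsilon> > 0 \<Longrightarrow> \<exists>K. finite K \<and> K \<subseteq> U \<and> (\<forall>u\<in>U. \<exists>k\<in>K. d u k < \<epsilon>)"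
  shows "relatively_compact_in T U"
proof -
  have "openin T X" unfolding opn using zero_less_one by blast
  then have top: "topspace T = X" unfolding topspace_def using opn by blast
  define q where "q x = (SOME y. y \<in> X \<and> d x y = 0)" for x
  have q: "q x \<in> X" "d x (q x) = 0" if "x \<in> X" for x
    using someI[of "\<lambda>y. y \<in> X \<and> d x y = 0" x] refl[OF that] that unfolding q_def by auto
  have dq: "d (q x) (q y) = d x y" if "x \<in> X" "y \<in> X" for x y
    using tri[of "q x" x "q y"] tri[of x y "q y"] tri[of x "q x" y] tri[of "q x" "q y" y]
      q[OF that(1)] q[OF that(2)] sym[of x "q x"] sym[of y "q y"] that by linarith
  have q_eq: "q x = q y" if "x \<in> X" "y \<in> X" "d x y = 0" for x y
  proof -
    have "d x z = d y z" if "z \<in> X" for z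
      using tri[of x y z] tri[of y x z] sym[of x y] that \<open>x \<in> X\<close> \<open>y \<in> X\<close> \<open>d x y = 0\<close> by linarith
    \<comment> \<open>Points at distance zero define the same predicate, so \<open>SOME\<close>
      picks the same witness for both.\<close>
    then have "(\<lambda>z. z \<in> X \<and> d x z = 0) = (\<lambda>z. z \<in> X \<and> d y z = 0)" by auto
    then show ?thesis by (simp add: q_def)
  qed
  define R where "R = q ` X"
  have RX: "R \<subseteq> X" unfolding R_def using q by blast
  have qR: "q c = c" if "c \<in> R" for c
    using that q_eq q unfolding R_def by (metis imageE)
  interpret Metric_space R d
  proof
    show "d x y = 0 \<longleftrightarrow> x = y" if "x \<in> R" "y \<in> R" for x y
      using that q_eq[of x y] qR[of x] qR[of y] RX refl by auto
    show "d x z \<le> d x y + d y z" if "x \<in> R" "y \<in> R" "z \<in> R" for x y z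
      using tri that RX by blast
  qed (rule nonneg sym)+
  have "mcomplete" unfolding mcomplete_def
  proof (intro allI impI)
    fix f assume f: "MCauchy f"
    then have fR: "range f \<subseteq> R" unfolding MCauchy_def by (rule conjunct1)
    then have "range f \<subseteq> X" using RX by (rule order_trans)
    moreover have "\<exists>N. \<forall>m\<ge>N. \<forall>n\<ge>N. d (f m) (f n) < \<epsilon>" if "\<epsilon> > 0" for \<epsilon>
      using conjunct2[OF f[unfolded MCauchy_def], rule_format, OF that] by simp
    ultimately have "\<exists>g\<in>X. (\<lambda>n. d (f n) g) \<longlonglongrightarrow> 0" by (rule complete)
    then obtain g where g: "g \<in> X" "(\<lambda>n. d (f n) g) \<longlonglongrightarrow> 0" by blast
    have "d (f n) (q g) = d (f n) g" for n
    proof -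
      have "f n \<in> R" using fR by auto
      then show ?thesis using dq[of "f n" g] qR[of "f n"] RX g(1) by auto
    qed
    then have "limitin mtopology f (q g) sequentially"
      using g fR unfolding limitin_metric_dist_null
      by (auto simp: R_def image_subset_iff intro!: always_eventually)
    then show "\<exists>x. limitin mtopology f x sequentially" by blast
  qed
  have qU: "q ` U \<subseteq> R" using U R_def by blast
  have "mtotally_bounded (q ` U)" unfolding mtotally_bounded_def
  proof (intro allI impI)
    fix \<epsilon> :: real assume "\<epsilon> > 0"
    then obtain K where K: "finite K" "K \<subseteq> U" "\<And>u. u \<in> U \<Longrightarrow> \<exists>k\<in>K. d u k < \<epsilon>" using net by meson
    have "q u \<in> (\<Union>x\<in>q ` K. mball x \<epsilon>)" if "u \<in> U" for u
    proof -
      obtain k where k: "k \<in> K" "d u k < \<epsilon>" using K(3) \<open>u \<in> U\<close> by blast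
      then have "k \<in> X" "u \<in> X" using K(2) U that by auto
      then have "d (q k) (q u) < \<epsilon>" using dq[of k u] sym[of u k] k(2) by simp
      moreover have "q k \<in> R" "q u \<in> R" using \<open>k \<in> X\<close> \<open>u \<in> X\<close> by (auto simp: R_def)
      ultimately show ?thesis using k(1) by auto
    qed
    then show "\<exists>K. finite K \<and> K \<subseteq> q ` U \<and> q ` U \<subseteq> (\<Union>x\<in>K. mball x \<epsilon>)"
      using K(1,2) by (intro exI[of _ "q ` K"]) auto
  qed
  define C where "C = mtopology closure_of (q ` U)"
  have C: "compactin mtopology C"
    using mtotally_bounded_eq_compact_closure_of[OF \<open>mcomplete\<close>] \<open>mtotally_bounded (q ` U)\<close>
    unfolding C_def by blast
  have CR: "C \<subseteq> R" using compactin_subset_topspace[OF C] by simp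
  have "q ` U \<subseteq> C" unfolding C_def using qU by (intro closure_of_subset) simp
  \<comment> \<open>The full preimage of \<open>C\<close>. An open set of \<open>T\<close> contains
    with a point every point at distance zero from it, so a finite cover of \<open>C\<close> by
    traces on \<open>R\<close> lifts to a finite cover of \<open>K\<close>.\<close>
  define K where "K = {x \<in> X. q x \<in> C}"
  have "compactin T K" unfolding compactin_def
  proof (intro conjI allI impI)
    show "K \<subseteq> topspace T" by (auto simp: top K_def)
    fix \<W> assume "Ball \<W> (openin T) \<and> K \<subseteq> \<Union>\<W>"
    then have W: "\<And>W. W \<in> \<W> \<Longrightarrow> openin T W" "K \<subseteq> \<Union>\<W>" by auto
    have "openin mtopology (W \<inter> R)" if "W \<in> \<W>" for W
      unfolding openin_mtopology
    proof (intro conjI allI impI)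
      fix x assume x: "x \<in> W \<inter> R"
      then obtain r where "r > 0" "\<And>v. v \<in> X \<Longrightarrow> d v x < r \<Longrightarrow> v \<in> W"
        using W(1)[OF \<open>W \<in> \<W>\<close>] unfolding opn by blast
      then show "\<exists>r>0. mball x r \<subseteq> W \<inter> R"
        using RX by (intro exI[of _ r]) (auto simp: sym)
    qed auto
    moreover have "C \<subseteq> \<Union>((\<lambda>W. W \<inter> R) ` \<W>)"
    proof
      fix c assume "c \<in> C"
      then have "c \<in> K" "c \<in> R" unfolding K_def using CR RX qR by auto
      then show "c \<in> \<Union>((\<lambda>W. W \<inter> R) ` \<W>)" using W(2) by auto
    qed
    ultimately obtain \<F>' where F': "finite \<F>'" "\<F>' \<subseteq> (\<lambda>W. W \<inter> R) ` \<W>" "C \<subseteq> \<Union>\<F>'"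
      using compactinD[OF C, of "(\<lambda>W. W \<inter> R) ` \<W>"] by auto
    obtain \<F> where F: "\<F> \<subseteq> \<W>" "finite \<F>" "\<F>' = (\<lambda>W. W \<inter> R) ` \<F>"
      using finite_subset_image[OF F'(1,2)] by blast
    have "K \<subseteq> \<Union>\<F>"
    proof
      fix x assume "x \<in> K"
      then have x: "x \<in> X" "q x \<in> C" by (auto simp: K_def)
      then obtain W where "W \<in> \<F>" "q x \<in> W" using F F'(3) by auto
      then obtain r where "r > 0" "\<And>v. v \<in> X \<Longrightarrow> d v (q x) < r \<Longrightarrow> v \<in> W"
        using W(1) F(1) unfolding opn by blast
      then have "x \<in> W" using q(2)[OF x(1)] x(1) by simp
      then show "x \<in> \<Union>\<F>" using \<open>W \<in> \<F>\<close> by blast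
    qed
    then show "\<exists>\<F>. finite \<F> \<and> \<F> \<subseteq> \<W> \<and> K \<subseteq> \<Union>\<F>" using F by blast
  qed
  \<comment> \<open>\<open>T\<close> need not be Hausdorff, so closedness does not follow from
    compactness; it is inherited from \<open>C\<close> through the isometry property
    \<open>dq\<close>.\<close>
  moreover have "closedin T K" unfolding closedin_def
  proof
    show "openin T (topspace T - K)" unfolding opn top
    proof (intro conjI ballI)
      fix x assume "x \<in> X - K"
      then have x: "x \<in> X" "q x \<in> R - C" unfolding K_def R_def by auto
      have "openin mtopology (R - C)"
        using closedin_closure_of[of mtopology "q ` U"] unfolding closedin_def C_def by simp
      then obtain r where r: "r > 0" "mball (q x) r \<subseteq> R - C"
        using x(2) unfolding openin_mtopology by blast
      have "v \<in> X - K" if "v \<in> X" "d v x < r" for v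
      proof -
        have "q v \<in> R" "q x \<in> R" "d (q x) (q v) < r"
          using dq[OF that(1) x(1)] that x(1) sym[of "q x" "q v"] by (auto simp: R_def)
        then have "q v \<in> mball (q x) r" by simp
        then show ?thesis using r(2) that by (auto simp: K_def)
      qed
      then show "\<exists>r>0. \<forall>v\<in>X. d v x < r \<longrightarrow> v \<in> X - K" using r(1) by blast
    qed auto
  qed (auto simp: top K_def)
  moreover have "U \<subseteq> K" unfolding K_def using \<open>q ` U \<subseteq> C\<close> U by blast
  ultimately have "compactin T (T closure_of U)"
    by (meson closed_compactin closedin_closure_of closure_of_minimal)
  then show ?thesis unfolding relatively_compact_in_def using top U by blast
qed

section \<open>Completeness of the \<open>L^p\<close> spaces\<close>

lemma Lp_space_borel_measurable_norm_diff:
  assumes "S \<in> sets lebesgue" "u \<in> Lp_space p S" "v \<in> Lp_space p S"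
  shows "(\<lambda>t. norm (u t - v t)) \<in> borel_measurable (lebesgue_on S)"
  using assms by (intro borel_measurable_norm_strongly_measurable strongly_measurable_diff)
    (auto simp: Lp_space_def)

lemma Lp_norm_triangle:
  assumes "1 \<le> p" "S \<in> sets lebesgue"
    "strongly_measurable (lebesgue_on S) u" "strongly_measurable (lebesgue_on S) v"
  shows "Lp_norm p S (\<lambda>t. norm (u t - v t)) \<le> Lp_norm p S (\<lambda>t. norm (u t)) + Lp_norm p S (\<lambda>t. norm (v t))"
proof -
  note [measurable] = borel_measurable_norm_strongly_measurable[OF assms(2,3)]
    borel_measurable_norm_strongly_measurable[OF assms(2,4)]
    borel_measurable_norm_strongly_measurable[OF assms(2) strongly_measurable_diff[OF assms(3,4)]]
  have "Lp_norm p S (\<lambda>t. norm (u t - v t)) \<le> Lp_norm p S (\<lambda>t. norm (u t) + norm (v t))"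
    by (intro Lp_norm_mono_AE assms(1) AE_I2) (auto intro: norm_triangle_ineq4)
  also have "\<dots> \<le> Lp_norm p S (\<lambda>t. norm (u t)) + Lp_norm p S (\<lambda>t. norm (v t))"
    by (intro Lp_norm_add_le assms(1)) measurable
  finally show ?thesis .
qed

lemma Lp_norm_diff_triangle:
  assumes "1 \<le> p" "S \<in> sets lebesgue" "u \<in> Lp_space p S" "v \<in> Lp_space p S" "w \<in> Lp_space p S"
  shows "Lp_norm p S (\<lambda>t. norm (u t - w t))
    \<le> Lp_norm p S (\<lambda>t. norm (u t - v t)) + Lp_norm p S (\<lambda>t. norm (v t - w t))"
  using Lp_norm_triangle[OF assms(1,2), of "\<lambda>t. u t - v t" "\<lambda>t. w t - v t"] assms(3-5)
  by (simp add: Lp_space_def strongly_measurable_diff norm_minus_commute)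

lemma Lp_norm_diff_finite:
  assumes "1 \<le> p" "S \<in> sets lebesgue" "u \<in> Lp_space p S" "v \<in> Lp_space p S"
  shows "Lp_norm p S (\<lambda>t. norm (u t - v t)) < \<infinity>"
  using Lp_norm_triangle[OF assms(1,2), of u v] assms(3,4)
  by (auto simp: Lp_space_def intro: le_less_trans)

text \<open>The Riesz-Fischer argument: consecutive distances \<open>(1/4)^k\<close> along a
  subsequence and thresholds \<open>(1/2)^k\<close> in Chebyshev's inequality leave exceptional sets
  of summable measure \<open>(1/2)^k\<close>. The subsequence therefore converges almost everywhere,
  and Fatou's lemma carries the Cauchy estimate to the limit.\<close>

lemma Lp_space_complete:
  fixes f :: "nat \<Rightarrow> real \<Rightarrow> 'b::banach"
  assumes p: "1 \<le> p" and S: "S \<in> lmeasurable" and f: "\<And>n. f n \<in> Lp_space p S"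
    and Cauchy: "\<And>\<epsilon>::real. \<epsilon> > 0 \<Longrightarrow>
      \<exists>N. \<forall>m\<ge>N. \<forall>n\<ge>N. Lp_norm p S (\<lambda>t. norm (f m t - f n t)) \<le> ennreal \<epsilon>"
  obtains g where "g \<in> Lp_space p S"
    "\<And>\<epsilon>::real. \<epsilon> > 0 \<Longrightarrow> \<exists>N. \<forall>n\<ge>N. Lp_norm p S (\<lambda>t. norm (f n t - g t)) \<le> ennreal \<epsilon>"
proof -
  have S': "S \<in> sets lebesgue" using S by auto
  have sm: "strongly_measurable (lebesgue_on S) (f n)" for n using f by (auto simp: Lp_space_def)
  have [measurable]: "(\<lambda>t. norm (f m t - f n t)) \<in> borel_measurable (lebesgue_on S)" for m n
    using f by (intro Lp_space_borel_measurable_norm_diff[OF S'])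
  have "\<forall>k::nat. \<exists>N. \<forall>m\<ge>N. \<forall>n\<ge>N. Lp_norm p S (\<lambda>t. norm (f m t - f n t)) \<le> ennreal ((1/4)^k)"
    using Cauchy by simp
  then obtain N where N: "\<And>k m n. m \<ge> N k \<Longrightarrow> n \<ge> N k \<Longrightarrow>
      Lp_norm p S (\<lambda>t. norm (f m t - f n t)) \<le> ennreal ((1/4)^k)"
    by metis
  \<comment> \<open>The sum makes \<open>r\<close> monotone and at least \<open>N k\<close>; the
    summand \<open>k\<close> makes it unbounded, so the subsequence eventually enters every
    tail.\<close>
  define r where "r k = (\<Sum>i\<le>k. N i) + k" for k
  have r: "r k \<ge> N k" "r k \<ge> k" "r (Suc k) \<ge> r k" for k
    unfolding r_def by (auto intro: member_le_sum trans_le_add1)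
  have "AE t in lebesgue_on S. \<forall>\<^sub>F k in sequentially. norm (f (r (Suc k)) t - f (r k) t) \<le> (1/2)^k"
  proof (rule AE_eventually_le_if_summable_measure[where c = "\<lambda>k. (1/2)^k"])
    fix k
    have "emeasure (lebesgue_on S) {t \<in> space (lebesgue_on S). (1/2)^k < \<bar>norm (f (r (Suc k)) t - f (r k) t)\<bar>}
      \<le> ennreal ((1/4)^k / (1/2)^k)"
      using r[of k] by (intro Lp_norm_Chebyshev[OF p] N) (auto intro!: power_mono)
    also have "(1/4)^k / (1/2)^k = ((1/2)^k :: real)" by (simp flip: power_divide)
    finally show "emeasure (lebesgue_on S) {t \<in> space (lebesgue_on S). (1/2)^k < norm (f (r (Suc k)) t - f (r k) t)}
      \<le> ennreal ((1/2)^k)" by simp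
    show "{t \<in> space (lebesgue_on S). (1/2)^k < norm (f (r (Suc k)) t - f (r k) t)} \<in> sets (lebesgue_on S)"
      by measurable
  qed auto
  then have lim: "AE t in lebesgue_on S. (\<lambda>k. f (r k) t) \<longlonglongrightarrow> lim (\<lambda>k. f (r k) t)"
  proof eventually_elim
    case (elim t)
    have "summable (\<lambda>k. f (r (Suc k)) t - f (r k) t)"
      by (rule summable_comparison_test_ev[OF elim]) (intro summable_geometric, simp)
    then have "convergent (\<lambda>n. \<Sum>k<n. f (r (Suc k)) t - f (r k) t)"
      by (simp add: summable_iff_convergent)
    then have "convergent (\<lambda>n. f (r n) t - f (r 0) t)"
      by (subst (asm) sum_lessThan_telescope)
    from convergent_add[OF this convergent_const[of "f (r 0) t"]]
    show ?case by (simp add: convergent_LIMSEQ_iff)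
  qed
  define g where "g t = lim (\<lambda>k. f (r k) t)" for t
  have g: "strongly_measurable (lebesgue_on S) g"
    using strongly_measurable_lim[OF S sm lim] unfolding g_def .
  have [measurable]: "(\<lambda>t. norm (f n t - g t)) \<in> borel_measurable (lebesgue_on S)" for n
    by (intro borel_measurable_norm_strongly_measurable[OF S'] strongly_measurable_diff sm g)
  have close: "\<exists>N. \<forall>n\<ge>N. Lp_norm p S (\<lambda>t. norm (f n t - g t)) \<le> ennreal \<epsilon>" if "\<epsilon> > 0" for \<epsilon>
  proof -
    obtain N where N: "\<And>m n. m \<ge> N \<Longrightarrow> n \<ge> N \<Longrightarrow> Lp_norm p S (\<lambda>t. norm (f m t - f n t)) \<le> ennreal \<epsilon>"
      using Cauchy[OF \<open>\<epsilon> > 0\<close>] by blast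
    \<comment> \<open>Starting the subsequence at \<open>N\<close> keeps all its indices at least
      \<open>N\<close>, as \<open>r j \<ge> j\<close>; the Cauchy bound then holds for every
      \<open>k\<close>.\<close>
    have "Lp_norm p S (\<lambda>t. norm (f n t - g t)) \<le> ennreal \<epsilon>" if "n \<ge> N" for n
    proof (rule Lp_norm_Fatou[OF p, where f = "\<lambda>k t. norm (f n t - f (r (N + k)) t)"])
      show "AE t in lebesgue_on S. (\<lambda>k. norm (f n t - f (r (N + k)) t)) \<longlonglongrightarrow> norm (f n t - g t)"
        using lim
      proof eventually_elim
        case (elim t)
        have "(\<lambda>k. f (r (N + k)) t) \<longlonglongrightarrow> g t"
          using LIMSEQ_ignore_initial_segment[OF elim, of N] by (simp add: g_def add.commute)
        then show ?case by (intro tendsto_intros)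
      qed
      show "Lp_norm p S (\<lambda>t. norm (f n t - f (r (N + k)) t)) \<le> ennreal \<epsilon>" for k
        using r(2)[of "N + k"] that by (intro N) auto
    qed (use \<open>\<epsilon> > 0\<close> in auto)
    then show ?thesis by blast
  qed
  have "g \<in> Lp_space p S"
  proof -
    obtain n where n: "Lp_norm p S (\<lambda>t. norm (f n t - g t)) \<le> ennreal 1" using close[of 1] by auto
    have "Lp_norm p S (\<lambda>t. norm (g t)) \<le> Lp_norm p S (\<lambda>t. norm (f n t)) + Lp_norm p S (\<lambda>t. norm (f n t - g t))"
      using Lp_norm_triangle[OF p S' sm strongly_measurable_diff[OF sm g], of n n] by simp
    also have "\<dots> < \<infinity>" using n f[of n] by (auto simp: Lp_space_def intro: le_less_trans)
    finally show ?thesis using g by (simp add: Lp_space_def)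
  qed
  then show ?thesis using close by (rule that)
qed

lemma Lp_norm_zero: "1 \<le> p \<Longrightarrow> Lp_norm p S (\<lambda>t. 0) = 0"
  using Lp_norm_le_iff[of p 0 S "\<lambda>_. 0"] Lp_norm_infinity_le_iff[of p "\<lambda>_. 0" S 0] by auto

lemma relatively_compact_in_Lp_topology:
  fixes U :: "(real \<Rightarrow> 'b::banach) set"
  assumes p: "1 \<le> p" and S: "S \<in> lmeasurable" and U: "U \<subseteq> Lp_space p S"
    and net: "\<And>\<epsilon>::real. \<epsilon> > 0 \<Longrightarrow> \<exists>K. finite K \<and> K \<subseteq> U \<and>
        (\<forall>u\<in>U. \<exists>k\<in>K. Lp_norm p S (\<lambda>t. norm (u t - k t)) \<le> ennreal \<epsilon>)"
  shows "relatively_compact_in (Lp_topology p S) U"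
proof -
  have S': "S \<in> sets lebesgue" using S by auto
  \<comment> \<open>On \<open>Lp_space\<close> the norms of differences are finite, so
    \<open>enn2real\<close> loses nothing there. Elsewhere \<open>d\<close> is still nonnegative and
    symmetric, which is all that is asked of it outside \<open>X\<close>.\<close>
  define d where "d u v = enn2real (Lp_norm p S (\<lambda>t. norm (u t - v t)))" for u v :: "real \<Rightarrow> 'b"
  have d: "ennreal (d u v) = Lp_norm p S (\<lambda>t. norm (u t - v t))" if "u \<in> Lp_space p S" "v \<in> Lp_space p S" for u v
    using Lp_norm_diff_finite[OF p S' that] by (simp add: d_def)
  have d_less: "d u v < \<epsilon> \<longleftrightarrow> Lp_norm p S (\<lambda>t. norm (u t - v t)) < ennreal \<epsilon>"
    if "u \<in> Lp_space p S" "v \<in> Lp_space p S" for u v \<epsilon>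
    unfolding d[OF that, symmetric] by (simp add: d_def ennreal_less_iff)
  have d_le: "d u v \<le> \<epsilon> \<longleftrightarrow> Lp_norm p S (\<lambda>t. norm (u t - v t)) \<le> ennreal \<epsilon>"
    if "u \<in> Lp_space p S" "v \<in> Lp_space p S" "\<epsilon> > 0" for u v \<epsilon>
    unfolding d[OF that(1,2), symmetric] using that(3) by simp
  show ?thesis
  proof (rule relatively_compact_in_pseudometric[where d = d and X = "Lp_space p S"])
    show "0 \<le> d x y" "d x y = d y x" for x y by (simp_all add: d_def norm_minus_commute)
    show "d x x = 0" if "x \<in> Lp_space p S" for x
    proof -
      show ?thesis unfolding d_def using Lp_norm_zero[OF p] by simp
    qed
    show "d x z \<le> d x y + d y z" if "x \<in> Lp_space p S" "y \<in> Lp_space p S" "z \<in> Lp_space p S" for x y z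
    proof -
      have "ennreal (d x z) \<le> ennreal (d x y) + ennreal (d y z)"
        using Lp_norm_diff_triangle[OF p S' that] that by (simp add: d)
      then show ?thesis by (simp add: d_def flip: ennreal_plus)
    qed
    show "\<exists>g\<in>Lp_space p S. (\<lambda>n. d (f n) g) \<longlonglongrightarrow> 0"
      if f: "range f \<subseteq> Lp_space p S"
        and Cauchy: "\<And>\<epsilon>. \<epsilon> > 0 \<Longrightarrow> \<exists>N::nat. \<forall>m\<ge>N. \<forall>n\<ge>N. d (f m) (f n) < \<epsilon>" for f
    proof -
      have fn: "f n \<in> Lp_space p S" for n using f by auto
      have "\<exists>N. \<forall>m\<ge>N. \<forall>n\<ge>N. Lp_norm p S (\<lambda>t. norm (f m t - f n t)) \<le> ennreal \<epsilon>" if "\<epsilon> > 0" for \<epsilon>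
        using Cauchy[OF that] d_less[OF fn fn] by (metis less_imp_le)
      from Lp_space_complete[OF p S fn this] obtain g where g: "g \<in> Lp_space p S"
        "\<And>\<epsilon>. \<epsilon> > 0 \<Longrightarrow> \<exists>N. \<forall>n\<ge>N. Lp_norm p S (\<lambda>t. norm (f n t - g t)) \<le> ennreal \<epsilon>" by blast
      have "(\<lambda>n. d (f n) g) \<longlonglongrightarrow> 0"
      proof (rule LIMSEQ_I)
        fix \<epsilon> :: real assume "\<epsilon> > 0"
        then obtain N where "\<And>n. n \<ge> N \<Longrightarrow> d (f n) g \<le> \<epsilon> / 2"
          using g(2)[of "\<epsilon> / 2"] d_le[OF fn g(1), of "\<epsilon> / 2"] by auto
        then show "\<exists>N. \<forall>n\<ge>N. norm (d (f n) g - 0) < \<epsilon>"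
          using \<open>\<epsilon> > 0\<close> by (intro exI[of _ N]) (force simp: d_def)
      qed
      then show ?thesis using g(1) by blast
    qed
    show "openin (Lp_topology p S) W \<longleftrightarrow> W \<subseteq> Lp_space p S \<and>
        (\<forall>u\<in>W. \<exists>r>0. \<forall>v\<in>Lp_space p S. d v u < r \<longrightarrow> v \<in> W)" for W
      unfolding openin_Lp_topology Lp_open_def using d_less by (auto simp: subset_iff)
    show "\<exists>K. finite K \<and> K \<subseteq> U \<and> (\<forall>u\<in>U. \<exists>k\<in>K. d u k < \<epsilon>)" if "\<epsilon> > 0" for \<epsilon>
    proof -
      obtain K where K: "finite K" "K \<subseteq> U"
          "\<And>u. u \<in> U \<Longrightarrow> \<exists>k\<in>K. Lp_norm p S (\<lambda>t. norm (u t - k t)) \<le> ennreal (\<epsilon> / 2)"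
        using net[of "\<epsilon> / 2"] \<open>\<epsilon> > 0\<close> by auto
      have "\<exists>k\<in>K. d u k < \<epsilon>" if "u \<in> U" for u
      proof -
        obtain k where "k \<in> K" "d u k \<le> \<epsilon> / 2"
          using K(2) K(3)[OF \<open>u \<in> U\<close>] d_le[of u _ "\<epsilon> / 2"] U \<open>u \<in> U\<close> \<open>\<epsilon> > 0\<close> by auto
        then show ?thesis using \<open>\<epsilon> > 0\<close> by (intro bexI[of _ k]) auto
      qed
      then show ?thesis using K(1,2) by blast
    qed
  qed (rule U)
qed

section \<open>The Ehrling inequality on the cone\<close>

lemma lies_in_Y_diff:
  assumes "linear iB" "linear iY" "inj iY" "lies_in_Y iB iY u" "lies_in_Y iB iY v"
  shows "lies_in_Y iB iY (u - v)" "as_Y iB iY (u - v) = as_Y iB iY u - as_Y iB iY v"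
proof -
  obtain a b where ab: "iB u = iY a" "iB v = iY b" using assms(4,5) unfolding lies_in_Y_def by auto
  have *: "iB (u - v) = iY (a - b)" using ab assms(1,2) by (simp add: linear_diff)
  then show "lies_in_Y iB iY (u - v)" unfolding lies_in_Y_def by blast
  show "as_Y iB iY (u - v) = as_Y iB iY u - as_Y iB iY v"
    unfolding as_Y_def * ab using assms(3) by simp
qed

lemma lies_in_Y_scaleR:
  assumes "linear iB" "linear iY" "inj iY" "lies_in_Y iB iY u"
  shows "lies_in_Y iB iY (c *\<^sub>R u)" "as_Y iB iY (c *\<^sub>R u) = c *\<^sub>R as_Y iB iY u"
proof -
  obtain a where a: "iB u = iY a" using assms(4) unfolding lies_in_Y_def by auto
  have *: "iB (c *\<^sub>R u) = iY (c *\<^sub>R a)" using a assms(1,2) by (simp add: linear_scale)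
  then show "lies_in_Y iB iY (c *\<^sub>R u)" unfolding lies_in_Y_def by blast
  show "as_Y iB iY (c *\<^sub>R u) = c *\<^sub>R as_Y iB iY u"
    unfolding as_Y_def * a using assms(3) by simp
qed

lemma cone_compactly_embedded_subseq:
  assumes "cone_compactly_embedded M s" "\<And>n. u n \<in> M" "\<And>n::nat. s (u n) \<le> C"
  obtains r l where "strict_mono r" "(u \<circ> r) \<longlonglongrightarrow> l"
proof -
  have "range u \<subseteq> M \<and> bdd_above (range (\<lambda>n. s (u n)))"
    using assms(2,3) by (auto intro!: bdd_aboveI[where M = C])
  then show ?thesis
    using assms(1) that unfolding cone_compactly_embedded_def convergent_def by blast
qed

text \<open>The differences \<open>a n - b n\<close> need not lie in the cone, so compactness is
  applied to \<open>a\<close> and \<open>b\<close> one after the other. The differences then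
  converge along a subsequence, hence are bounded, and the growing factor \<open>n\<close> forces
  their \<open>Y\<close> norms to 0. Compatibility makes the limit 0, although the \<open>B\<close>
  norms stay above \<epsilon>.\<close>

lemma Ehrling_inequality_normalized:
  fixes iB :: "'b::real_normed_vector \<Rightarrow> 'v::real_vector" and iY :: "'y::real_normed_vector \<Rightarrow> 'v"
  assumes iB: "linear iB" and iY: "linear iY" "inj iY"
    and compact: "cone_compactly_embedded M s"
    and compatible: "\<And>(w :: nat \<Rightarrow> 'b) w0.
           w \<longlonglongrightarrow> w0 \<Longrightarrow> (\<And>n. lies_in_Y iB iY (w n)) \<Longrightarrow>
           (\<lambda>n. as_Y iB iY (w n)) \<longlonglongrightarrow> 0 \<Longrightarrow> w0 = 0"
    and a: "\<And>n. a n \<in> M" "\<And>n. s (a n) \<le> 1" "\<And>n. lies_in_Y iB iY (a n)"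
    and b: "\<And>n. b n \<in> M" "\<And>n. s (b n) \<le> 1" "\<And>n. lies_in_Y iB iY (b n)"
    and \<epsilon>: "\<epsilon> > 0"
    and gt: "\<And>n::nat. \<epsilon> + real n * norm (as_Y iB iY (a n) - as_Y iB iY (b n)) < norm (a n - b n)"
  shows False
proof -
  obtain r1 \<alpha> where r1: "strict_mono r1" "(a \<circ> r1) \<longlonglongrightarrow> \<alpha>"
    using cone_compactly_embedded_subseq[OF compact a(1,2)] .
  obtain r2 \<beta> where r2: "strict_mono r2" "((b \<circ> r1) \<circ> r2) \<longlonglongrightarrow> \<beta>"
    using cone_compactly_embedded_subseq[OF compact, of "b \<circ> r1" 1] b(1,2) by auto
  define r where "r = r1 \<circ> r2"
  define w where "w k = a (r k) - b (r k)" for k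
  have r: "r k \<ge> k" for k
    using strict_mono_o[OF r1(1) r2(1)] unfolding r_def by (rule seq_suble)
  have w_lim: "w \<longlonglongrightarrow> \<alpha> - \<beta>"
    using tendsto_diff[OF LIMSEQ_subseq_LIMSEQ[OF r1(2) r2(1)] r2(2)]
    by (simp add: w_def[abs_def] r_def comp_def)
  have wY: "lies_in_Y iB iY (w k)" "as_Y iB iY (w k) = as_Y iB iY (a (r k)) - as_Y iB iY (b (r k))" for k
    unfolding w_def using lies_in_Y_diff[OF iB iY a(3) b(3)] by auto
  \<comment> \<open>The subsequence has coefficients \<open>r k \<ge> k\<close>, so the weaker
    coefficient \<open>k\<close> may be used.\<close>
  have w_gt: "\<epsilon> + real k * norm (as_Y iB iY (w k)) \<le> norm (w k)" for k
  proof -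
    have "real k * norm (as_Y iB iY (w k)) \<le> real (r k) * norm (as_Y iB iY (w k))"
      using r[of k] by (intro mult_right_mono) auto
    moreover have "\<epsilon> + real (r k) * norm (as_Y iB iY (w k)) < norm (w k)"
      using gt[of "r k"] unfolding wY(2) by (simp add: w_def)
    ultimately show ?thesis by linarith
  qed
  have "bounded (range w)"
    using w_lim convergent_imp_bounded by blast
  then obtain D where D: "\<And>k. norm (w k) \<le> D"
    unfolding bounded_iff by auto
  have "(\<lambda>k. D / real k) \<longlonglongrightarrow> 0"
    by (rule lim_const_over_n)
  moreover have "\<forall>\<^sub>F k in sequentially. norm (as_Y iB iY (w k)) \<le> D / real k"
    using eventually_gt_at_top[of 0]
  proof eventually_elim
    case (elim k)
    have "real k * norm (as_Y iB iY (w k)) \<le> D" using w_gt[of k] D[of k] \<epsilon> by linarith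
    then show ?case using elim by (simp add: field_simps)
  qed
  ultimately have "(\<lambda>k. as_Y iB iY (w k)) \<longlonglongrightarrow> 0"
    by (rule Lim_null_comparison[rotated])
  then have "\<alpha> - \<beta> = 0" using compatible[OF w_lim wY(1)] by blast
  then have "(\<lambda>k. norm (w k)) \<longlonglongrightarrow> 0" using tendsto_norm[OF w_lim] by simp
  moreover have "\<epsilon> \<le> norm (w k)" for k
  proof -
    have "0 \<le> real k * norm (as_Y iB iY (w k))" by simp
    then show ?thesis using w_gt[of k] by linarith
  qed
  ultimately have "\<epsilon> \<le> 0" by (intro LIMSEQ_le_const) auto
  then show False using \<epsilon> by simp
qed

text \<open>Were every integer \<open>n\<close> to fail as the constant \<open>C\<close>, each would
  have a violating pair. Both sides are homogeneous of degree 1 under a common nonnegative factor,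
  which the cone permits, so the pairs can be scaled to \<open>s u + s v = 1\<close>.\<close>

lemma Ehrling_inequality:
  fixes iB :: "'b::real_normed_vector \<Rightarrow> 'v::real_vector" and iY :: "'y::real_normed_vector \<Rightarrow> 'v"
  assumes iB: "linear iB" and iY: "linear iY" "inj iY" and cone: "seminormed_nonneg_cone M s"
    and compact: "cone_compactly_embedded M s"
    and compatible: "\<And>(w :: nat \<Rightarrow> 'b) w0.
           w \<longlonglongrightarrow> w0 \<Longrightarrow> (\<And>n. lies_in_Y iB iY (w n)) \<Longrightarrow>
           (\<lambda>n. as_Y iB iY (w n)) \<longlonglongrightarrow> 0 \<Longrightarrow> w0 = 0"
    and \<epsilon>: "\<epsilon> > 0"
  obtains C where "0 \<le> C" "\<And>u v. u \<in> M \<Longrightarrow> v \<in> M \<Longrightarrow> lies_in_Y iB iY u \<Longrightarrow> lies_in_Y iB iY v \<Longrightarrow>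
      norm (u - v) \<le> \<epsilon> * (s u + s v) + C * norm (as_Y iB iY u - as_Y iB iY v)"
proof (rule ccontr)
  let ?P = "\<lambda>n::nat. \<lambda>(u, v). u \<in> M \<and> v \<in> M \<and> lies_in_Y iB iY u \<and> lies_in_Y iB iY v \<and>
      \<epsilon> * (s u + s v) + real n * norm (as_Y iB iY u - as_Y iB iY v) < norm (u - v)"
  assume contr: "\<not> thesis"
  have "\<forall>n. \<exists>z. ?P n z"
  proof (intro allI, rule ccontr)
    fix n :: nat assume "\<nexists>z. ?P n z"
    then have "norm (u - v) \<le> \<epsilon> * (s u + s v) + real n * norm (as_Y iB iY u - as_Y iB iY v)"
      if "u \<in> M" "v \<in> M" "lies_in_Y iB iY u" "lies_in_Y iB iY v" for u v
      using that by (simp add: not_less)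
    then show False using that[of "real n"] contr by simp
  qed
  then obtain z where z: "\<forall>n. ?P n (z n)" by (rule choice[THEN exE])
  define u where "u n = fst (z n)" for n
  define v where "v n = snd (z n)" for n
  have uv: "u n \<in> M" "v n \<in> M" "lies_in_Y iB iY (u n)" "lies_in_Y iB iY (v n)"
      "\<epsilon> * (s (u n) + s (v n)) + real n * norm (as_Y iB iY (u n) - as_Y iB iY (v n)) < norm (u n - v n)" for n
    using z unfolding u_def v_def by (simp_all add: case_prod_beta)
  define c where "c n = s (u n) + s (v n)" for n
  have s_nonneg: "0 \<le> s x" if "x \<in> M" for x
    using cone that unfolding seminormed_nonneg_cone_def by blast
  have s_scale: "t *\<^sub>R x \<in> M" "s (t *\<^sub>R x) = t * s x" if "x \<in> M" "0 \<le> t" for x t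
    using cone that unfolding seminormed_nonneg_cone_def by blast+
  \<comment> \<open>If both seminorms vanish, then \<open>u n = v n = 0\<close> and the strict
    inequality reads \<open>0 < 0\<close>.\<close>
  have c: "c n > 0" for n
  proof (rule ccontr)
    assume "\<not> c n > 0"
    then have "s (u n) = 0" "s (v n) = 0"
      using s_nonneg[OF uv(1), of n] s_nonneg[OF uv(2), of n] unfolding c_def by linarith+
    then have "u n = 0" "v n = 0"
      using cone uv(1,2) unfolding seminormed_nonneg_cone_def by blast+
    then show False using uv(5)[of n] \<open>s (u n) = 0\<close> \<open>s (v n) = 0\<close> by simp
  qed
  define a where "a n = (1 / c n) *\<^sub>R u n" for n
  define b where "b n = (1 / c n) *\<^sub>R v n" for n
  have c': "0 \<le> 1 / c n" for n using c[of n] by simp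
  note Ya = lies_in_Y_scaleR[OF iB iY uv(3)] and Yb = lies_in_Y_scaleR[OF iB iY uv(4)]
  show False
  proof (rule Ehrling_inequality_normalized[where a = a and b = b, OF iB iY compact _ _ _ _ _ _ _ \<epsilon>])
    show "w0 = 0" if "w \<longlonglongrightarrow> w0" "\<And>n. lies_in_Y iB iY (w n)" "(\<lambda>n. as_Y iB iY (w n)) \<longlonglongrightarrow> 0" for w w0
      using that by (rule compatible)
    fix n
    show "a n \<in> M" "b n \<in> M" unfolding a_def b_def using s_scale uv c' by blast+
    show "lies_in_Y iB iY (a n)" "lies_in_Y iB iY (b n)" unfolding a_def b_def by (rule Ya Yb)+
    have "s (a n) = 1 / c n * s (u n)" "s (b n) = 1 / c n * s (v n)"
      unfolding a_def b_def by (rule s_scale(2)[OF uv(1) c'] s_scale(2)[OF uv(2) c'])+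
    moreover have "s (u n) \<le> c n" "s (v n) \<le> c n"
      using s_nonneg[OF uv(1), of n] s_nonneg[OF uv(2), of n] unfolding c_def by linarith+
    ultimately show "s (a n) \<le> 1" "s (b n) \<le> 1" using c[of n] by simp_all
    have "norm (as_Y iB iY (a n) - as_Y iB iY (b n)) = (1 / c n) * norm (as_Y iB iY (u n) - as_Y iB iY (v n))"
      unfolding a_def b_def Ya(2) Yb(2) scaleR_diff_right[symmetric] norm_scaleR using c' by simp
    moreover have "norm (a n - b n) = (1 / c n) * norm (u n - v n)"
      unfolding a_def b_def scaleR_diff_right[symmetric] norm_scaleR using c' by simp
    moreover have "(1 / c n) * (\<epsilon> * c n + real n * norm (as_Y iB iY (u n) - as_Y iB iY (v n))) < (1 / c n) * norm (u n - v n)"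
      using uv(5)[of n] c[of n] unfolding c_def[symmetric] by (intro mult_strict_left_mono) auto
    ultimately show "\<epsilon> + real n * norm (as_Y iB iY (a n) - as_Y iB iY (b n)) < norm (a n - b n)"
      using c[of n] by (simp add: distrib_left)
  qed
qed

text \<open>Compactness of the embedding provides convergent subsequences whose limits may lie
  outside \<open>M\<close>. They are still Cauchy, which is what total boundedness asks for.\<close>

lemma cone_sublevel_finite_net:
  fixes M :: "'b::real_normed_vector set"
  assumes "cone_compactly_embedded M s" "\<epsilon> > 0"
  obtains F where "finite F" "\<And>x. x \<in> M \<Longrightarrow> s x \<le> R \<Longrightarrow> \<exists>c\<in>F. dist c x < \<epsilon>"
proof -
  have "Met_TC.mtotally_bounded {x \<in> M. s x \<le> R}"
    unfolding Met_TC.mtotally_bounded_sequentially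
  proof (intro conjI allI impI)
    fix \<sigma> :: "nat \<Rightarrow> 'b" assume "range \<sigma> \<subseteq> {x \<in> M. s x \<le> R}"
    then have \<sigma>: "\<And>n. \<sigma> n \<in> M" "\<And>n. s (\<sigma> n) \<le> R" by auto
    obtain r l where r: "strict_mono r" "(\<sigma> \<circ> r) \<longlonglongrightarrow> l"
      using cone_compactly_embedded_subseq[OF assms(1) \<sigma>] .
    have "Met_TC.MCauchy (\<sigma> \<circ> r)" using LIMSEQ_imp_Cauchy[OF r(2)] by simp
    with r(1) show "\<exists>r. strict_mono r \<and> Met_TC.MCauchy (\<sigma> \<circ> r)" by (intro exI conjI)
  qed simp
  then obtain F where "finite F" and F: "{x \<in> M. s x \<le> R} \<subseteq> (\<Union>c\<in>F. Met_TC.mball c \<epsilon>)"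
    unfolding Met_TC.mtotally_bounded_def using assms(2) by blast
  show ?thesis
  proof (rule that[OF \<open>finite F\<close>])
    fix x assume "x \<in> M" "s x \<le> R"
    with F have "x \<in> (\<Union>c\<in>F. Met_TC.mball c \<epsilon>)" by blast
    then show "\<exists>c\<in>F. dist c x < \<epsilon>" by simp
  qed
qed

text \<open>The compact embedding is continuous: the sublevel set at 1 is totally bounded, hence
  norm bounded, and homogeneity does the rest. This is what places \<open>U\<close> in
  \<open>Lp_space\<close>.\<close>

lemma cone_norm_bound:
  fixes M :: "'b::real_normed_vector set"
  assumes cone: "seminormed_nonneg_cone M s" and "cone_compactly_embedded M s"
  obtains C where "0 \<le> C" "\<And>x. x \<in> M \<Longrightarrow> norm x \<le> C * s x"
proof -
  obtain F where F: "finite F" "\<And>x. x \<in> M \<Longrightarrow> s x \<le> 1 \<Longrightarrow> \<exists>c\<in>F. dist c x < 1"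
    using cone_sublevel_finite_net[OF assms(2) zero_less_one] by blast
  \<comment> \<open>The sum replaces the maximum of the norms of the centres and makes sense for
    empty \<open>F\<close> as well; 1 is the radius of the net.\<close>
  define C where "C = (\<Sum>c\<in>F. norm c) + 1"
  have C: "0 \<le> C" unfolding C_def by (simp add: sum_nonneg)
  have unit: "norm x \<le> C" if "x \<in> M" "s x \<le> 1" for x
  proof -
    obtain c where c: "c \<in> F" "dist c x < 1" using F(2)[OF \<open>x \<in> M\<close> \<open>s x \<le> 1\<close>] by blast
    have "norm x \<le> norm c + dist c x" using norm_triangle_ineq2[of x c] by (simp add: dist_norm norm_minus_commute)
    moreover have "norm c \<le> (\<Sum>c\<in>F. norm c)" using c(1) F(1) by (intro member_le_sum) auto
    ultimately show ?thesis using c(2) unfolding C_def by linarith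
  qed
  have "norm x \<le> C * s x" if x: "x \<in> M" for x
  proof (cases "s x = 0")
    case True
    then have "x = 0" using cone x unfolding seminormed_nonneg_cone_def by blast
    then show ?thesis using True by simp
  next
    case False
    have sx: "s x > 0" using False cone x unfolding seminormed_nonneg_cone_def by force
    then have "(1 / s x) *\<^sub>R x \<in> M" "s ((1 / s x) *\<^sub>R x) = (1 / s x) * s x"
      using cone x unfolding seminormed_nonneg_cone_def by simp_all
    then have "norm ((1 / s x) *\<^sub>R x) \<le> C" using sx by (intro unit) auto
    then show ?thesis using sx by (simp add: field_simps)
  qed
  with C show ?thesis by (rule that)
qed

section \<open>Tonelli near the diagonal\<close>

text \<open>
  Since \<open>'b\<close> need not be separable, \<open>f\<close> itself has no Borel version; Tonelli is applied to a Borel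
  version of the distance function instead.
\<close>

definition borel_dist_version ::
  "real set \<Rightarrow> (real \<Rightarrow> 'b::real_normed_vector) \<Rightarrow> (real \<Rightarrow> real \<Rightarrow> real) \<Rightarrow> real set \<Rightarrow> bool" where
  "borel_dist_version S f G N \<longleftrightarrow>
     (\<lambda>(x, y). G x y) \<in> borel_measurable (borel \<Otimes>\<^sub>M borel) \<and> N \<in> null_sets lborel \<and>
     (\<forall>x y. G x y = G y x) \<and> (\<forall>x\<in>S - N. \<forall>y\<in>S - N. G x y = norm (f x - f y))"

text \<open>Simple functions for the completed measure agree almost everywhere with Borel simple
  functions \<psi>, and countably many null sets are merged into one. Since each \<psi> has finite
  range, the distance \<open>norm (\<psi> n x - \<psi> n y)\<close> is jointly measurable whatever
  the size of the target space, and so is its limit.\<close>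

lemma ex_borel_dist_version:
  fixes f :: "real \<Rightarrow> 'b::real_normed_vector"
  assumes S: "S \<in> sets lebesgue" and f: "strongly_measurable (lebesgue_on S) f"
  obtains G N where "borel_dist_version S f G N"
proof -
  obtain \<phi> where \<phi>: "\<And>n::nat. simple_function (lebesgue_on S) (\<phi> n)"
      and lim: "AE x in lebesgue_on S. (\<lambda>n. \<phi> n x) \<longlonglongrightarrow> f x"
    using f unfolding strongly_measurable_def by blast
  have S_space: "S \<inter> space lebesgue \<in> sets lebesgue" using S by simp
  have "simple_function lebesgue (\<lambda>t. indicator S t *\<^sub>R \<phi> n t)" for n
    using \<phi>[of n] unfolding simple_function_restrict_space[OF S_space] .
  then have "\<forall>n. \<exists>\<psi>. simple_function lborel \<psi> \<and> (AE t in lborel. indicator S t *\<^sub>R \<phi> n t = \<psi> t)"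
    by (intro allI completion_ex_simple_function)
  then obtain \<psi> where \<psi>: "\<And>n. simple_function lborel (\<psi> n)"
      "\<And>n. AE t in lborel. indicator S t *\<^sub>R \<phi> n t = \<psi> n t"
    by (auto dest!: choice)
  have "AE t in lborel. t \<in> S \<longrightarrow> (\<lambda>n. \<psi> n t) \<longlonglongrightarrow> f t"
  proof -
    have "AE t in lborel. t \<in> S \<longrightarrow> (\<lambda>n. \<phi> n t) \<longlonglongrightarrow> f t"
      using lim by (subst (asm) AE_lebesgue_on_iff[OF S])
    moreover have "AE t in lborel. \<forall>n. indicator S t *\<^sub>R \<phi> n t = \<psi> n t"
      unfolding AE_all_countable using \<psi>(2) by blast
    ultimately show ?thesis
    proof eventually_elim
      case (elim t)
      show ?case
      proof
        assume "t \<in> S"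
        then have "(\<lambda>n. \<phi> n t) \<longlonglongrightarrow> f t" "\<And>n. \<psi> n t = \<phi> n t" using elim by (auto simp: eq_commute)
        then show "(\<lambda>n. \<psi> n t) \<longlonglongrightarrow> f t" by simp
      qed
    qed
  qed
  then obtain N where N: "N \<in> null_sets lborel" "\<And>t. t \<notin> N \<Longrightarrow> t \<in> S \<Longrightarrow> (\<lambda>n. \<psi> n t) \<longlonglongrightarrow> f t"
    by (elim AE_E3) auto
  \<comment> \<open>\<open>lim\<close> is applied to real sequences and is total, so
    \<open>G\<close> is Borel on the whole plane; it is symmetric everywhere because every
    approximant is.\<close>
  define G where "G x y = lim (\<lambda>n. norm (\<psi> n x - \<psi> n y))" for x y
  have "simple_function (lborel \<Otimes>\<^sub>M lborel) (\<lambda>z. norm (\<psi> n (fst z) - \<psi> n (snd z)))" for n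
    by (intro simple_function_compose1[where g = norm] simple_function_compose2[where h = "(-)"]
      simple_function_comp[OF measurable_fst \<psi>(1)] simple_function_comp[OF measurable_snd \<psi>(1)])
  then have [measurable]: "(\<lambda>z. norm (\<psi> n (fst z) - \<psi> n (snd z))) \<in> borel_measurable (lborel \<Otimes>\<^sub>M lborel)" for n
    by (rule borel_measurable_simple_function)
  have "(\<lambda>z. lim (\<lambda>n. norm (\<psi> n (fst z) - \<psi> n (snd z)))) \<in> borel_measurable (lborel \<Otimes>\<^sub>M lborel)"
    by measurable
  then have "(\<lambda>(x, y). G x y) \<in> borel_measurable (borel \<Otimes>\<^sub>M borel)"
    by (simp add: G_def case_prod_beta cong: measurable_cong_sets)
  moreover have "G x y = G y x" for x y unfolding G_def by (simp add: norm_minus_commute)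
  moreover have "G x y = norm (f x - f y)" if "x \<in> S - N" "y \<in> S - N" for x y
    unfolding G_def using that by (intro limI tendsto_norm tendsto_diff N(2)) auto
  ultimately show ?thesis using N(1) by (intro that[of G N]) (simp add: borel_dist_version_def)
qed

lemma borel_measurable_lebesgue_on_ex_borel:
  fixes f :: "real \<Rightarrow> real"
  assumes S: "S \<in> sets lebesgue" and f: "f \<in> borel_measurable (lebesgue_on S)"
  obtains g N where "g \<in> borel_measurable borel" "N \<in> null_sets lborel" "\<And>x. x \<in> S - N \<Longrightarrow> g x = f x"
proof -
  obtain g where g: "g \<in> borel_measurable lborel" "AE x in lborel. (if x \<in> S then f x else 0) = g x"
    using completion_ex_borel_measurable_real[OF borel_measurable_if_I[OF f S]] by blast
  from g(2) obtain N where N: "N \<in> null_sets lborel" "\<And>x. x \<notin> N \<Longrightarrow> (if x \<in> S then f x else 0) = g x"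
    by (elim AE_E3) auto
  have "g x = f x" if "x \<in> S - N" for x using N(2)[of x] that by simp
  moreover have "g \<in> borel_measurable borel" using g(1) by simp
  ultimately show ?thesis using N(1) by (intro that[of g N])
qed

lemma AE_lborel_shift:
  assumes "N \<in> null_sets lborel"
  shows "AE t in lborel. t + h \<notin> (N :: real set)"
proof -
  have [measurable]: "N \<in> sets borel" using assms by auto
  have "AE t in lborel. h + 1 * t \<notin> N"
    using assms by (intro AE_borel_affine AE_not_in) auto
  then show ?thesis by (simp add: add.commute)
qed

lemma borel_imp_lebesgue_on: "g \<in> borel_measurable borel \<Longrightarrow> g \<in> borel_measurable (lebesgue_on S)"
  by (intro measurable_restrict_space1 measurable_completion) simp

lemma Lp_norm_reparam_le:
  fixes g :: "real \<Rightarrow> real"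
  assumes p: "1 \<le> p" and g: "g \<in> borel_measurable borel" and S: "S \<in> sets borel" "R \<in> sets borel"
    and sub: "\<And>t. t \<in> R \<Longrightarrow> t + h \<in> S" and le: "Lp_norm p S g \<le> ennreal C" and C: "0 \<le> C"
  shows "Lp_norm p R (\<lambda>t. g (t + h)) \<le> ennreal C"
proof (cases "p = \<infinity>")
  note [measurable] = g S
  have gm: "(\<lambda>t. g (t + h)) \<in> borel_measurable borel" by measurable
  have SR: "S \<in> sets lebesgue" "R \<in> sets lebesgue" using S by auto
  {
    case True
    have "AE t in lborel. t \<in> S \<longrightarrow> \<bar>g t\<bar> \<le> C"
      using le unfolding Lp_norm_infinity_le_iff[OF True borel_imp_lebesgue_on[OF g] C] AE_lebesgue_on_iff[OF SR(1)] .
    then have "AE t in lborel. h + 1 * t \<in> S \<longrightarrow> \<bar>g (h + 1 * t)\<bar> \<le> C"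
      by (intro AE_borel_affine) auto
    then have "AE t in lborel. t \<in> R \<longrightarrow> \<bar>g (t + h)\<bar> \<le> C"
      by eventually_elim (use sub in \<open>simp add: add.commute\<close>)
    then show ?thesis
      unfolding Lp_norm_infinity_le_iff[OF True borel_imp_lebesgue_on[OF gm] C] AE_lebesgue_on_iff[OF SR(2)] .
  next
    case False
    let ?q = "enn2real p"
    have I: "(\<integral>\<^sup>+t. ennreal (\<bar>f t\<bar> powr ?q) \<partial>lebesgue_on Q) = (\<integral>\<^sup>+t. ennreal (\<bar>f t\<bar> powr ?q) * indicator Q t \<partial>lborel)"
      if "Q \<in> sets lebesgue" for f and Q :: "real set"
      using that by (simp add: nn_integral_restrict_space nn_integral_completion)
    have "(\<integral>\<^sup>+t. ennreal (\<bar>g (t + h)\<bar> powr ?q) * indicator R t \<partial>lborel)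
        \<le> (\<integral>\<^sup>+t. ennreal (\<bar>g (h + 1 * t)\<bar> powr ?q) * indicator S (h + 1 * t) \<partial>lborel)"
      using sub by (intro nn_integral_mono) (auto simp: indicator_def add.commute)
    also have "\<dots> = (\<integral>\<^sup>+t. ennreal (\<bar>g t\<bar> powr ?q) * indicator S t \<partial>lborel)"
      by (subst nn_integral_real_affine[where c = 1 and t = h]) auto
    also have "\<dots> \<le> ennreal (C powr ?q)"
      using le unfolding Lp_norm_le_iff[OF p False C] I[OF SR(1)] .
    finally show ?thesis unfolding Lp_norm_le_iff[OF p False C] I[OF SR(2)] .
  }
qed

text \<open>In the variables \<open>t\<close> and \<open>h = s - t\<close>, Tonelli turns the strip
  into slices of constant shift. A negative shift is a positive one by translation and symmetry, the
  slice \<open>h = 0\<close> is negligible, and \<open>2 * \<delta>\<close> is the length of the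
  range of \<open>h\<close>.\<close>

lemma near_diagonal_integral_le:
  fixes D :: "real \<Rightarrow> real \<Rightarrow> ennreal"
  assumes D[measurable]: "(\<lambda>(x, y). D x y) \<in> borel_measurable (borel \<Otimes>\<^sub>M borel)"
    and sym: "\<And>x y. D x y = D y x" and "0 < \<delta>"
    and le: "\<And>h. 0 < h \<Longrightarrow> h < \<delta> \<Longrightarrow> (\<integral>\<^sup>+t. D (t + h) t * indicator {0<..<T - h} t \<partial>lborel) \<le> a"
  shows "(\<integral>\<^sup>+t. \<integral>\<^sup>+s. D t s * indicator {0<..<T} t * indicator {0<..<T} s * indicator {-\<delta><..<\<delta>} (s - t) \<partial>lborel \<partial>lborel)
     \<le> ennreal (2 * \<delta>) * a"
proof -
  \<comment> \<open>With both indicators built in, a shift by \<open>h > 0\<close> restricts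
    \<open>t\<close> to \<open>{0<..<T - h}\<close> automatically.\<close>
  define E where "E t s = D t s * indicator {0<..<T} t * indicator {0<..<T} s" for t s
  have [measurable]: "(\<lambda>(x, y). E x y) \<in> borel_measurable (borel \<Otimes>\<^sub>M borel)"
    unfolding E_def by measurable
  have E_sym: "E t s = E s t" for t s
    unfolding E_def using sym[of t s] by (simp add: ac_simps)
  have pos: "(\<integral>\<^sup>+t. E (t + h) t \<partial>lborel) \<le> a" if "0 < h" "h < \<delta>" for h
  proof -
    have "E (t + h) t = D (t + h) t * indicator {0<..<T - h} t" for t
      unfolding E_def using \<open>0 < h\<close> by (auto simp: indicator_def)
    then show ?thesis using le[OF that] by simp
  qed
  have shift: "(\<integral>\<^sup>+t. E t (t + h) \<partial>lborel) \<le> a" if "\<bar>h\<bar> < \<delta>" "h \<noteq> 0" for h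
  proof (cases "h > 0")
    case True
    then show ?thesis using pos[of h] that E_sym by simp
  next
    case False
    have "(\<integral>\<^sup>+t. E t (t + h) \<partial>lborel) = (\<integral>\<^sup>+t. E (- h + 1 * t) (- h + 1 * t + h) \<partial>lborel)"
      by (subst nn_integral_real_affine[where c = 1 and t = "- h"]) simp_all
    also have "\<dots> = (\<integral>\<^sup>+t. E (t + - h) t \<partial>lborel)" by (simp add: add.commute)
    also have "\<dots> \<le> a" using False that by (intro pos) auto
    finally show ?thesis .
  qed
  have "(\<integral>\<^sup>+t. \<integral>\<^sup>+s. E t s * indicator {-\<delta><..<\<delta>} (s - t) \<partial>lborel \<partial>lborel)
      = (\<integral>\<^sup>+t. \<integral>\<^sup>+h. E t (t + h) * indicator {-\<delta><..<\<delta>} h \<partial>lborel \<partial>lborel)"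
  proof (rule nn_integral_cong)
    fix t :: real
    show "(\<integral>\<^sup>+s. E t s * indicator {-\<delta><..<\<delta>} (s - t) \<partial>lborel) = (\<integral>\<^sup>+h. E t (t + h) * indicator {-\<delta><..<\<delta>} h \<partial>lborel)"
      by (subst nn_integral_real_affine[where c = 1 and t = t]) simp_all
  qed
  also have "\<dots> = (\<integral>\<^sup>+h. \<integral>\<^sup>+t. E t (t + h) * indicator {-\<delta><..<\<delta>} h \<partial>lborel \<partial>lborel)"
    by (rule lborel_pair.Fubini'[symmetric]) measurable
  also have "\<dots> = (\<integral>\<^sup>+h. (\<integral>\<^sup>+t. E t (t + h) \<partial>lborel) * indicator {-\<delta><..<\<delta>} h \<partial>lborel)"
    by (intro nn_integral_cong nn_integral_multc) measurable
  also have "\<dots> \<le> (\<integral>\<^sup>+h. a * indicator {-\<delta><..<\<delta>} h \<partial>lborel)"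
  proof (rule nn_integral_mono_AE)
    have "AE h in lborel. h \<noteq> (0::real)" by (rule AE_lborel_singleton)
    then show "AE h in lborel. (\<integral>\<^sup>+t. E t (t + h) \<partial>lborel) * indicator {-\<delta><..<\<delta>} h \<le> a * indicator {-\<delta><..<\<delta>} h"
      by eventually_elim (use shift in \<open>auto simp: indicator_def\<close>)
  qed
  also have "\<dots> = ennreal (2 * \<delta>) * a"
    using \<open>0 < \<delta>\<close> by (simp add: nn_integral_cmult_indicator mult.commute)
  finally show ?thesis unfolding E_def .
qed

section \<open>Sampling on a random grid\<close>

lemma grid_floor_bounds:
  fixes m t :: real and N :: nat
  assumes "0 < m" "T = real N * m" "t \<in> {0<..<T}"
  shows "nat \<lfloor>t / m\<rfloor> < N" "real_of_int \<lfloor>t / m\<rfloor> = real (nat \<lfloor>t / m\<rfloor>)"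
    "m * real_of_int \<lfloor>t / m\<rfloor> \<le> t" "t < m * real_of_int \<lfloor>t / m\<rfloor> + m"
proof -
  have t: "0 < t / m" "t / m < real N" using assms by (auto simp: field_simps)
  then have "0 \<le> \<lfloor>t / m\<rfloor>" "\<lfloor>t / m\<rfloor> < int N" by (auto simp: floor_less_iff)
  then show "nat \<lfloor>t / m\<rfloor> < N" "real_of_int \<lfloor>t / m\<rfloor> = real (nat \<lfloor>t / m\<rfloor>)" by linarith+
  have "real_of_int \<lfloor>t / m\<rfloor> \<le> t / m" "t / m < real_of_int \<lfloor>t / m\<rfloor> + 1" by linarith+
  then have "m * real_of_int \<lfloor>t / m\<rfloor> \<le> m * (t / m)" "m * (t / m) < m * (real_of_int \<lfloor>t / m\<rfloor> + 1)"
    using assms(1) by (intro mult_left_mono mult_strict_left_mono; simp)+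
  then show "m * real_of_int \<lfloor>t / m\<rfloor> \<le> t" "t < m * real_of_int \<lfloor>t / m\<rfloor> + m"
    using assms(1) by (simp_all add: distrib_left)
qed

lemma grid_point_bounds:
  fixes m \<tau> :: real
  assumes "0 < \<tau>" "\<tau> < m" "k < N"
  shows "m * real k + \<tau> \<in> {0<..<real N * m}"
proof -
  have "m * real k + m \<le> real N * m"
  proof -
    have "m * (real k + 1) \<le> m * real N" using assms by (intro mult_left_mono) auto
    then show ?thesis by (simp add: algebra_simps)
  qed
  moreover have "0 \<le> m * real k" using assms by simp
  ultimately have "0 < m * real k + \<tau>" "m * real k + \<tau> < real N * m" using assms by linarith+
  then show ?thesis by simp
qed

text \<open>A time \<open>t\<close> and its sampling point lie in the same cell and thus differ by
  less than \<open>m\<close>. For fixed \<open>t\<close> the sampling point \<open>s\<close> is a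
  translate of \<tau>, so the integral over \<tau> is one over part of the strip
  \<open>\<bar>s - t\<bar> < m\<close>.\<close>

lemma sampling_integral_le:
  fixes D :: "real \<Rightarrow> real \<Rightarrow> ennreal"
  assumes D[measurable]: "(\<lambda>(x, y). D x y) \<in> borel_measurable (borel \<Otimes>\<^sub>M borel)"
    and sym: "\<And>x y. D x y = D y x" and m: "0 < m" "T = real N * m"
    and le: "\<And>h. 0 < h \<Longrightarrow> h < m \<Longrightarrow> (\<integral>\<^sup>+t. D (t + h) t * indicator {0<..<T - h} t \<partial>lborel) \<le> a"
  shows "(\<integral>\<^sup>+\<tau>. (\<integral>\<^sup>+t. D t (m * real_of_int \<lfloor>t / m\<rfloor> + \<tau>) * indicator {0<..<T} t \<partial>lborel) * indicator {0<..<m} \<tau> \<partial>lborel)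
    \<le> ennreal (2 * m) * a"
proof -
  have "(\<integral>\<^sup>+\<tau>. (\<integral>\<^sup>+t. D t (m * real_of_int \<lfloor>t / m\<rfloor> + \<tau>) * indicator {0<..<T} t \<partial>lborel) * indicator {0<..<m} \<tau> \<partial>lborel)
     = (\<integral>\<^sup>+\<tau>. \<integral>\<^sup>+t. D t (m * real_of_int \<lfloor>t / m\<rfloor> + \<tau>) * indicator {0<..<T} t * indicator {0<..<m} \<tau> \<partial>lborel \<partial>lborel)"
    by (intro nn_integral_cong nn_integral_multc[symmetric]) measurable
  also have "\<dots> = (\<integral>\<^sup>+t. \<integral>\<^sup>+\<tau>. D t (m * real_of_int \<lfloor>t / m\<rfloor> + \<tau>) * indicator {0<..<T} t * indicator {0<..<m} \<tau> \<partial>lborel \<partial>lborel)"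
    by (rule lborel_pair.Fubini') measurable
  also have "\<dots> \<le> (\<integral>\<^sup>+t. \<integral>\<^sup>+s. D t s * indicator {0<..<T} t * indicator {0<..<T} s * indicator {-m<..<m} (s - t) \<partial>lborel \<partial>lborel)"
  proof (rule nn_integral_mono)
    fix t :: real
    define b where "b = m * real_of_int \<lfloor>t / m\<rfloor>"
    have "(\<integral>\<^sup>+\<tau>. D t (b + \<tau>) * indicator {0<..<T} t * indicator {0<..<m} \<tau> \<partial>lborel)
       = (\<integral>\<^sup>+s. D t s * indicator {0<..<T} t * indicator {0<..<m} (s - b) \<partial>lborel)"
      by (subst nn_integral_real_affine[where c = 1 and t = b and f = "\<lambda>s. D t s * indicator {0<..<T} t * indicator {0<..<m} (s - b)"])
        simp_all
    also have "\<dots> \<le> (\<integral>\<^sup>+s. D t s * indicator {0<..<T} t * indicator {0<..<T} s * indicator {-m<..<m} (s - t) \<partial>lborel)"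
    proof (rule nn_integral_mono)
      fix s :: real
      show "D t s * indicator {0<..<T} t * indicator {0<..<m} (s - b)
        \<le> D t s * indicator {0<..<T} t * indicator {0<..<T} s * indicator {-m<..<m} (s - t)"
      proof (cases "t \<in> {0<..<T} \<and> s - b \<in> {0<..<m}")
        case True
        then have t: "t \<in> {0<..<T}" and s: "0 < s - b" "s - b < m" by auto
        note fl = grid_floor_bounds[OF m t]
        have b: "b = m * real (nat \<lfloor>t / m\<rfloor>)" unfolding b_def fl(2)[symmetric] ..
        have "m * real (nat \<lfloor>t / m\<rfloor>) + (s - b) \<in> {0<..<real N * m}"
          using grid_point_bounds[OF s fl(1)] .
        then have "s \<in> {0<..<T}" unfolding b[symmetric] m(2) by simp
        moreover have "s - t \<in> {-m<..<m}" using fl(3,4) s unfolding b_def[symmetric] by auto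
        ultimately show ?thesis by (simp add: indicator_def)
      next
        case False
        then show ?thesis by (auto simp: indicator_def)
      qed
    qed
    finally show "(\<integral>\<^sup>+\<tau>. D t (m * real_of_int \<lfloor>t / m\<rfloor> + \<tau>) * indicator {0<..<T} t * indicator {0<..<m} \<tau> \<partial>lborel)
      \<le> (\<integral>\<^sup>+s. D t s * indicator {0<..<T} t * indicator {0<..<T} s * indicator {-m<..<m} (s - t) \<partial>lborel)"
      unfolding b_def .
  qed
  also have "\<dots> \<le> ennreal (2 * m) * a"
    by (rule near_diagonal_integral_le[OF D sym m(1) le])
  finally show ?thesis .
qed

text \<open>Counting bad offsets in \<open>{0<..<m}\<close>: the sampling error \<open>A\<close> has
  integral at most \<open>2 * m * a\<close>, so it exceeds \<open>6 * a\<close> on measure at most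
  \<open>m / 3\<close>. The sum \<open>B\<close> of sampled values has integral at most
  \<open>N * c\<close>, so it exceeds \<open>3 * N * c / m\<close> on measure at most
  \<open>m / 3\<close>. Offsets that meet \<open>Z\<close> are negligible, and measure at least
  \<open>m / 3\<close> remains.\<close>

lemma ex_sampling_point:
  fixes D :: "real \<Rightarrow> real \<Rightarrow> ennreal" and g :: "real \<Rightarrow> ennreal"
  assumes D[measurable]: "(\<lambda>(x, y). D x y) \<in> borel_measurable (borel \<Otimes>\<^sub>M borel)"
    and sym: "\<And>x y. D x y = D y x" and m: "0 < m" "T = real N * m"
    and le: "\<And>h. 0 < h \<Longrightarrow> h < m \<Longrightarrow> (\<integral>\<^sup>+t. D (t + h) t * indicator {0<..<T - h} t \<partial>lborel) \<le> ennreal a"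
    and a: "0 < a"
    and g[measurable]: "g \<in> borel_measurable borel" and gc: "(\<integral>\<^sup>+t. g t * indicator {0<..<T} t \<partial>lborel) \<le> ennreal c"
    and c: "0 < c" and Z: "Z \<in> null_sets lborel"
  obtains \<tau> where "0 < \<tau>" "\<tau> < m" "\<And>k. k < N \<Longrightarrow> m * real k + \<tau> \<notin> Z"
    "(\<integral>\<^sup>+t. D t (m * real_of_int \<lfloor>t / m\<rfloor> + \<tau>) * indicator {0<..<T} t \<partial>lborel) \<le> ennreal (6 * a)"
    "\<And>k. k < N \<Longrightarrow> g (m * real k + \<tau>) \<le> ennreal (3 * real N * c / m)"
proof (rule ccontr)
  assume contr: "\<not> thesis"
  define A where "A \<tau> = (\<integral>\<^sup>+t. D t (m * real_of_int \<lfloor>t / m\<rfloor> + \<tau>) * indicator {0<..<T} t \<partial>lborel)" for \<tau>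
  define B where "B \<tau> = (\<Sum>k<N. g (m * real k + \<tau>))" for \<tau>
  have [measurable]: "A \<in> borel_measurable borel" "B \<in> borel_measurable borel"
    unfolding A_def B_def by measurable
  \<comment> \<open>The reciprocal of the threshold for \<open>B\<close>. Division by zero makes it
    0 for \<open>N = 0\<close>, when \<open>{0<..<T}\<close> is empty; this case is settled
    separately.\<close>
  define d where "d = m / (3 * real N * c)"
  show False
  proof (cases "N = 0")
    case True
    have "(\<integral>\<^sup>+t. D t (m * real_of_int \<lfloor>t / m\<rfloor> + m / 2) * indicator {0<..<T} t \<partial>lborel) = 0"
      using True m by simp
    then show False using that[of "m / 2"] contr True m by simp
  next
    case False
    have d: "0 < d" "d * (3 * real N * c / m) = 1" "d * (real N * c) = m / 3"
      using m c False by (auto simp: d_def field_simps)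
    have "AE \<tau> in lborel. \<forall>k<N. \<tau> + m * real k \<notin> Z"
      unfolding AE_all_countable by (auto intro!: AE_impI AE_lborel_shift[OF Z])
    \<comment> \<open>With no admissible offset, almost every \<tau> violates one of the two bounds,
      so one of the two functions divided by its threshold is at least 1. Integration yields
      \<open>m \<le> 2 * m / 3\<close>.\<close>
    then have "AE \<tau> in lborel. indicator {0<..<m} \<tau> \<le>
        ennreal (1 / (6 * a)) * (A \<tau> * indicator {0<..<m} \<tau>) + ennreal d * (B \<tau> * indicator {0<..<m} \<tau>)"
    proof eventually_elim
      case (elim \<tau>)
      show ?case
      proof (cases "0 < \<tau> \<and> \<tau> < m")
        case True
        have "A \<tau> > ennreal (6 * a) \<or> (\<exists>k<N. g (m * real k + \<tau>) > ennreal (3 * real N * c / m))"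
        proof (rule ccontr)
          assume "\<not> ?thesis"
          then have *: "\<not> A \<tau> > ennreal (6 * a)"
              "\<And>k. k < N \<Longrightarrow> \<not> g (m * real k + \<tau>) > ennreal (3 * real N * c / m)"
            by blast+
          have "m * real k + \<tau> \<notin> Z" if "k < N" for k using elim that by (simp add: add.commute)
          with True *[unfolded not_less] have thesis unfolding A_def by (intro that[of \<tau>]) auto
          with contr show False by contradiction
        qed
        then have "1 \<le> ennreal (1 / (6 * a)) * A \<tau> + ennreal d * B \<tau>"
        proof
          assume A: "A \<tau> > ennreal (6 * a)"
          have "1 = ennreal (1 / (6 * a)) * ennreal (6 * a)" using a by (simp flip: ennreal_mult)
          also have "\<dots> \<le> ennreal (1 / (6 * a)) * A \<tau>" using less_imp_le[OF A] by (intro mult_left_mono) auto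
          also have "\<dots> \<le> ennreal (1 / (6 * a)) * A \<tau> + ennreal d * B \<tau>" by simp
          finally show ?thesis .
        next
          assume "\<exists>k<N. g (m * real k + \<tau>) > ennreal (3 * real N * c / m)"
          then obtain k where k: "k < N" "g (m * real k + \<tau>) > ennreal (3 * real N * c / m)" by blast
          have "ennreal d * ennreal (3 * real N * c / m) = ennreal (d * (3 * real N * c / m))"
            using d(1) c m(1) by (intro ennreal_mult[symmetric]) auto
          then have "1 = ennreal d * ennreal (3 * real N * c / m)" unfolding d(2) by simp
          also have "\<dots> \<le> ennreal d * g (m * real k + \<tau>)" using less_imp_le[OF k(2)] by (intro mult_left_mono) auto
          also have "g (m * real k + \<tau>) \<le> B \<tau>"
            unfolding B_def using k(1) by (intro member_le_sum) auto
          also have "ennreal d * B \<tau> \<le> ennreal (1 / (6 * a)) * A \<tau> + ennreal d * B \<tau>" by simp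
          finally show ?thesis by (simp add: mult_left_mono)
        qed
        then show ?thesis using True by simp
      qed (auto simp: indicator_def)
    qed
    then have "(\<integral>\<^sup>+\<tau>. indicator {0<..<m} \<tau> \<partial>lborel) \<le>
       (\<integral>\<^sup>+\<tau>. ennreal (1 / (6 * a)) * (A \<tau> * indicator {0<..<m} \<tau>) + ennreal d * (B \<tau> * indicator {0<..<m} \<tau>) \<partial>lborel)"
      by (rule nn_integral_mono_AE)
    also have "\<dots> = ennreal (1 / (6 * a)) * (\<integral>\<^sup>+\<tau>. A \<tau> * indicator {0<..<m} \<tau> \<partial>lborel)
        + ennreal d * (\<integral>\<^sup>+\<tau>. B \<tau> * indicator {0<..<m} \<tau> \<partial>lborel)"
      by (simp add: nn_integral_add nn_integral_cmult)
    also have "\<dots> \<le> ennreal (1 / (6 * a)) * ennreal (2 * m * a) + ennreal d * ennreal (real N * c)"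
    proof (intro add_mono mult_left_mono)
      show "(\<integral>\<^sup>+\<tau>. A \<tau> * indicator {0<..<m} \<tau> \<partial>lborel) \<le> ennreal (2 * m * a)"
        using sampling_integral_le[OF D sym m le] a m(1) unfolding A_def by (simp add: ennreal_mult)
      have "(\<integral>\<^sup>+\<tau>. B \<tau> * indicator {0<..<m} \<tau> \<partial>lborel)
          = (\<Sum>k<N. \<integral>\<^sup>+\<tau>. g (m * real k + \<tau>) * indicator {0<..<m} \<tau> \<partial>lborel)"
        unfolding B_def sum_distrib_right by (intro nn_integral_sum) measurable
      \<comment> \<open>Each cell is estimated by the integral over the whole interval; the factor
        \<open>N\<close> is harmless because the threshold may depend on the grid.\<close>
      also have "\<dots> \<le> (\<Sum>k<N. ennreal c)"
      proof (rule sum_mono)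
        fix k assume "k \<in> {..<N}"
        then have k: "k < N" by simp
        have "(\<integral>\<^sup>+\<tau>. g (m * real k + \<tau>) * indicator {0<..<m} \<tau> \<partial>lborel)
          \<le> (\<integral>\<^sup>+\<tau>. g (m * real k + 1 * \<tau>) * indicator {0<..<T} (m * real k + 1 * \<tau>) \<partial>lborel)"
          using grid_point_bounds[OF _ _ k, of _ m] unfolding m(2)
          by (intro nn_integral_mono) (auto simp: indicator_def)
        also have "\<dots> = (\<integral>\<^sup>+t. g t * indicator {0<..<T} t \<partial>lborel)"
          by (subst nn_integral_real_affine[where c = 1 and t = "m * real k"]) simp_all
        finally show "(\<integral>\<^sup>+\<tau>. g (m * real k + \<tau>) * indicator {0<..<m} \<tau> \<partial>lborel) \<le> ennreal c"
          using gc by (rule order_trans)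
      qed
      also have "\<dots> = ennreal (real N * c)" using c by (simp add: ennreal_mult ennreal_of_nat_eq_real_of_nat)
      finally show "(\<integral>\<^sup>+\<tau>. B \<tau> * indicator {0<..<m} \<tau> \<partial>lborel) \<le> ennreal (real N * c)" .
    qed auto
    also have "\<dots> = ennreal (1 / (6 * a) * (2 * m * a) + d * (real N * c))"
      using a m(1) c d(1) by (simp flip: ennreal_mult ennreal_plus)
    also have "1 / (6 * a) * (2 * m * a) + d * (real N * c) = 2 * m / 3"
      unfolding d(3) using a by (simp add: field_simps)
    finally have "ennreal m \<le> ennreal (2 * m / 3)" using m(1) by simp
    then show False using m(1) by simp
  qed
qed

lemma nn_integral_lebesgue_on:
  "S \<in> sets lebesgue \<Longrightarrow> (\<integral>\<^sup>+t. f t \<partial>lebesgue_on S) = (\<integral>\<^sup>+t. f t * indicator S t \<partial>lborel)"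
  by (simp add: nn_integral_restrict_space nn_integral_completion)

text \<open>Sampling is applied to the \<open>q\<close>-th powers, whose integrals the
  \<open>L^p\<close> norms control. Almost every \<open>t\<close> and all grid points avoid
  \<open>Z\<close>, so there \<open>G\<close> is the true distance. The bound on sampled values
  depends on \<open>N\<close>, \<open>m\<close> and \<open>C\<close> but not on \<open>u\<close>,
  which is what allows a common net of centres.\<close>

lemma ex_step_approximation:
  fixes u :: "real \<Rightarrow> 'b::real_normed_vector" and g :: "real \<Rightarrow> real"
  assumes p: "1 \<le> p" "p \<noteq> \<infinity>" and G: "borel_dist_version {0<..<T} u G Z" and m: "0 < m" "T = real N * m"
    and shift: "\<And>h. 0 < h \<Longrightarrow> h < m \<Longrightarrow> Lp_norm p {0<..<T - h} (\<lambda>t. G (t + h) t) \<le> ennreal \<eta>"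
    and \<eta>: "0 < \<eta>"
    and g: "g \<in> borel_measurable borel" and gC: "Lp_norm p {0<..<T} g \<le> ennreal C" and C: "0 < C"
    and q: "q = enn2real p"
  obtains \<tau> where "\<And>k. k < N \<Longrightarrow> m * real k + \<tau> \<in> {0<..<T} - Z"
    "\<And>k. k < N \<Longrightarrow> \<bar>g (m * real k + \<tau>)\<bar> \<le> (3 * real N * C powr q / m) powr (1 / q)"
    "Lp_norm p {0<..<T} (\<lambda>t. norm (u t - u (m * real (nat \<lfloor>t / m\<rfloor>) + \<tau>))) \<le> ennreal (6 * \<eta>)"
proof -
  note q1 = enn2real_ge_1[OF p, folded q]
  have le_iff: "Lp_norm p {0<..<x} f \<le> ennreal b \<longleftrightarrow>
      (\<integral>\<^sup>+t. ennreal (\<bar>f t\<bar> powr q) * indicator {0<..<x} t \<partial>lborel) \<le> ennreal (b powr q)"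
    if "0 \<le> b" for f x b
    unfolding Lp_norm_le_iff[OF p that, folded q] by (subst nn_integral_lebesgue_on) simp_all
  have [measurable]: "(\<lambda>(x, y). G x y) \<in> borel_measurable (borel \<Otimes>\<^sub>M borel)"
    and Z: "Z \<in> null_sets lborel" and G_sym: "\<And>x y. G x y = G y x"
    and G_eq: "\<And>x y. x \<in> {0<..<T} - Z \<Longrightarrow> y \<in> {0<..<T} - Z \<Longrightarrow> G x y = norm (u x - u y)"
    using G unfolding borel_dist_version_def by auto
  note [measurable] = g
  define D where "D x y = ennreal (\<bar>G x y\<bar> powr q)" for x y
  have D: "(\<lambda>(x, y). D x y) \<in> borel_measurable (borel \<Otimes>\<^sub>M borel)" unfolding D_def by measurable
  obtain \<tau> where \<tau>: "0 < \<tau>" "\<tau> < m" "\<And>k. k < N \<Longrightarrow> m * real k + \<tau> \<notin> Z"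
    "(\<integral>\<^sup>+t. D t (m * real_of_int \<lfloor>t / m\<rfloor> + \<tau>) * indicator {0<..<T} t \<partial>lborel) \<le> ennreal (6 * \<eta> powr q)"
    "\<And>k. k < N \<Longrightarrow> ennreal (\<bar>g (m * real k + \<tau>)\<bar> powr q) \<le> ennreal (3 * real N * C powr q / m)"
  proof (rule ex_sampling_point[where D = D and g = "\<lambda>t. ennreal (\<bar>g t\<bar> powr q)", OF D _ m])
    show "D x y = D y x" for x y unfolding D_def G_sym[of x y] ..
    show "(\<integral>\<^sup>+t. D (t + h) t * indicator {0<..<T - h} t \<partial>lborel) \<le> ennreal (\<eta> powr q)" if "0 < h" "h < m" for h
      using shift[OF that] \<eta> le_iff[of \<eta>] unfolding D_def by simp
    show "(\<integral>\<^sup>+t. ennreal (\<bar>g t\<bar> powr q) * indicator {0<..<T} t \<partial>lborel) \<le> ennreal (C powr q)"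
      using gC C le_iff[of C] by simp
    show "(\<lambda>t. ennreal (\<bar>g t\<bar> powr q)) \<in> borel_measurable borel" by measurable
  qed (use \<eta> C Z in auto)
  have grid: "m * real k + \<tau> \<in> {0<..<T} - Z" if "k < N" for k
    using grid_point_bounds[OF \<tau>(1,2) that] \<tau>(3)[OF that] m(2) by simp
  have "\<bar>g (m * real k + \<tau>)\<bar> \<le> (3 * real N * C powr q / m) powr (1 / q)" if "k < N" for k
  proof -
    have "\<bar>g (m * real k + \<tau>)\<bar> powr q \<le> 3 * real N * C powr q / m"
      using \<tau>(5)[OF that] m(1) by (simp add: ennreal_le_iff)
    then have "(\<bar>g (m * real k + \<tau>)\<bar> powr q) powr (1 / q) \<le> (3 * real N * C powr q / m) powr (1 / q)"
      using q1 by (intro powr_mono2) auto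
    then show ?thesis using q1 by (simp add: powr_powr)
  qed
  moreover have "Lp_norm p {0<..<T} (\<lambda>t. norm (u t - u (m * real (nat \<lfloor>t / m\<rfloor>) + \<tau>))) \<le> ennreal (6 * \<eta>)"
  proof -
    have "(\<integral>\<^sup>+t. ennreal (\<bar>norm (u t - u (m * real (nat \<lfloor>t / m\<rfloor>) + \<tau>))\<bar> powr q) * indicator {0<..<T} t \<partial>lborel)
       = (\<integral>\<^sup>+t. D t (m * real_of_int \<lfloor>t / m\<rfloor> + \<tau>) * indicator {0<..<T} t \<partial>lborel)"
    proof (rule nn_integral_cong_AE)
      have "AE t in lborel. t \<notin> Z" using Z by (rule AE_not_in)
      then show "AE t in lborel. ennreal (\<bar>norm (u t - u (m * real (nat \<lfloor>t / m\<rfloor>) + \<tau>))\<bar> powr q) * indicator {0<..<T} t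
         = D t (m * real_of_int \<lfloor>t / m\<rfloor> + \<tau>) * indicator {0<..<T} t"
      proof eventually_elim
        case (elim t)
        show ?case
        proof (cases "t \<in> {0<..<T}")
          case True
          note fl = grid_floor_bounds[OF m True]
          have "G t (m * real (nat \<lfloor>t / m\<rfloor>) + \<tau>) = norm (u t - u (m * real (nat \<lfloor>t / m\<rfloor>) + \<tau>))"
            using True elim grid[OF fl(1)] by (intro G_eq) auto
          then show ?thesis unfolding D_def fl(2) by simp
        qed simp
      qed
    qed
    also have "\<dots> \<le> ennreal (6 * \<eta> powr q)" by (rule \<tau>(4))
    \<comment> \<open>As \<open>q \<ge> 1\<close>, the factor 6 may be replaced by its
      \<open>q\<close>-th power, which gives a bound uniform in the exponent.\<close>
    also have "\<dots> \<le> ennreal ((6 * \<eta>) powr q)"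
    proof (rule ennreal_leI)
      have "(6::real) powr 1 \<le> 6 powr q" using q1 by (intro powr_mono) auto
      then have "6 * \<eta> powr q \<le> 6 powr q * \<eta> powr q" by (intro mult_right_mono) auto
      then show "6 * \<eta> powr q \<le> (6 * \<eta>) powr q" by (simp add: powr_mult)
    qed
    finally show ?thesis using \<eta> le_iff[of "6 * \<eta>"] by simp
  qed
  ultimately show ?thesis using grid by (intro that[of \<tau>])
qed

section \<open>Uniform shifts and nets for finite exponents\<close>

lemma borel_dist_version_mono:
  "borel_dist_version S f G N \<Longrightarrow> N \<subseteq> N' \<Longrightarrow> N' \<in> null_sets lborel \<Longrightarrow> borel_dist_version S f G N'"
  unfolding borel_dist_version_def by blast

lemma ex_grid:
  fixes T \<delta> :: real
  assumes "0 < T" "0 < \<delta>"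
  obtains N m where "0 < m" "T = real N * m" "m < \<delta>"
proof -
  obtain N :: nat where N: "T / \<delta> < real N" using reals_Archimedean2 by blast
  moreover have "0 < T / \<delta>" using assms by simp
  ultimately have "0 < real N" by linarith
  then show ?thesis using assms N by (intro that[of "T / real N" N]) (auto simp: field_simps)
qed

text \<open>The function factors through the cell index, a natural number below \<open>N\<close>;
  hence \<open>f\<close> itself may be arbitrary.\<close>

lemma simple_function_grid:
  fixes m T :: real
  assumes "0 < m" "T = real N * m"
  shows "simple_function (lebesgue_on {0<..<T}) (\<lambda>t. f (m * real (nat \<lfloor>t / m\<rfloor>) + \<tau>))"
  unfolding simple_function_eq_measurable
proof
  have "(\<lambda>t. f (m * real (nat \<lfloor>t / m\<rfloor>) + \<tau>)) ` space (lebesgue_on {0<..<T})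
      \<subseteq> (\<lambda>k. f (m * real k + \<tau>)) ` {..<N}"
    using grid_floor_bounds(1)[OF assms] by auto
  then show "finite ((\<lambda>t. f (m * real (nat \<lfloor>t / m\<rfloor>) + \<tau>)) ` space (lebesgue_on {0<..<T}))"
    by (rule finite_subset) simp
  have "(\<lambda>t::real. nat \<lfloor>t / m\<rfloor>) \<in> measurable borel (count_space UNIV)" by measurable
  then have "(\<lambda>t. f (m * real (nat \<lfloor>t / m\<rfloor>) + \<tau>)) \<in> measurable borel (count_space UNIV)"
    by (rule measurable_compose) simp
  then show "(\<lambda>t. f (m * real (nat \<lfloor>t / m\<rfloor>) + \<tau>)) \<in> measurable (lebesgue_on {0<..<T}) (count_space UNIV)"
    by (intro measurable_restrict_space1 measurable_completion) simp
qed

section \<open>The setting shared by all exponents\<close>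

locale Aubin_Lions_cone =
  fixes T :: real and p :: ennreal
    and iB :: "'b::banach \<Rightarrow> 'v::real_vector" and iY :: "'y::banach \<Rightarrow> 'v"
    and M :: "'b set" and s :: "'b \<Rightarrow> real" and U :: "(real \<Rightarrow> 'b) set"
  assumes T: "T > 0" and p: "1 \<le> p"
    and linear: "linear iB" "linear iY" "inj iY"
    and cone: "seminormed_nonneg_cone M s"
    and compact_embedding: "cone_compactly_embedded M s"
    and compatible: "\<And>(w :: nat \<Rightarrow> 'b) w0.
           w \<longlonglongrightarrow> w0 \<Longrightarrow> (\<And>n. lies_in_Y iB iY (w n)) \<Longrightarrow>
           (\<lambda>n. as_Y iB iY (w n)) \<longlonglongrightarrow> 0 \<Longrightarrow> w0 = 0"
    and subset: "U \<subseteq> Lp_cone p {0<..<T} M s \<inter> Lp_in_Y iB iY p {0<..<T}"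
    and bounded: "\<exists>C::real. \<forall>u\<in>U. Lp_norm p {0<..<T} (\<lambda>t. s (u t)) \<le> ennreal C"
    and shifts: "\<And>\<epsilon>::real. \<epsilon> > 0 \<Longrightarrow>
           \<forall>\<^sub>F h in at_right 0. \<forall>u\<in>U.
             Lp_norm p {0<..<T - h} (\<lambda>t. norm (as_Y iB iY (u (t + h)) - as_Y iB iY (u t)))
               \<le> ennreal \<epsilon>"
begin

lemma interval_lebesgue: "{0<..<x} \<in> sets lebesgue" for x :: real
  by simp

lemma Ehrling:
  assumes "\<epsilon> > 0"
  obtains C where "0 \<le> C" "\<And>u v. u \<in> M \<Longrightarrow> v \<in> M \<Longrightarrow> lies_in_Y iB iY u \<Longrightarrow> lies_in_Y iB iY v \<Longrightarrow>
      norm (u - v) \<le> \<epsilon> * (s u + s v) + C * norm (as_Y iB iY u - as_Y iB iY v)"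
proof (rule Ehrling_inequality[OF linear cone compact_embedding _ assms])
  show "w0 = 0" if "w \<longlonglongrightarrow> w0" "\<And>n. lies_in_Y iB iY (w n)" "(\<lambda>n. as_Y iB iY (w n)) \<longlonglongrightarrow> 0" for w w0
    using that by (rule compatible)
qed (rule that)

lemma seminorm_bound:
  obtains C where "0 < C" "\<And>u. u \<in> U \<Longrightarrow> Lp_norm p {0<..<T} (\<lambda>t. s (u t)) \<le> ennreal C"
proof -
  obtain C where C: "\<And>u. u \<in> U \<Longrightarrow> Lp_norm p {0<..<T} (\<lambda>t. s (u t)) \<le> ennreal C"
    using bounded by blast
  have "Lp_norm p {0<..<T} (\<lambda>t. s (u t)) \<le> ennreal (max C 1)" if "u \<in> U" for u
    using C[OF that] ennreal_leI[of C "max C 1"] by (meson max.cobounded1 order_trans)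
  then show ?thesis by (intro that[of "max C 1"]) auto
qed

lemma U_strongly_measurable:
  assumes "u \<in> U"
  shows "strongly_measurable (lebesgue_on {0<..<T}) u"
    "strongly_measurable (lebesgue_on {0<..<T}) (\<lambda>t. as_Y iB iY (u t))"
  using assms subset by (auto simp: Lp_cone_def Lp_in_Y_def Lp_space_def)

text \<open>A single null set collects the exceptional times of the seminorm, of membership in
  \<open>M\<close> and \<open>Y\<close>, and of the \<open>Y\<close> distance, so that the Ehrling
  inequality can be used at individual times off \<open>Z\<close>.\<close>

lemma ex_borel_data:
  assumes "u \<in> U"
  obtains g H Z where "g \<in> borel_measurable borel" "Z \<in> null_sets lborel"
    "borel_dist_version {0<..<T} (\<lambda>t. as_Y iB iY (u t)) H Z"
    "\<And>t. t \<in> {0<..<T} - Z \<Longrightarrow> u t \<in> M \<and> lies_in_Y iB iY (u t) \<and> g t = s (u t)"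
proof -
  have u: "AE t in lebesgue_on {0<..<T}. u t \<in> M" "(\<lambda>t. s (u t)) \<in> borel_measurable (lebesgue_on {0<..<T})"
      "AE t in lebesgue_on {0<..<T}. lies_in_Y iB iY (u t)"
    using assms subset by (auto simp: Lp_cone_def Lp_in_Y_def)
  obtain g Z1 where g: "g \<in> borel_measurable borel" "Z1 \<in> null_sets lborel"
      "\<And>t. t \<in> {0<..<T} - Z1 \<Longrightarrow> g t = s (u t)"
    using borel_measurable_lebesgue_on_ex_borel[OF interval_lebesgue u(2)] by blast
  obtain H Z2 where H: "borel_dist_version {0<..<T} (\<lambda>t. as_Y iB iY (u t)) H Z2"
    using ex_borel_dist_version[OF interval_lebesgue U_strongly_measurable(2)[OF assms]] by blast
  have "AE t in lebesgue_on {0<..<T}. u t \<in> M \<and> lies_in_Y iB iY (u t)"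
    using u(1,3) by eventually_elim blast
  then have "AE t in lborel. t \<in> {0<..<T} \<longrightarrow> u t \<in> M \<and> lies_in_Y iB iY (u t)"
    unfolding AE_lebesgue_on_iff[OF interval_lebesgue] .
  then obtain Z3 where Z3: "Z3 \<in> null_sets lborel"
      "\<And>t. t \<notin> Z3 \<Longrightarrow> t \<in> {0<..<T} \<Longrightarrow> u t \<in> M \<and> lies_in_Y iB iY (u t)"
    by (elim AE_E3) auto
  have "Z2 \<in> null_sets lborel" using H unfolding borel_dist_version_def by blast
  then have Z: "Z1 \<union> Z2 \<union> Z3 \<in> null_sets lborel" using g(2) Z3(1) by (intro null_sets.Un)
  show ?thesis
  proof (rule that[OF g(1) Z])
    show "borel_dist_version {0<..<T} (\<lambda>t. as_Y iB iY (u t)) H (Z1 \<union> Z2 \<union> Z3)"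
      by (rule borel_dist_version_mono[OF H _ Z]) blast
    show "u t \<in> M \<and> lies_in_Y iB iY (u t) \<and> g t = s (u t)" if "t \<in> {0<..<T} - (Z1 \<union> Z2 \<union> Z3)" for t
      using g(3) Z3(2) that by simp
  qed
qed

lemma borel_version_Lp_norm_le:
  assumes "u \<in> U" "g \<in> borel_measurable borel" "Z \<in> null_sets lborel"
    "\<And>t. t \<in> {0<..<T} - Z \<Longrightarrow> g t = s (u t)" "Lp_norm p {0<..<T} (\<lambda>t. s (u t)) \<le> ennreal C"
  shows "Lp_norm p {0<..<T} g \<le> ennreal C"
proof -
  have "AE t in lebesgue_on {0<..<T}. \<bar>g t\<bar> \<le> \<bar>s (u t)\<bar>"
    unfolding AE_lebesgue_on_iff[OF interval_lebesgue]
    using AE_not_in[OF assms(3)] by eventually_elim (use assms(4) in auto)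
  from Lp_norm_mono_AE[OF p borel_imp_lebesgue_on[OF assms(2)] this] show ?thesis
    using assms(5) by (rule order_trans)
qed

lemma U_subset_Lp_space: "U \<subseteq> Lp_space p {0<..<T}"
proof
  fix u assume u: "u \<in> U"
  obtain K where K: "0 \<le> K" "\<And>x. x \<in> M \<Longrightarrow> norm x \<le> K * s x"
    using cone_norm_bound[OF cone compact_embedding] by blast
  obtain C where C: "0 < C" "\<And>u. u \<in> U \<Longrightarrow> Lp_norm p {0<..<T} (\<lambda>t. s (u t)) \<le> ennreal C"
    using seminorm_bound by blast
  have su: "(\<lambda>t. s (u t)) \<in> borel_measurable (lebesgue_on {0<..<T})"
      "AE t in lebesgue_on {0<..<T}. u t \<in> M"
    using u subset by (auto simp: Lp_cone_def)
  have "Lp_norm p {0<..<T} (\<lambda>t. norm (u t)) \<le> Lp_norm p {0<..<T} (\<lambda>t. K * s (u t))"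
  proof (rule Lp_norm_mono_AE[OF p borel_measurable_norm_strongly_measurable[OF interval_lebesgue U_strongly_measurable(1)[OF u]]])
    show "AE t in lebesgue_on {0<..<T}. \<bar>norm (u t)\<bar> \<le> \<bar>K * s (u t)\<bar>"
      using su(2)
    proof eventually_elim
      case (elim t)
      show ?case using K(2)[OF elim] norm_ge_zero[of "u t"] by linarith
    qed
  qed
  also have "\<dots> \<le> ennreal (\<bar>K\<bar> * C)"
    by (rule Lp_norm_cmult_le[OF p su(1) C(2)[OF u] less_imp_le[OF C(1)]])
  finally have "Lp_norm p {0<..<T} (\<lambda>t. norm (u t)) < \<infinity>" by (auto intro: le_less_trans)
  then show "u \<in> Lp_space p {0<..<T}"
    using U_strongly_measurable(1)[OF u] by (simp add: Lp_space_def)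
qed

text \<open>The order of choices matters: \<eta> and \<open>C\<close> fix the Ehrling parameter,
  this fixes \<open>K\<close>, and only then is the smallness of the \<open>Y\<close> shifts
  prescribed. The resulting \<delta> depends neither on \<open>u\<close> nor on the chosen Borel
  version \<open>G\<close>.\<close>

lemma shifts_in_B:
  assumes "0 < \<eta>"
  obtains \<delta> where "0 < \<delta>" "\<And>u G Z h. u \<in> U \<Longrightarrow> borel_dist_version {0<..<T} u G Z \<Longrightarrow> 0 < h \<Longrightarrow> h < \<delta> \<Longrightarrow>
      Lp_norm p {0<..<T - h} (\<lambda>t. G (t + h) t) \<le> ennreal \<eta>"
proof -
  obtain C where C: "0 < C" "\<And>u. u \<in> U \<Longrightarrow> Lp_norm p {0<..<T} (\<lambda>t. s (u t)) \<le> ennreal C"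
    using seminorm_bound by blast
  \<comment> \<open>The seminorms at \<open>t + h\<close> and at \<open>t\<close> contribute at most
    \<epsilon> times \<open>C + C\<close>, that is \<open>\<eta> / 2\<close>.\<close>
  define \<epsilon> where "\<epsilon> = \<eta> / (4 * C)"
  have \<epsilon>: "0 < \<epsilon>" "\<epsilon> * (C + C) = \<eta> / 2" using assms C(1) by (simp_all add: \<epsilon>_def field_simps)
  obtain K where K: "0 \<le> K" "\<And>x y. x \<in> M \<Longrightarrow> y \<in> M \<Longrightarrow> lies_in_Y iB iY x \<Longrightarrow> lies_in_Y iB iY y \<Longrightarrow>
      norm (x - y) \<le> \<epsilon> * (s x + s y) + K * norm (as_Y iB iY x - as_Y iB iY y)"
    using Ehrling[OF \<epsilon>(1)] by blast
  \<comment> \<open>The term in \<open>Y\<close> contributes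
    \<open>K * \<epsilon>' \<le> \<eta> / 2\<close>; \<open>K + 1\<close> guards against
    \<open>K = 0\<close>.\<close>
  define \<epsilon>' where "\<epsilon>' = (\<eta> / 2) / (K + 1)"
  have \<epsilon>': "0 < \<epsilon>'" "K * \<epsilon>' \<le> \<eta> / 2"
  proof -
    show "0 < \<epsilon>'" using assms K(1) by (simp add: \<epsilon>'_def)
    then have "K * \<epsilon>' \<le> \<epsilon>' * (K + 1)" by (simp add: algebra_simps)
    also have "\<dots> = \<eta> / 2"
    proof -
      have "K + 1 \<noteq> 0" using K(1) by linarith
      from nonzero_eq_divide_eq[OF this] show ?thesis using \<epsilon>'_def by blast
    qed
    finally show "K * \<epsilon>' \<le> \<eta> / 2" .
  qed
  obtain \<delta> where \<delta>: "0 < \<delta>" "\<And>h u. 0 < h \<Longrightarrow> h < \<delta> \<Longrightarrow> u \<in> U \<Longrightarrow>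
      Lp_norm p {0<..<T - h} (\<lambda>t. norm (as_Y iB iY (u (t + h)) - as_Y iB iY (u t))) \<le> ennreal \<epsilon>'"
    using shifts[OF \<epsilon>'(1)] unfolding eventually_at_right_field by auto
  show ?thesis
  proof (rule that[OF \<delta>(1)])
    fix u G Z h assume u: "u \<in> U" and G: "borel_dist_version {0<..<T} u G Z" and h: "0 < h" "h < \<delta>"
    obtain g H Z' where g[measurable]: "g \<in> borel_measurable borel" and Z': "Z' \<in> null_sets lborel"
      and H: "borel_dist_version {0<..<T} (\<lambda>t. as_Y iB iY (u t)) H Z'"
      and good: "\<And>t. t \<in> {0<..<T} - Z' \<Longrightarrow> u t \<in> M \<and> lies_in_Y iB iY (u t) \<and> g t = s (u t)"
      by (rule ex_borel_data[OF u]) (rule that)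
    have [measurable]: "(\<lambda>(x, y). G x y) \<in> borel_measurable (borel \<Otimes>\<^sub>M borel)"
        "(\<lambda>(x, y). H x y) \<in> borel_measurable (borel \<Otimes>\<^sub>M borel)"
      and Z: "Z \<in> null_sets lborel"
      and G_eq: "\<And>x y. x \<in> {0<..<T} - Z \<Longrightarrow> y \<in> {0<..<T} - Z \<Longrightarrow> G x y = norm (u x - u y)"
      and H_eq: "\<And>x y. x \<in> {0<..<T} - Z' \<Longrightarrow> y \<in> {0<..<T} - Z' \<Longrightarrow> H x y = norm (as_Y iB iY (u x) - as_Y iB iY (u y))"
      using G H unfolding borel_dist_version_def by auto
    let ?L = "lebesgue_on {0<..<T - h}"
    have AE_good: "AE t in ?L. t \<in> {0<..<T} - (Z \<union> Z') \<and> t + h \<in> {0<..<T} - (Z \<union> Z')"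
    proof -
      have ZZ: "Z \<union> Z' \<in> null_sets lborel" using Z Z' by (rule null_sets.Un)
      show ?thesis unfolding AE_lebesgue_on_iff[OF interval_lebesgue]
        using AE_not_in[OF ZZ] AE_lborel_shift[OF ZZ, of h]
        by eventually_elim (use h in auto)
    qed
    have gC: "Lp_norm p {0<..<T} g \<le> ennreal C"
      by (rule borel_version_Lp_norm_le[OF u g Z' _ C(2)[OF u]]) (use good in blast)
    have g1: "Lp_norm p {0<..<T - h} (\<lambda>t. g (t + h)) \<le> ennreal C"
      using h by (intro Lp_norm_reparam_le[OF p g _ _ _ gC less_imp_le[OF C(1)]]) auto
    have g2: "Lp_norm p {0<..<T - h} g \<le> ennreal C"
      using h Lp_norm_reparam_le[OF p g _ _ _ gC less_imp_le[OF C(1)], of "{0<..<T - h}" 0] by auto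
    have "Lp_norm p {0<..<T - h} (\<lambda>t. H (t + h) t) \<le> ennreal \<epsilon>'"
    proof -
      have "AE t in ?L. \<bar>H (t + h) t\<bar> \<le> \<bar>norm (as_Y iB iY (u (t + h)) - as_Y iB iY (u t))\<bar>"
        using AE_good by eventually_elim (simp add: H_eq)
      moreover have "(\<lambda>t. H (t + h) t) \<in> borel_measurable borel" by measurable
      ultimately have "Lp_norm p {0<..<T - h} (\<lambda>t. H (t + h) t)
          \<le> Lp_norm p {0<..<T - h} (\<lambda>t. norm (as_Y iB iY (u (t + h)) - as_Y iB iY (u t)))"
        by (intro Lp_norm_mono_AE p borel_imp_lebesgue_on)
      also have "\<dots> \<le> ennreal \<epsilon>'" using h u by (intro \<delta>(2))
      finally show ?thesis .
    qed
    have Hm: "(\<lambda>t. H (t + h) t) \<in> borel_measurable ?L"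
      and Gm: "(\<lambda>t. G (t + h) t) \<in> borel_measurable ?L"
      and gm: "(\<lambda>t. g (t + h)) \<in> borel_measurable ?L" "g \<in> borel_measurable ?L"
      by (rule borel_imp_lebesgue_on, measurable)+
    have gm': "(\<lambda>t. g (t + h) + g t) \<in> borel_measurable ?L"
      using gm by (rule borel_measurable_add)
    have "Lp_norm p {0<..<T - h} (\<lambda>t. g (t + h) + g t) \<le> ennreal (C + C)"
      by (rule Lp_norm_add_le_pos[OF p gm g1 g2 C(1) C(1)])
    then have 1: "Lp_norm p {0<..<T - h} (\<lambda>t. \<epsilon> * (g (t + h) + g t)) \<le> ennreal (\<eta> / 2)"
      using Lp_norm_cmult_le[OF p gm', of "C + C" \<epsilon>] C(1) unfolding abs_of_pos[OF \<epsilon>(1)] \<epsilon>(2) by simp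
    have 2: "Lp_norm p {0<..<T - h} (\<lambda>t. K * H (t + h) t) \<le> ennreal (\<eta> / 2)"
    proof -
      have "Lp_norm p {0<..<T - h} (\<lambda>t. K * H (t + h) t) \<le> ennreal (\<bar>K\<bar> * \<epsilon>')"
        by (rule Lp_norm_cmult_le[OF p Hm \<open>Lp_norm p {0<..<T - h} (\<lambda>t. H (t + h) t) \<le> ennreal \<epsilon>'\<close> less_imp_le[OF \<epsilon>'(1)]])
      also have "\<dots> \<le> ennreal (\<eta> / 2)" using \<epsilon>'(2) K(1) by (intro ennreal_leI) simp
      finally show ?thesis .
    qed
    have m1: "(\<lambda>t. \<epsilon> * (g (t + h) + g t)) \<in> borel_measurable ?L"
      and m2: "(\<lambda>t. K * H (t + h) t) \<in> borel_measurable ?L"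
      using gm' Hm by measurable
    have "Lp_norm p {0<..<T - h} (\<lambda>t. G (t + h) t)
        \<le> Lp_norm p {0<..<T - h} (\<lambda>t. \<epsilon> * (g (t + h) + g t) + K * H (t + h) t)"
    proof (rule Lp_norm_mono_AE[OF p Gm])
      show "AE t in ?L. \<bar>G (t + h) t\<bar> \<le> \<bar>\<epsilon> * (g (t + h) + g t) + K * H (t + h) t\<bar>"
        using AE_good
      proof eventually_elim
        case (elim t)
        then have t: "t \<in> {0<..<T} - Z'" "t + h \<in> {0<..<T} - Z'" by auto
        have "G (t + h) t = norm (u (t + h) - u t)" using elim by (intro G_eq) auto
        moreover have "H (t + h) t = norm (as_Y iB iY (u (t + h)) - as_Y iB iY (u t))"
          by (rule H_eq[OF t(2,1)])
        moreover have "norm (u (t + h) - u t) \<le> \<epsilon> * (s (u (t + h)) + s (u t))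
            + K * norm (as_Y iB iY (u (t + h)) - as_Y iB iY (u t))"
          using good[OF t(1)] good[OF t(2)] by (intro K(2)) auto
        ultimately show ?case using good[OF t(1)] good[OF t(2)] by simp
      qed
    qed
    also have "\<dots> \<le> ennreal (\<eta> / 2 + \<eta> / 2)"
      using assms by (intro Lp_norm_add_le_pos[OF p m1 m2 1 2]) auto
    finally show "Lp_norm p {0<..<T - h} (\<lambda>t. G (t + h) t) \<le> ennreal \<eta>" by simp
  qed
qed

text \<open>Uniform shifts determine the mesh, the mesh determines the level \<open>R\<close>, and
  only then is the sublevel set covered by finitely many balls. A function is labelled by the
  centres near its samples; its own offset does not enter the label.\<close>

lemma ex_finite_net_finite_exponent:
  assumes fin: "p \<noteq> \<infinity>" and \<epsilon>: "0 < \<epsilon>"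
  shows "\<exists>K. finite K \<and> K \<subseteq> U \<and> (\<forall>u\<in>U. \<exists>k\<in>K. Lp_norm p {0<..<T} (\<lambda>t. norm (u t - k t)) \<le> ennreal \<epsilon>)"
proof -
  obtain C where C: "0 < C" "\<And>u. u \<in> U \<Longrightarrow> Lp_norm p {0<..<T} (\<lambda>t. s (u t)) \<le> ennreal C"
    using seminorm_bound by blast
  \<comment> \<open>Sampling costs a factor 6, so each step function is within
    \<open>\<epsilon> / 4\<close> of its function.\<close>
  have "0 < \<epsilon> / 24" using \<epsilon> by simp
  obtain \<delta> where \<delta>: "0 < \<delta>"
    "\<And>u G Z h. u \<in> U \<Longrightarrow> borel_dist_version {0<..<T} u G Z \<Longrightarrow> 0 < h \<Longrightarrow> h < \<delta> \<Longrightarrow>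
      Lp_norm p {0<..<T - h} (\<lambda>t. G (t + h) t) \<le> ennreal (\<epsilon> / 24)"
    by (rule shifts_in_B[OF \<open>0 < \<epsilon> / 24\<close>]) (rule that)
  obtain N m where m: "0 < m" "T = real N * m" "m < \<delta>"
    using ex_grid[OF T \<delta>(1)] by blast
  define R where "R = (3 * real N * C powr enn2real p / m) powr (1 / enn2real p)"
  \<comment> \<open>Samples with a common centre differ by at most \<open>2 * \<nu>\<close>, a
    constant whose norm is at most \<open>2 * \<nu> * (1 + T) = \<epsilon> / 4\<close>. Together
    with two sampling errors this makes \<open>3 * \<epsilon> / 4\<close>.\<close>
  define \<nu> where "\<nu> = (\<epsilon> / 8) / (1 + T)"
  have \<nu>: "0 < \<nu>" "2 * \<nu> * (1 + T) = \<epsilon> / 4"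
  proof -
    have "1 + T \<noteq> 0" using T by linarith
    from nonzero_eq_divide_eq[OF this] have "\<nu> * (1 + T) = \<epsilon> / 8" using \<nu>_def by blast
    then have "2 * (\<nu> * (1 + T)) = 2 * (\<epsilon> / 8)" by (rule arg_cong)
    then show "2 * \<nu> * (1 + T) = \<epsilon> / 4" unfolding mult.assoc by simp
    show "0 < \<nu>" using \<epsilon> T by (simp add: \<nu>_def)
  qed
  obtain F where F: "finite F" "\<And>x. x \<in> M \<Longrightarrow> s x \<le> R \<Longrightarrow> \<exists>c\<in>F. dist c x < \<nu>"
    using cone_sublevel_finite_net[OF compact_embedding \<nu>(1)] by blast
  have "\<forall>x. \<exists>c. x \<in> M \<and> s x \<le> R \<longrightarrow> c \<in> F \<and> dist c x < \<nu>" using F(2) by blast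
  then obtain c where c: "\<forall>x. x \<in> M \<and> s x \<le> R \<longrightarrow> c x \<in> F \<and> dist (c x) x < \<nu>" by (rule choice[THEN exE])
  have "\<forall>u. \<exists>\<tau>. u \<in> U \<longrightarrow> (\<forall>k<N. u (m * real k + \<tau>) \<in> M \<and> s (u (m * real k + \<tau>)) \<le> R) \<and>
      Lp_norm p {0<..<T} (\<lambda>t. norm (u t - u (m * real (nat \<lfloor>t / m\<rfloor>) + \<tau>))) \<le> ennreal (\<epsilon> / 4)"
  proof (intro allI)
    fix u
    show "\<exists>\<tau>. u \<in> U \<longrightarrow> (\<forall>k<N. u (m * real k + \<tau>) \<in> M \<and> s (u (m * real k + \<tau>)) \<le> R) \<and>
      Lp_norm p {0<..<T} (\<lambda>t. norm (u t - u (m * real (nat \<lfloor>t / m\<rfloor>) + \<tau>))) \<le> ennreal (\<epsilon> / 4)"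
    proof (cases "u \<in> U")
      case u: True
      obtain g H Z where g: "g \<in> borel_measurable borel" and Z: "Z \<in> null_sets lborel"
        and H: "borel_dist_version {0<..<T} (\<lambda>t. as_Y iB iY (u t)) H Z"
        and good: "\<And>t. t \<in> {0<..<T} - Z \<Longrightarrow> u t \<in> M \<and> lies_in_Y iB iY (u t) \<and> g t = s (u t)"
        by (rule ex_borel_data[OF u]) (rule that)
      obtain G Z' where GZ': "borel_dist_version {0<..<T} u G Z'"
        by (rule ex_borel_dist_version[OF interval_lebesgue U_strongly_measurable(1)[OF u]])
      then have "Z' \<in> null_sets lborel" unfolding borel_dist_version_def by blast
      from null_sets.Un[OF this Z] have G: "borel_dist_version {0<..<T} u G (Z' \<union> Z)"
        by (rule borel_dist_version_mono[OF GZ' Un_upper1])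
      have gC: "Lp_norm p {0<..<T} g \<le> ennreal C"
        by (rule borel_version_Lp_norm_le[OF u g Z _ C(2)[OF u]]) (use good in blast)
      obtain \<tau> where \<tau>: "\<And>k. k < N \<Longrightarrow> m * real k + \<tau> \<in> {0<..<T} - (Z' \<union> Z)"
        "\<And>k. k < N \<Longrightarrow> \<bar>g (m * real k + \<tau>)\<bar> \<le> R"
        "Lp_norm p {0<..<T} (\<lambda>t. norm (u t - u (m * real (nat \<lfloor>t / m\<rfloor>) + \<tau>))) \<le> ennreal (6 * (\<epsilon> / 24))"
      proof (rule ex_step_approximation[OF p fin G m(1,2) _ \<open>0 < \<epsilon> / 24\<close> g gC C(1) HOL.refl, folded R_def])
        show "Lp_norm p {0<..<T - h} (\<lambda>t. G (t + h) t) \<le> ennreal (\<epsilon> / 24)" if "0 < h" "h < m" for h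
          using \<delta>(2)[OF u G that(1)] that m(3) by simp
      qed (rule that)
      have "u (m * real k + \<tau>) \<in> M \<and> s (u (m * real k + \<tau>)) \<le> R" if "k < N" for k
      proof -
        have "m * real k + \<tau> \<in> {0<..<T} - Z" using \<tau>(1)[OF that] by blast
        from good[OF this] \<tau>(2)[OF that] show ?thesis by auto
      qed
      moreover have "6 * (\<epsilon> / 24) = \<epsilon> / 4" by simp
      ultimately show ?thesis using \<tau>(3) by (intro exI[of _ \<tau>]) simp
    qed simp
  qed
  then obtain \<tau> where \<tau>: "\<forall>u. u \<in> U \<longrightarrow> (\<forall>k<N. u (m * real k + \<tau> u) \<in> M \<and> s (u (m * real k + \<tau> u)) \<le> R) \<and>
      Lp_norm p {0<..<T} (\<lambda>t. norm (u t - u (m * real (nat \<lfloor>t / m\<rfloor>) + \<tau> u))) \<le> ennreal (\<epsilon> / 4)"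
    by (rule choice[THEN exE])
  \<comment> \<open>Restriction to \<open>{..<N}\<close> makes labels extensional, so they lie in a
    finite product of copies of \<open>F\<close>.\<close>
  define lab where "lab u = (\<lambda>k\<in>{..<N}. c (u (m * real k + \<tau> u)))" for u
  show ?thesis
  proof (rule finite_net_of_finite_labels[where lab = lab])
    have "lab ` U \<subseteq> PiE {..<N} (\<lambda>_. F)"
    proof (rule image_subsetI)
      fix u assume "u \<in> U"
      then have "c (u (m * real k + \<tau> u)) \<in> F" if "k < N" for k using c \<tau> that by blast
      then show "lab u \<in> PiE {..<N} (\<lambda>_. F)" unfolding lab_def restrict_PiE_iff by blast
    qed
    then show "finite (lab ` U)" by (rule finite_subset) (intro finite_PiE F(1), simp)
    fix u v assume u: "u \<in> U" and v: "v \<in> U" and eq: "lab u = lab v"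
    define a where "a t = norm (u t - u (m * real (nat \<lfloor>t / m\<rfloor>) + \<tau> u))" for t
    define b where "b t = norm (v t - v (m * real (nat \<lfloor>t / m\<rfloor>) + \<tau> v))" for t
    have ab: "Lp_norm p {0<..<T} a \<le> ennreal (\<epsilon> / 4)" "Lp_norm p {0<..<T} b \<le> ennreal (\<epsilon> / 4)"
      using \<tau> u v unfolding a_def b_def by auto
    have abm: "a \<in> borel_measurable (lebesgue_on {0<..<T})" "b \<in> borel_measurable (lebesgue_on {0<..<T})"
      unfolding a_def b_def
      by (intro borel_measurable_norm_strongly_measurable[OF interval_lebesgue] strongly_measurable_diff
        U_strongly_measurable(1) u v strongly_measurable_simple_function simple_function_grid[OF m(1,2)])+
    have "Lp_norm p {0<..<T} (\<lambda>t. norm (u t - v t)) \<le> Lp_norm p {0<..<T} (\<lambda>t. (a t + b t) + 2 * \<nu>)"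
    proof (rule Lp_norm_mono_AE[OF p])
      show "(\<lambda>t. norm (u t - v t)) \<in> borel_measurable (lebesgue_on {0<..<T})"
        by (intro borel_measurable_norm_strongly_measurable[OF interval_lebesgue] strongly_measurable_diff
          U_strongly_measurable(1) u v)
      show "AE t in lebesgue_on {0<..<T}. \<bar>norm (u t - v t)\<bar> \<le> \<bar>(a t + b t) + 2 * \<nu>\<bar>"
      proof (rule AE_I2)
        fix t assume "t \<in> space (lebesgue_on {0<..<T})"
        then have "t \<in> {0<..<T}" by simp
        define k where "k = nat \<lfloor>t / m\<rfloor>"
        have k: "k < N" unfolding k_def by (rule grid_floor_bounds(1)[OF m(1,2) \<open>t \<in> {0<..<T}\<close>])
        define x where "x = u (m * real k + \<tau> u)"
        define y where "y = v (m * real k + \<tau> v)"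
        have xy: "dist (c x) x < \<nu>" "dist (c y) y < \<nu>"
          using c \<tau> u v k unfolding x_def y_def by blast+
        have "c x = c y" using fun_cong[OF eq, of k] k unfolding lab_def x_def y_def by simp
        then have "dist x y \<le> 2 * \<nu>" using dist_triangle3[of x y "c x"] xy by simp
        moreover have "dist (u t) (v t) \<le> dist (u t) x + dist x y + dist y (v t)"
          using dist_triangle[of "u t" "v t" x] dist_triangle[of x "v t" y] by linarith
        moreover have "dist (u t) x = a t" "dist y (v t) = b t"
          unfolding a_def b_def x_def y_def k_def by (simp_all add: dist_norm norm_minus_commute)
        ultimately have "norm (u t - v t) \<le> a t + b t + 2 * \<nu>" by (simp add: dist_norm)
        then show "\<bar>norm (u t - v t)\<bar> \<le> \<bar>(a t + b t) + 2 * \<nu>\<bar>"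
          using norm_ge_zero[of "u t - v t"] by linarith
      qed
    qed
    also have "\<dots> \<le> ennreal ((\<epsilon> / 4 + \<epsilon> / 4) + 2 * \<nu> * (1 + T))"
    proof (rule Lp_norm_add_le_pos[OF p])
      show "Lp_norm p {0<..<T} (\<lambda>t. a t + b t) \<le> ennreal (\<epsilon> / 4 + \<epsilon> / 4)"
        using \<epsilon> by (intro Lp_norm_add_le_pos[OF p abm ab]) auto
      show "Lp_norm p {0<..<T} (\<lambda>t. 2 * \<nu>) \<le> ennreal (2 * \<nu> * (1 + T))"
        using T \<nu>(1) by (intro Lp_norm_const_le[OF p]) auto
    qed (use abm \<epsilon> \<nu> T in auto)
    also have "\<dots> \<le> ennreal \<epsilon>" unfolding \<nu>(2) using \<epsilon> by (intro ennreal_leI) simp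
    finally show "Lp_norm p {0<..<T} (\<lambda>t. norm (u t - v t)) \<le> ennreal \<epsilon>" .
  qed
qed

end

section \<open>Continuous representatives and the case \<open>p = \<infinity>\<close>\<close>

lemma AE_lborel_ex_in_interval:
  fixes a b :: real
  assumes "AE t in lborel. P t" "a < b"
  obtains t where "a < t" "t < b" "P t"
proof (rule ccontr)
  assume "\<not> thesis"
  then have no: "\<And>t. t \<in> {a<..<b} \<Longrightarrow> \<not> P t" using that by auto
  from assms(1) have "AE t in lborel. t \<notin> {a<..<b}" by eventually_elim (use no in blast)
  then have "{a<..<b} \<in> null_sets lborel" by (subst AE_iff_null_sets) simp_all
  then have "emeasure lborel {a<..<b} = 0" by auto
  then show False using assms(2) by simp
qed

text \<open>Every neighbourhood of a point of \<open>{0..T}\<close>, the end points included, meets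
  \<open>{0<..<T}\<close> in a nondegenerate interval, and a conull set cannot miss such an
  interval.\<close>

lemma closure_of_conull:
  fixes T :: real
  assumes "0 < T" "AE t in lborel. t \<in> {0<..<T} \<longrightarrow> t \<in> P"
  shows "{0..T} \<subseteq> closure P"
proof
  fix x assume x: "x \<in> {0..T}"
  show "x \<in> closure P" unfolding closure_approachable
  proof (intro allI impI)
    fix e :: real assume e: "0 < e"
    have "max 0 (x - e) < min T (x + e)" using x e assms(1) by auto
    from AE_lborel_ex_in_interval[OF assms(2) this] obtain t where
      "max 0 (x - e) < t" "t < min T (x + e)" "t \<in> {0<..<T} \<longrightarrow> t \<in> P" .
    then have "t \<in> P" "dist t x < e" by (auto simp: dist_real_def)
    then show "\<exists>y\<in>P. dist y x < e" by blast
  qed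
qed

lemma conull_sequence:
  fixes T :: real and v :: "real \<Rightarrow> 'b::metric_space"
  assumes "0 < T" "AE t in lborel. t \<in> {0<..<T} \<longrightarrow> t \<in> P" "P \<subseteq> {0..T}" "t \<in> {0..T}" "continuous_on {0..T} v"
  obtains x where "\<And>k::nat. x k \<in> P" "x \<longlonglongrightarrow> t" "(\<lambda>k. v (x k)) \<longlonglongrightarrow> v t"
proof -
  have "t \<in> closure P" using closure_of_conull[OF assms(1,2)] assms(4) by blast
  then obtain x where x: "\<And>k. x k \<in> P" "x \<longlonglongrightarrow> t" unfolding closure_sequential by blast
  have "x k \<in> {0..T}" for k using x(1) assms(3) by blast
  then have "(\<lambda>k. v (x k)) \<longlonglongrightarrow> v t"
    using assms(4) by (intro continuous_on_tendsto_compose[OF assms(5) x(2)] always_eventually) simp_all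
  with x show ?thesis by (rule that)
qed

section \<open>The metric space of continuous functions\<close>

lemma mspace_C0_metric:
  "v \<in> mspace (C0_metric T) \<longleftrightarrow> v \<in> extensional {0..T} \<and> continuous_on {0..T} v"
proof -
  \<comment> \<open>Compactness of the interval turns the boundedness condition in
    \<open>cfunspace\<close> into a consequence of continuity.\<close>
  have "compactin (top_of_set {0..T}) (topspace (top_of_set {0..T}))"
    by (simp add: compactin_subtopology)
  from compactin_mspace_cfunspace[OF this, of euclidean_metric] show ?thesis
    unfolding C0_metric_def by (auto simp: PiE_def)
qed

lemma mdist_C0_metric_le:
  assumes "0 \<le> e" "\<And>t. t \<in> {0..T} \<Longrightarrow> dist (v t) (w t) \<le> e"
  shows "mdist (C0_metric T) v w \<le> e"
  unfolding C0_metric_def using assms by (intro mdist_cfunspace_le) auto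

lemma mcomplete_of_cfunspace_euclidean:
  "mcomplete_of (cfunspace X (euclidean_metric :: 'b::complete_space metric))"
proof -
  have "Metric_space.mcomplete UNIV (dist :: 'b \<Rightarrow> _)" by (simp add: complete_UNIV)
  from Met_TC.mcomplete_cfunspace[OF this, of X] show ?thesis
    unfolding euclidean_metric_def Met_TC.Self_def .
qed

lemma relatively_compact_in_C0:
  fixes V :: "(real \<Rightarrow> 'b::complete_space) set"
  assumes V: "V \<subseteq> mspace (C0_metric T)"
    and net: "\<And>\<epsilon>::real. \<epsilon> > 0 \<Longrightarrow> \<exists>K. finite K \<and> K \<subseteq> V \<and> (\<forall>v\<in>V. \<exists>k\<in>K. \<forall>t\<in>{0..T}. dist (v t) (k t) \<le> \<epsilon>)"
  shows "relatively_compact_in (mtopology_of (C0_metric T)) V"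
proof -
  interpret C: Metric_space "mspace (C0_metric T)" "mdist (C0_metric T) :: (real \<Rightarrow> 'b) \<Rightarrow> _" by simp
  have "mcomplete_of (C0_metric T :: (real \<Rightarrow> 'b) metric)"
    unfolding C0_metric_def by (rule mcomplete_of_cfunspace_euclidean)
  then have complete: "C.mcomplete" by (simp add: mcomplete_of_def)
  have "C.mtotally_bounded V" unfolding C.mtotally_bounded_def
  proof (intro allI impI)
    fix \<epsilon> :: real assume "\<epsilon> > 0"
    then have "\<epsilon> / 2 > 0" by simp
    from net[OF this] obtain K where K: "finite K" "K \<subseteq> V" "\<forall>v\<in>V. \<exists>k\<in>K. \<forall>t\<in>{0..T}. dist (v t) (k t) \<le> \<epsilon> / 2"
      by (elim exE conjE) (rule that)
    have "v \<in> (\<Union>x\<in>K. C.mball x \<epsilon>)" if v: "v \<in> V" for v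
    proof -
      obtain k where k: "k \<in> K" "\<And>t. t \<in> {0..T} \<Longrightarrow> dist (v t) (k t) \<le> \<epsilon> / 2" using K(3) v by blast
      then have "mdist (C0_metric T) k v \<le> \<epsilon> / 2"
        using \<open>\<epsilon> > 0\<close> by (intro mdist_C0_metric_le) (auto simp: dist_commute)
      then have "v \<in> C.mball k \<epsilon>" using \<open>\<epsilon> > 0\<close> k(1) v K(2) V by (auto simp: subset_iff)
      then show ?thesis using k(1) by blast
    qed
    then show "\<exists>K. finite K \<and> K \<subseteq> V \<and> V \<subseteq> (\<Union>x\<in>K. C.mball x \<epsilon>)" using K(1,2) by blast
  qed
  then show ?thesis
    using C.mtotally_bounded_eq_compact_closure_of[OF complete, of V] V
    unfolding relatively_compact_in_def mtopology_of_def by simp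
qed

section \<open>Equicontinuity off a null set\<close>

context Aubin_Lions_cone
begin

text \<open>The modulus \<delta> and the level \<open>C\<close> are common to all of
  \<open>U\<close>, whereas the conull set \<open>P\<close> of good times belongs to
  \<open>u\<close>. The factor 2 stems from comparing two times through a third one.\<close>

definition equicontinuity_set :: "(nat \<Rightarrow> real) \<Rightarrow> real \<Rightarrow> (real \<Rightarrow> 'b) \<Rightarrow> real set \<Rightarrow> bool" where
  "equicontinuity_set \<delta> C u P \<longleftrightarrow>
     P \<subseteq> {0<..<T} \<and> (AE t in lborel. t \<in> {0<..<T} \<longrightarrow> t \<in> P) \<and>
     (\<forall>t\<in>P. u t \<in> M \<and> s (u t) \<le> C) \<and>
     (\<forall>n. \<forall>t\<in>P. \<forall>t'\<in>P. \<bar>t - t'\<bar> < \<delta> n \<longrightarrow> dist (u t) (u t') \<le> 2 * inverse (real (Suc n)))"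

text \<open>The shift bound holds for every small \<open>h\<close> at almost every \<open>t\<close>,
  with a null set that varies with \<open>h\<close>. Applying the strip estimate to the indicator of
  \<open>G > e\<close>, with bound 0, exchanges the quantifiers.\<close>

lemma AE_AE_dist_le:
  assumes inf: "p = \<infinity>" and G: "borel_dist_version {0<..<T} u G Z" and "0 < d" "0 \<le> e"
    and shift: "\<And>h. 0 < h \<Longrightarrow> h < d \<Longrightarrow> Lp_norm p {0<..<T - h} (\<lambda>t. G (t + h) t) \<le> ennreal e"
  shows "AE t in lborel. AE s in lborel. t \<in> {0<..<T} \<and> s \<in> {0<..<T} \<and> \<bar>s - t\<bar> < d \<longrightarrow> G t s \<le> e"
proof -
  have [measurable]: "(\<lambda>(x, y). G x y) \<in> borel_measurable (borel \<Otimes>\<^sub>M borel)"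
    and sym: "\<And>x y. G x y = G y x" using G unfolding borel_dist_version_def by auto
  define D where "D x y = (indicator {e<..} (G x y) :: ennreal)" for x y
  have D[measurable]: "(\<lambda>(x, y). D x y) \<in> borel_measurable (borel \<Otimes>\<^sub>M borel)" unfolding D_def by measurable
  define E where "E t s = D t s * indicator {0<..<T} t * indicator {0<..<T} s * indicator {-d<..<d} (s - t)" for t s
  have [measurable]: "(\<lambda>(x, y). E x y) \<in> borel_measurable (borel \<Otimes>\<^sub>M borel)" unfolding E_def by measurable
  have "(\<integral>\<^sup>+t. \<integral>\<^sup>+s. E t s \<partial>lborel \<partial>lborel) \<le> ennreal (2 * d) * 0"
    unfolding E_def
  proof (rule near_diagonal_integral_le[OF D _ \<open>0 < d\<close>])
    show "D x y = D y x" for x y unfolding D_def sym[of x y] ..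
    fix h :: real assume h: "0 < h" "h < d"
    have Gm: "(\<lambda>t. G (t + h) t) \<in> borel_measurable borel" by measurable
    from shift[OF h] have "AE t in lborel. t \<in> {0<..<T - h} \<longrightarrow> \<bar>G (t + h) t\<bar> \<le> e"
      unfolding Lp_norm_infinity_le_iff[OF inf borel_imp_lebesgue_on[OF Gm] \<open>0 \<le> e\<close>]
        AE_lebesgue_on_iff[OF interval_lebesgue] .
    then have "AE t in lborel. D (t + h) t * indicator {0<..<T - h} t = 0"
      by eventually_elim (auto simp: D_def indicator_def)
    from nn_integral_cong_AE[OF this]
    show "(\<integral>\<^sup>+t. D (t + h) t * indicator {0<..<T - h} t \<partial>lborel) \<le> 0" by simp
  qed
  then have "(\<integral>\<^sup>+t. \<integral>\<^sup>+s. E t s \<partial>lborel \<partial>lborel) = 0" by simp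
  then have "AE t in lborel. (\<integral>\<^sup>+s. E t s \<partial>lborel) = 0"
    by (subst (asm) nn_integral_0_iff_AE) measurable
  then show ?thesis
  proof eventually_elim
    case (elim t)
    then have "AE s in lborel. E t s = 0" by (subst (asm) nn_integral_0_iff_AE) measurable
    then show ?case
      by eventually_elim (auto simp: E_def D_def indicator_def not_less split: if_splits)
  qed
qed

text \<open>A good time \<open>t\<close> is close to almost every nearby time, but perhaps not to a
  given good \<open>t'\<close>. Almost every \<open>x\<close> between them is close to both, since
  it is nearer to each than they are to one another.\<close>

lemma ex_equicontinuity_set:
  assumes inf: "p = \<infinity>" and u: "u \<in> U" and C: "0 < C" "Lp_norm p {0<..<T} (\<lambda>t. s (u t)) \<le> ennreal C"
    and \<delta>: "\<And>n. 0 < \<delta> n" "\<And>n G Z h. borel_dist_version {0<..<T} u G Z \<Longrightarrow> 0 < h \<Longrightarrow> h < \<delta> n \<Longrightarrow>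
      Lp_norm p {0<..<T - h} (\<lambda>t. G (t + h) t) \<le> ennreal (inverse (real (Suc n)))"
  obtains P where "equicontinuity_set \<delta> C u P"
proof -
  obtain g H Z where g: "g \<in> borel_measurable borel" and Z: "Z \<in> null_sets lborel"
    and H: "borel_dist_version {0<..<T} (\<lambda>t. as_Y iB iY (u t)) H Z"
    and good: "\<And>t. t \<in> {0<..<T} - Z \<Longrightarrow> u t \<in> M \<and> lies_in_Y iB iY (u t) \<and> g t = s (u t)"
    by (rule ex_borel_data[OF u]) (rule that)
  obtain G Z' where G: "borel_dist_version {0<..<T} u G Z'"
    by (rule ex_borel_dist_version[OF interval_lebesgue U_strongly_measurable(1)[OF u]])
  then have Z': "Z' \<in> null_sets lborel"
    and G_eq: "\<And>x y. x \<in> {0<..<T} - Z' \<Longrightarrow> y \<in> {0<..<T} - Z' \<Longrightarrow> G x y = norm (u x - u y)"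
    unfolding borel_dist_version_def by auto
  have gC: "Lp_norm p {0<..<T} g \<le> ennreal C"
    by (rule borel_version_Lp_norm_le[OF u g Z _ C(2)]) (use good in blast)
  then have AE_g: "AE t in lborel. t \<in> {0<..<T} \<longrightarrow> \<bar>g t\<bar> \<le> C"
    unfolding Lp_norm_infinity_le_iff[OF inf borel_imp_lebesgue_on[OF g] less_imp_le[OF C(1)]]
      AE_lebesgue_on_iff[OF interval_lebesgue] .
  let ?near = "\<lambda>n t. AE s in lborel. t \<in> {0<..<T} \<and> s \<in> {0<..<T} \<and> \<bar>s - t\<bar> < \<delta> n \<longrightarrow> G t s \<le> inverse (real (Suc n))"
  have AE_near: "AE t in lborel. \<forall>n. ?near n t"
    unfolding AE_all_countable by (intro allI AE_AE_dist_le[OF inf G \<delta>(1) _ \<delta>(2)[OF G]]) simp_all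
  define P where "P = {t \<in> {0<..<T}. t \<notin> Z \<and> t \<notin> Z' \<and> \<bar>g t\<bar> \<le> C \<and> (\<forall>n. ?near n t)}"
  have lt: "dist (u t) (u t') \<le> 2 * inverse (real (Suc n))"
    if P: "t \<in> P" "t' \<in> P" and close: "\<bar>t - t'\<bar> < \<delta> n" and "t < t'" for n t t'
  proof -
    have "?near n t" "?near n t'" using P unfolding P_def by blast+
    with AE_not_in[OF Z'] have "AE x in lborel. x \<notin> Z' \<and>
       (t \<in> {0<..<T} \<and> x \<in> {0<..<T} \<and> \<bar>x - t\<bar> < \<delta> n \<longrightarrow> G t x \<le> inverse (real (Suc n))) \<and>
       (t' \<in> {0<..<T} \<and> x \<in> {0<..<T} \<and> \<bar>x - t'\<bar> < \<delta> n \<longrightarrow> G t' x \<le> inverse (real (Suc n)))"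
      by eventually_elim blast
    from AE_lborel_ex_in_interval[OF this \<open>t < t'\<close>] obtain x where x: "t < x" "x < t'" "x \<notin> Z' \<and>
       (t \<in> {0<..<T} \<and> x \<in> {0<..<T} \<and> \<bar>x - t\<bar> < \<delta> n \<longrightarrow> G t x \<le> inverse (real (Suc n))) \<and>
       (t' \<in> {0<..<T} \<and> x \<in> {0<..<T} \<and> \<bar>x - t'\<bar> < \<delta> n \<longrightarrow> G t' x \<le> inverse (real (Suc n)))" .
    have t: "t \<in> {0<..<T} - Z'" "t' \<in> {0<..<T} - Z'" using P unfolding P_def by blast+
    have x': "x \<in> {0<..<T} - Z'" using x t by auto
    have "\<bar>x - t\<bar> < \<delta> n" "\<bar>x - t'\<bar> < \<delta> n" using x(1,2) close by linarith+
    then have "G t x \<le> inverse (real (Suc n))" "G t' x \<le> inverse (real (Suc n))"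
      using x(3) x' t by blast+
    then have "dist (u t) (u x) \<le> inverse (real (Suc n))" "dist (u t') (u x) \<le> inverse (real (Suc n))"
      unfolding G_eq[OF t(1) x'] G_eq[OF t(2) x'] dist_norm by blast+
    then show ?thesis using dist_triangle2[of "u t" "u t'" "u x"] by linarith
  qed
  have "equicontinuity_set \<delta> C u P" unfolding equicontinuity_set_def
  proof (intro conjI allI ballI impI)
    show "P \<subseteq> {0<..<T}" unfolding P_def by blast
    show "AE t in lborel. t \<in> {0<..<T} \<longrightarrow> t \<in> P"
      using AE_not_in[OF Z] AE_not_in[OF Z'] AE_g AE_near
      unfolding P_def by eventually_elim blast
    fix t assume t: "t \<in> P"
    then have "t \<in> {0<..<T} - Z" "\<bar>g t\<bar> \<le> C" unfolding P_def by blast+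
    with good[OF this(1)] show "u t \<in> M" "s (u t) \<le> C" by auto
    fix n t' assume t': "t' \<in> P" and close: "\<bar>t - t'\<bar> < \<delta> n"
    consider "t < t'" | "t' < t" | "t = t'" by linarith
    then show "dist (u t) (u t') \<le> 2 * inverse (real (Suc n))"
    proof cases
      case 1
      then show ?thesis by (rule lt[OF t t' close])
    next
      case 2
      have "\<bar>t' - t\<bar> < \<delta> n" using close by linarith
      from lt[OF t' t this 2] show ?thesis by (simp add: dist_commute)
    qed simp
  qed
  then show ?thesis by (rule that)
qed

text \<open>Fixes \<delta> and \<open>C\<close> before \<open>u\<close>, which is the uniformity
  that the Arzela-Ascoli argument consumes.\<close>

lemma ex_uniform_equicontinuity:
  assumes inf: "p = \<infinity>"
  obtains \<delta> C where "\<And>n. 0 < \<delta> n" "\<And>u. u \<in> U \<Longrightarrow> \<exists>P. equicontinuity_set \<delta> C u P"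
proof -
  obtain C where C: "0 < C" "\<And>u. u \<in> U \<Longrightarrow> Lp_norm p {0<..<T} (\<lambda>t. s (u t)) \<le> ennreal C"
    by (rule seminorm_bound) (rule that)
  have "\<forall>n. \<exists>d>0. \<forall>u G Z h. u \<in> U \<longrightarrow> borel_dist_version {0<..<T} u G Z \<longrightarrow> 0 < h \<longrightarrow> h < d \<longrightarrow>
      Lp_norm p {0<..<T - h} (\<lambda>t. G (t + h) t) \<le> ennreal (inverse (real (Suc n)))"
  proof
    fix n
    have "0 < inverse (real (Suc n))" by simp
    then obtain d where "0 < d" "\<And>u G Z h. u \<in> U \<Longrightarrow> borel_dist_version {0<..<T} u G Z \<Longrightarrow> 0 < h \<Longrightarrow> h < d \<Longrightarrow>
      Lp_norm p {0<..<T - h} (\<lambda>t. G (t + h) t) \<le> ennreal (inverse (real (Suc n)))"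
      by (rule shifts_in_B) (rule that)
    then show "\<exists>d>0. \<forall>u G Z h. u \<in> U \<longrightarrow> borel_dist_version {0<..<T} u G Z \<longrightarrow> 0 < h \<longrightarrow> h < d \<longrightarrow>
      Lp_norm p {0<..<T - h} (\<lambda>t. G (t + h) t) \<le> ennreal (inverse (real (Suc n)))"
      by (intro exI conjI allI impI)
  qed
  then obtain \<delta> where \<delta>: "\<forall>n. 0 < \<delta> n \<and> (\<forall>u G Z h. u \<in> U \<longrightarrow> borel_dist_version {0<..<T} u G Z \<longrightarrow> 0 < h \<longrightarrow> h < \<delta> n \<longrightarrow>
      Lp_norm p {0<..<T - h} (\<lambda>t. G (t + h) t) \<le> ennreal (inverse (real (Suc n))))"
    by (rule choice[THEN exE])
  show ?thesis
  proof (rule that[of \<delta> C])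
    show "0 < \<delta> n" for n using \<delta> by blast
    fix u assume u: "u \<in> U"
    show "\<exists>P. equicontinuity_set \<delta> C u P"
    proof (rule ex_equicontinuity_set[OF inf u C(1) C(2)[OF u]])
      show "0 < \<delta> n" for n using \<delta> by blast
      show "Lp_norm p {0<..<T - h} (\<lambda>t. G (t + h) t) \<le> ennreal (inverse (real (Suc n)))"
        if "borel_dist_version {0<..<T} u G Z" "0 < h" "h < \<delta> n" for n G Z h
        using \<delta> u that by blast
    qed blast
  qed
qed

text \<open>On the dense set \<open>P\<close> the function is uniformly continuous, and as
  \<open>B\<close> is complete it extends to the closure, which contains
  \<open>{0..T}\<close>.\<close>

lemma ex_continuous_representative:
  assumes inf: "p = \<infinity>" and u: "u \<in> U"
  shows "\<exists>v. is_continuous_representative T u v"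
proof -
  obtain \<delta> C where \<delta>: "\<And>n. 0 < \<delta> n" "\<And>u. u \<in> U \<Longrightarrow> \<exists>P. equicontinuity_set \<delta> C u P"
    by (rule ex_uniform_equicontinuity[OF inf]) (rule that)
  from \<delta>(2)[OF u] obtain P where "equicontinuity_set \<delta> C u P" ..
  then have P: "P \<subseteq> {0<..<T}" "AE t in lborel. t \<in> {0<..<T} \<longrightarrow> t \<in> P"
      "\<And>n t t'. t \<in> P \<Longrightarrow> t' \<in> P \<Longrightarrow> \<bar>t - t'\<bar> < \<delta> n \<Longrightarrow> dist (u t) (u t') \<le> 2 * inverse (real (Suc n))"
    unfolding equicontinuity_set_def by blast+
  have "uniformly_continuous_on P u" unfolding uniformly_continuous_on_def
  proof (intro allI impI)
    fix e :: real assume "0 < e"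
    then have "0 < e / 2" by simp
    from reals_Archimedean[OF this] obtain n where n: "inverse (real (Suc n)) < e / 2" ..
    have "dist (u t') (u t) < e" if "t \<in> P" "t' \<in> P" "dist t' t < \<delta> n" for t t'
      using P(3)[OF that(2,1), of n] that(3) n unfolding dist_real_def by linarith
    then show "\<exists>d>0. \<forall>t\<in>P. \<forall>t'\<in>P. dist t' t < d \<longrightarrow> dist (u t') (u t) < e"
      using \<delta>(1)[of n] by blast
  qed
  then obtain w where w: "uniformly_continuous_on (closure P) w" "\<And>t. t \<in> P \<Longrightarrow> u t = w t"
    by (rule uniformly_continuous_on_extension_on_closure) (rule that)
  define v where "v = restrict w {0..T}"
  have "continuous_on {0..T} w"
    using uniformly_continuous_imp_continuous[OF w(1)] closure_of_conull[OF T P(2)] by (rule continuous_on_subset)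
  then have "continuous_on {0..T} v" by (rule continuous_on_eq) (simp add: v_def)
  then have "v \<in> mspace (C0_metric T)"
    unfolding mspace_C0_metric by (simp add: v_def)
  moreover have "AE t in lebesgue_on {0<..<T}. v t = u t"
    unfolding AE_lebesgue_on_iff[OF interval_lebesgue] using P(2)
  proof eventually_elim
    case (elim t)
    show ?case
    proof
      assume "t \<in> {0<..<T}"
      then show "v t = u t" using elim w(2)[of t] by (simp add: v_def)
    qed
  qed
  ultimately show ?thesis unfolding is_continuous_representative_def by blast
qed

text \<open>A representative agrees with \<open>u\<close> only almost everywhere, but the good times
  of agreement are still dense, and the bounds pass to limits. The strict condition on
  \<open>\<bar>t - t'\<bar>\<close> survives approximation; the values reach only the closure, since
  sublevel sets need not be closed.\<close>

lemma continuous_representative_equicontinuous: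
  assumes P: "equicontinuity_set \<delta> C u P" and v: "is_continuous_representative T u v"
  shows "\<And>n t t'. t \<in> {0..T} \<Longrightarrow> t' \<in> {0..T} \<Longrightarrow> \<bar>t - t'\<bar> < \<delta> n \<Longrightarrow> dist (v t) (v t') \<le> 2 * inverse (real (Suc n))"
    and "\<And>t. t \<in> {0..T} \<Longrightarrow> v t \<in> closure {x \<in> M. s x \<le> C}"
proof -
  have P1: "P \<subseteq> {0<..<T}" "AE t in lborel. t \<in> {0<..<T} \<longrightarrow> t \<in> P" "\<And>t. t \<in> P \<Longrightarrow> u t \<in> M \<and> s (u t) \<le> C"
      "\<And>n t t'. t \<in> P \<Longrightarrow> t' \<in> P \<Longrightarrow> \<bar>t - t'\<bar> < \<delta> n \<Longrightarrow> dist (u t) (u t') \<le> 2 * inverse (real (Suc n))"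
    using P unfolding equicontinuity_set_def by blast+
  have v1: "continuous_on {0..T} v" "AE t in lborel. t \<in> {0<..<T} \<longrightarrow> v t = u t"
    using v unfolding is_continuous_representative_def mspace_C0_metric AE_lebesgue_on_iff[OF interval_lebesgue] by blast+
  define Q where "Q = {t \<in> P. v t = u t}"
  have Q: "AE t in lborel. t \<in> {0<..<T} \<longrightarrow> t \<in> Q"
    using P1(2) v1(2) unfolding Q_def by eventually_elim blast
  have QT: "Q \<subseteq> {0..T}" using P1(1) unfolding Q_def by auto
  {
    fix n t t' assume t: "t \<in> {0..T}" "t' \<in> {0..T}" "\<bar>t - t'\<bar> < \<delta> n"
    obtain x where x: "\<And>k::nat. x k \<in> Q" "x \<longlonglongrightarrow> t" "(\<lambda>k. v (x k)) \<longlonglongrightarrow> v t"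
      by (rule conull_sequence[OF T Q QT t(1) v1(1)]) (rule that)
    obtain y where y: "\<And>k::nat. y k \<in> Q" "y \<longlonglongrightarrow> t'" "(\<lambda>k. v (y k)) \<longlonglongrightarrow> v t'"
      by (rule conull_sequence[OF T Q QT t(2) v1(1)]) (rule that)
    have "(\<lambda>k. \<bar>x k - y k\<bar>) \<longlonglongrightarrow> \<bar>t - t'\<bar>" by (intro tendsto_intros x(2) y(2))
    then have "\<forall>\<^sub>F k in sequentially. \<bar>x k - y k\<bar> < \<delta> n" using t(3) by (rule order_tendstoD)
    then have "\<forall>\<^sub>F k in sequentially. dist (v (x k)) (v (y k)) \<le> 2 * inverse (real (Suc n))"
    proof eventually_elim
      case (elim k)
      have "x k \<in> P" "y k \<in> P" "v (x k) = u (x k)" "v (y k) = u (y k)"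
        using x(1)[of k] y(1)[of k] unfolding Q_def by blast+
      then show ?case using P1(4)[of "x k" "y k" n] elim by simp
    qed
    then show "dist (v t) (v t') \<le> 2 * inverse (real (Suc n))"
      by (intro tendsto_upperbound[OF tendsto_dist[OF x(3) y(3)]]) simp_all
  }
  {
    fix t assume t: "t \<in> {0..T}"
    obtain x where x: "\<And>k::nat. x k \<in> Q" "x \<longlonglongrightarrow> t" "(\<lambda>k. v (x k)) \<longlonglongrightarrow> v t"
      by (rule conull_sequence[OF T Q QT t v1(1)]) (rule that)
    have "v (x k) \<in> {x \<in> M. s x \<le> C}" for k
      using x(1)[of k] P1(3)[of "x k"] unfolding Q_def by simp
    with x(3) show "v t \<in> closure {x \<in> M. s x \<le> C}"
      unfolding closure_sequential by (intro exI[of _ "\<lambda>k. v (x k)"]) simp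
  }
qed

text \<open>Continuity permits sampling at the fixed grid points themselves. The error is
  \<open>\<epsilon> / 4\<close> for moving each function to its grid point and
  \<open>\<epsilon> / 2\<close> for two samples with a common centre.\<close>

lemma ex_finite_net_C0:
  assumes inf: "p = \<infinity>" and \<epsilon>: "0 < \<epsilon>"
  defines "V \<equiv> {v. \<exists>u\<in>U. is_continuous_representative T u v}"
  shows "\<exists>K. finite K \<and> K \<subseteq> V \<and> (\<forall>v\<in>V. \<exists>k\<in>K. \<forall>t\<in>{0..T}. dist (v t) (k t) \<le> \<epsilon>)"
proof -
  obtain \<delta> C where \<delta>: "\<And>n. 0 < \<delta> n" "\<And>u. u \<in> U \<Longrightarrow> \<exists>P. equicontinuity_set \<delta> C u P"
    by (rule ex_uniform_equicontinuity[OF inf]) (rule that)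
  have "0 < \<epsilon> / 8" using \<epsilon> by simp
  \<comment> \<open>With the factor 2 of the modulus this makes the oscillation over a cell at most
    \<open>\<epsilon> / 4\<close>.\<close>
  from reals_Archimedean[OF this] obtain n where n: "inverse (real (Suc n)) < \<epsilon> / 8" ..
  obtain N m where m: "0 < m" "T = real N * m" "m < \<delta> n"
    by (rule ex_grid[OF T \<delta>(1)]) (rule that)
  obtain F where F: "finite F" "\<And>x. x \<in> M \<Longrightarrow> s x \<le> C \<Longrightarrow> \<exists>c\<in>F. dist c x < \<epsilon> / 8"
    by (rule cone_sublevel_finite_net[OF compact_embedding \<open>0 < \<epsilon> / 8\<close>]) (rule that)
  \<comment> \<open>The net covers the sublevel set with radius \<open>\<epsilon> / 8\<close>;
    passing to its closure costs another \<open>\<epsilon> / 8\<close>.\<close>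
  have "\<forall>y. \<exists>c. y \<in> closure {x \<in> M. s x \<le> C} \<longrightarrow> c \<in> F \<and> dist c y < \<epsilon> / 4"
  proof
    fix y
    show "\<exists>c. y \<in> closure {x \<in> M. s x \<le> C} \<longrightarrow> c \<in> F \<and> dist c y < \<epsilon> / 4"
    proof (cases "y \<in> closure {x \<in> M. s x \<le> C}")
      case True
      then obtain x where x: "x \<in> M" "s x \<le> C" "dist x y < \<epsilon> / 8"
        unfolding closure_approachable using \<open>0 < \<epsilon> / 8\<close> by blast
      then obtain c where c: "c \<in> F" "dist c x < \<epsilon> / 8" using F(2) by blast
      have "dist c y < \<epsilon> / 4" using dist_triangle[of c y x] x(3) c(2) by linarith
      then show ?thesis using c(1) by blast
    qed blast
  qed
  then obtain c where c: "\<forall>y. y \<in> closure {x \<in> M. s x \<le> C} \<longrightarrow> c y \<in> F \<and> dist (c y) y < \<epsilon> / 4"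
    by (rule choice[THEN exE])
  have V: "dist (v t) (v t') \<le> \<epsilon> / 4" "v t \<in> closure {x \<in> M. s x \<le> C}"
    if v: "v \<in> V" and t: "t \<in> {0..T}" "t' \<in> {0..T}" "\<bar>t - t'\<bar> < \<delta> n" for v t t'
  proof -
    obtain u where u: "u \<in> U" "is_continuous_representative T u v" using v unfolding V_def by blast
    from \<delta>(2)[OF u(1)] obtain P where P: "equicontinuity_set \<delta> C u P" ..
    show "v t \<in> closure {x \<in> M. s x \<le> C}" by (rule continuous_representative_equicontinuous(2)[OF P u(2) t(1)])
    have "dist (v t) (v t') \<le> 2 * inverse (real (Suc n))"
      by (rule continuous_representative_equicontinuous(1)[OF P u(2) t])
    then show "dist (v t) (v t') \<le> \<epsilon> / 4" using n by linarith
  qed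
  have grid: "m * real k \<in> {0..T}" if "k \<le> N" for k
    using that m(1) unfolding m(2) by (auto simp: mult.commute intro: mult_right_mono)
  \<comment> \<open>The index \<open>N\<close> is included because the end point
    \<open>t = T\<close> falls into cell \<open>N\<close>.\<close>
  define lab where "lab v = (\<lambda>k\<in>{..N}. c (v (m * real k)))" for v :: "real \<Rightarrow> 'b"
  show ?thesis
  proof (rule finite_net_of_finite_labels[where lab = lab])
    have "lab ` V \<subseteq> PiE {..N} (\<lambda>_. F)"
    proof (rule image_subsetI)
      fix v assume v: "v \<in> V"
      have "c (v (m * real k)) \<in> F" if "k \<le> N" for k
        using V(2)[OF v grid[OF that] grid[OF that]] \<delta>(1)[of n] c by simp
      then show "lab v \<in> PiE {..N} (\<lambda>_. F)" unfolding lab_def restrict_PiE_iff by blast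
    qed
    then show "finite (lab ` V)" by (rule finite_subset) (intro finite_PiE F(1), simp)
    fix v w assume v: "v \<in> V" and w: "w \<in> V" and eq: "lab v = lab w"
    show "\<forall>t\<in>{0..T}. dist (v t) (w t) \<le> \<epsilon>"
    proof
      fix t assume t: "t \<in> {0..T}"
      define k where "k = nat \<lfloor>t / m\<rfloor>"
      have tm: "0 \<le> t / m" "t / m \<le> real N" using t m(1,2) by (auto simp: field_simps)
      then have k: "k \<le> N" "real k \<le> t / m" "t / m < real k + 1" unfolding k_def by linarith+
      have "m * real k \<le> m * (t / m)" "m * (t / m) < m * (real k + 1)"
        using k(2,3) m(1) by (intro mult_left_mono mult_strict_left_mono; simp)+
      then have "m * real k \<le> t" "t < m * real k + m" using m(1) by (simp_all add: distrib_left)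
      then have close: "\<bar>t - m * real k\<bar> < \<delta> n" using m(3) by linarith
      define x where "x = v (m * real k)"
      define y where "y = w (m * real k)"
      have vx: "dist (v t) x \<le> \<epsilon> / 4" and wy: "dist (w t) y \<le> \<epsilon> / 4"
        unfolding x_def y_def by (rule V(1)[OF v t grid[OF k(1)] close] V(1)[OF w t grid[OF k(1)] close])+
      have "x \<in> closure {x \<in> M. s x \<le> C}" "y \<in> closure {x \<in> M. s x \<le> C}"
        unfolding x_def y_def using V(2)[OF v grid[OF k(1)] grid[OF k(1)]]
          V(2)[OF w grid[OF k(1)] grid[OF k(1)]] \<delta>(1)[of n] by simp_all
      then have "dist (c x) x < \<epsilon> / 4" "dist (c y) y < \<epsilon> / 4" using c by blast+
      moreover have "c x = c y" using fun_cong[OF eq, of k] k(1) unfolding lab_def x_def y_def by simp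
      ultimately have "dist x y \<le> \<epsilon> / 2" using dist_triangle3[of x y "c x"] by simp
      then show "dist (v t) (w t) \<le> \<epsilon>"
        using vx wy dist_triangle[of "v t" "w t" x] dist_triangle[of x "w t" y] dist_commute[of y "w t"] by linarith
    qed
  qed
qed

text \<open>The net of continuous representatives is pulled back by choosing an element of
  \<open>U\<close> for each; equality almost everywhere bounds the essential supremum by the uniform
  distance.\<close>

lemma ex_finite_net_infinity:
  assumes inf: "p = \<infinity>" and \<epsilon>: "0 < \<epsilon>"
  shows "\<exists>K. finite K \<and> K \<subseteq> U \<and> (\<forall>u\<in>U. \<exists>k\<in>K. Lp_norm p {0<..<T} (\<lambda>t. norm (u t - k t)) \<le> ennreal \<epsilon>)"
proof -
  let ?V = "{v. \<exists>u\<in>U. is_continuous_representative T u v}"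
  obtain K where K: "finite K" "K \<subseteq> ?V" "\<forall>v\<in>?V. \<exists>k\<in>K. \<forall>t\<in>{0..T}. dist (v t) (k t) \<le> \<epsilon>"
    using ex_finite_net_C0[OF assms] by blast
  have "\<forall>v. \<exists>u. v \<in> ?V \<longrightarrow> u \<in> U \<and> is_continuous_representative T u v" by blast
  then obtain f where f: "\<forall>v. v \<in> ?V \<longrightarrow> f v \<in> U \<and> is_continuous_representative T (f v) v"
    by (rule choice[THEN exE])
  have "\<exists>k\<in>f ` K. Lp_norm p {0<..<T} (\<lambda>t. norm (u t - k t)) \<le> ennreal \<epsilon>" if u: "u \<in> U" for u
  proof -
    obtain v where v: "is_continuous_representative T u v"
      using ex_continuous_representative[OF inf u] by blast
    then have "v \<in> ?V" using u by blast
    then obtain k where k: "k \<in> K" "\<And>t. t \<in> {0..T} \<Longrightarrow> dist (v t) (k t) \<le> \<epsilon>" using K(3) by blast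
    then have fk: "f k \<in> U" "is_continuous_representative T (f k) k" using f K(2) by blast+
    have m: "(\<lambda>t. norm (u t - f k t)) \<in> borel_measurable (lebesgue_on {0<..<T})"
      by (intro borel_measurable_norm_strongly_measurable[OF interval_lebesgue] strongly_measurable_diff
        U_strongly_measurable(1) u fk(1))
    have "AE t in lborel. t \<in> {0<..<T} \<longrightarrow> v t = u t" "AE t in lborel. t \<in> {0<..<T} \<longrightarrow> k t = f k t"
      using v fk(2) unfolding is_continuous_representative_def AE_lebesgue_on_iff[OF interval_lebesgue] by blast+
    then have "AE t in lborel. t \<in> {0<..<T} \<longrightarrow> \<bar>norm (u t - f k t)\<bar> \<le> \<epsilon>"
    proof eventually_elim
      case (elim t)
      show ?case
      proof
        assume "t \<in> {0<..<T}"
        then have "v t = u t" "k t = f k t" "dist (v t) (k t) \<le> \<epsilon>" using elim k(2)[of t] by auto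
        then show "\<bar>norm (u t - f k t)\<bar> \<le> \<epsilon>" by (simp add: dist_norm)
      qed
    qed
    then have "Lp_norm p {0<..<T} (\<lambda>t. norm (u t - f k t)) \<le> ennreal \<epsilon>"
      unfolding Lp_norm_infinity_le_iff[OF inf m less_imp_le[OF \<epsilon>]] AE_lebesgue_on_iff[OF interval_lebesgue] .
    then show ?thesis using k(1) by blast
  qed
  moreover have "f ` K \<subseteq> U" using f K(2) by blast
  ultimately show ?thesis using K(1) by blast
qed

end

theorem theorem1:
  fixes T :: real
    and p :: ennreal
    and iB :: "'b::banach \<Rightarrow> 'v::real_vector"
    and iY :: "'y::banach \<Rightarrow> 'v"
    and M :: "'b set"
    and s :: "'b \<Rightarrow> real"
    and U :: "(real \<Rightarrow> 'b) set"
  assumes "T > 0"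
    and "1 \<le> p"
    and "linear iB" "inj iB" "linear iY" "inj iY"
    and "seminormed_nonneg_cone M s"
    and "iB ` M \<inter> range iY \<noteq> {}"
    and compact_embedding: "cone_compactly_embedded M s"
    and compatible: "\<And>(w :: nat \<Rightarrow> 'b) w0.
           w \<longlonglongrightarrow> w0 \<Longrightarrow> (\<And>n. lies_in_Y iB iY (w n)) \<Longrightarrow>
           (\<lambda>n. as_Y iB iY (w n)) \<longlonglongrightarrow> 0 \<Longrightarrow> w0 = 0"
    and subset: "U \<subseteq> Lp_cone p {0<..<T} M s \<inter> Lp_in_Y iB iY p {0<..<T}"
    and bounded: "\<exists>C::real. \<forall>u\<in>U. Lp_norm p {0<..<T} (\<lambda>t. s (u t)) \<le> ennreal C"
    and shifts: "\<And>\<epsilon>::real. \<epsilon> > 0 \<Longrightarrow>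
           \<forall>\<^sub>F h in at_right 0. \<forall>u\<in>U.
             Lp_norm p {0<..<T - h} (\<lambda>t. norm (as_Y iB iY (u (t + h)) - as_Y iB iY (u t)))
               \<le> ennreal \<epsilon>"
  shows "relatively_compact_in (Lp_topology p {0<..<T}) U \<and>
         (p = \<infinity> \<longrightarrow>
            (\<forall>u\<in>U. \<exists>v. is_continuous_representative T u v) \<and>
            relatively_compact_in (mtopology_of (C0_metric T))
              {v. \<exists>u\<in>U. is_continuous_representative T u v})"
proof -
  interpret Aubin_Lions_cone T p iB iY M s U
  proof (rule Aubin_Lions_cone.intro)
    show "w0 = 0" if "w \<longlonglongrightarrow> w0" "\<And>n. lies_in_Y iB iY (w n)" "(\<lambda>n. as_Y iB iY (w n)) \<longlonglongrightarrow> 0" for w w0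
      using that by (rule compatible)
  qed (fact assms)+
  have "\<exists>K. finite K \<and> K \<subseteq> U \<and> (\<forall>u\<in>U. \<exists>k\<in>K. Lp_norm p {0<..<T} (\<lambda>t. norm (u t - k t)) \<le> ennreal \<epsilon>)"
    if "\<epsilon> > 0" for \<epsilon> :: real
    using ex_finite_net_finite_exponent ex_finite_net_infinity that by blast
  then have "relatively_compact_in (Lp_topology p {0<..<T}) U"
    by (intro relatively_compact_in_Lp_topology p U_subset_Lp_space) simp_all
  moreover have "relatively_compact_in (mtopology_of (C0_metric T)) {v. \<exists>u\<in>U. is_continuous_representative T u v}"
    if "p = \<infinity>"
    by (intro relatively_compact_in_C0 ex_finite_net_C0[OF that])
      (auto simp: is_continuous_representative_def)
  ultimately show ?thesis using ex_continuous_representative by blast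
qed

end
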